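(* Let $0<\alpha<1$. Assume that $b$ is a Gaussian field which belongs to $C^\alpha(D)$ almost surely and such that $\mathbb{E}(\|b\|_{C^\alpha}^k)<\infty$ for all $k<\infty$. Suppose that the spaces $(V_h)_{h>0}$ satisfy, for some constants $C_0>0$ and $t>0$, $$\min_{v_h\in V_h}\|v-v_h\|_V\le C_0\, n_h^{-t}\|v\|_W,\qquad v\in W,\ h>0.$$ Then there exists $C>0$ such that for any $h>0$, $$\|u-u_h\|_{\mathcal{V}_2}\le C\,n_h^{-\alpha t}.$$
   Context: $D\subset\mathbb{R}^d$, $d\in\{1,2,3\}$, is a bounded Lipschitz domain, $f\in L^2(D)$, and $V:=H^1_0(D)$ with norm $\|v\|_V:=\|\nabla v\|_{L^2(D)}$. $U:=\mathbb{R}^{\mathbb{N}}$ is equipped with the $\sigma$-algebra generated by the Borel cylinders and with the countable tensor product $\gamma$ of the standard Gaussian measures $N(0,1)$ on $\mathbb{R}$; $\mathbb{E}$ and "almost surely" refer to $\gamma$. $b$ is a centered Gaussian process on $D$ with parametric expansion $b(y)=\sum_{j\ge1}y_j\psi_j$, where $y=(y_j)_{j\ge1}\in U$ (so the $y_j$ are independent standard Gaussian variables under $\gamma$) and $\psi_j:D\to\mathbb{R}$ are given functions. The diffusion coefficient is $a(y):=\exp(b(y))$. For every $y$ such that $b(y)\in L^\infty(D)$, $u(y)\in V$ is the unique solution of $\int_D a(y)\nabla u(y)\cdot\nabla v=\int_D fv$ for all $v\in V$. $(V_h)_{h>0}$ is a family of finite-dimensional subspaces of $V$, with $n_h:=\dim(V_h)\to\infty$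 as $h\to0$, and $u_h(y)\in V_h$ is the Galerkin approximation defined by $\int_D a(y)\nabla u_h(y)\cdot\nabla v_h=\int_D fv_h$ for all $v_h\in V_h$. $C^\alpha(D)$ has norm $\|b\|_{C^\alpha}:=\|b\|_{L^\infty}+\sup_{x_1\ne x_2\in D}\frac{|b(x_1)-b(x_2)|}{|x_1-x_2|^\alpha}$. $W:=\{v\in V:\Delta v\in L^2(D)\}$ with norm $\|v\|_W:=\|\Delta v\|_{L^2(D)}$. $\mathcal{V}_2:=L^2(U,V,\gamma)$ is the Bochner space with norm $\|v\|_{\mathcal{V}_2}^2=\int_U\|v(y)\|_V^2\,d\gamma(y)$. *)

theory Defs
  imports "HOL-Probability.Probability"
begin

text \<open>
  Elements of \<open>L\<^sup>2(D)\<close>, \<open>H\<^sup>1(D)\<close> and their subspaces are represented by functions on the whole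
  Euclidean space, of which only the values on \<open>D\<close> matter; two representatives are identified
  when they agree almost everywhere on \<open>D\<close>. All integrals over \<open>D\<close> are Lebesgue integrals.
\<close>

section \<open>Domains\<close>

text \<open>
  Near each boundary point, \<open>D\<close> is the strict epigraph, in some direction \<open>e\<close>, of a Lipschitz
  function \<open>g\<close> on the hyperplane orthogonal to \<open>e\<close>.
\<close>

definition lipschitz_domain :: "'a::euclidean_space set \<Rightarrow> bool" where
  "lipschitz_domain D \<longleftrightarrow> open D \<and> connected D \<and> D \<noteq> {} \<and>
     (\<forall>p\<in>frontier D. \<exists>r>0. \<exists>e. norm e = 1 \<and>
        (\<exists>L g. L-lipschitz_on {z. z \<bullet> e = 0} g \<and>
           D \<inter> ball p r = {z \<in> ball p r. g (z - (z \<bullet> e) *\<^sub>R e) < z \<bullet> e}))"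

section \<open>Lebesgue and Sobolev spaces\<close>

definition L2 :: "'a::euclidean_space set \<Rightarrow> ('a \<Rightarrow> 'b::euclidean_space) set" where
  "L2 D = {v. v \<in> borel_measurable (lebesgue_on D) \<and>
              integrable (lebesgue_on D) (\<lambda>x. (norm (v x))\<^sup>2)}"

definition L2_norm :: "'a::euclidean_space set \<Rightarrow> ('a \<Rightarrow> 'b::euclidean_space) \<Rightarrow> real" where
  "L2_norm D v = sqrt (LINT x|lebesgue_on D. (norm (v x))\<^sup>2)"

definition Linf_norm :: "'a::euclidean_space set \<Rightarrow> ('a \<Rightarrow> real) \<Rightarrow> ereal" where
  "Linf_norm D v = esssup (lebesgue_on D) (\<lambda>x. ereal \<bar>v x\<bar>)"

definition Linf :: "'a::euclidean_space set \<Rightarrow> ('a \<Rightarrow> real) set" where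
  "Linf D = {v. v \<in> borel_measurable (lebesgue_on D) \<and> Linf_norm D v < \<infinity>}"

definition grad :: "('a::euclidean_space \<Rightarrow> real) \<Rightarrow> 'a \<Rightarrow> 'a" where
  "grad \<phi> x = (\<Sum>i\<in>Basis. frechet_derivative \<phi> (at x) i *\<^sub>R i)"

fun Ck :: "nat \<Rightarrow> ('a::euclidean_space \<Rightarrow> real) \<Rightarrow> bool" where
  "Ck 0 \<phi> \<longleftrightarrow> continuous_on UNIV \<phi>"
| "Ck (Suc k) \<phi> \<longleftrightarrow> (\<forall>x. \<phi> differentiable (at x)) \<and> (\<forall>i\<in>Basis. Ck k (\<lambda>x. grad \<phi> x \<bullet> i))"

definition test_functions :: "'a::euclidean_space set \<Rightarrow> ('a \<Rightarrow> real) set" where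
  "test_functions D = {\<phi>. (\<forall>k. Ck k \<phi>) \<and> (\<exists>K. compact K \<and> K \<subseteq> D \<and> (\<forall>x. x \<notin> K \<longrightarrow> \<phi> x = 0))}"

definition is_weak_grad :: "'a::euclidean_space set \<Rightarrow> ('a \<Rightarrow> real) \<Rightarrow> ('a \<Rightarrow> 'a) \<Rightarrow> bool" where
  "is_weak_grad D v G \<longleftrightarrow> G \<in> L2 D \<and>
     (\<forall>\<phi>\<in>test_functions D.
        (LINT x|lebesgue_on D. v x *\<^sub>R grad \<phi> x) = - (LINT x|lebesgue_on D. \<phi> x *\<^sub>R G x))"

definition H1 :: "'a::euclidean_space set \<Rightarrow> ('a \<Rightarrow> real) set" where
  "H1 D = {v \<in> L2 D. \<exists>G. is_weak_grad D v G}"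

text \<open>The choice is unique up to a null set of \<open>D\<close>.\<close>

definition weak_grad :: "'a::euclidean_space set \<Rightarrow> ('a \<Rightarrow> real) \<Rightarrow> 'a \<Rightarrow> 'a" where
  "weak_grad D v = (SOME G. is_weak_grad D v G)"

text \<open>\<open>H\<^sup>1\<^sub>0(D)\<close> is the closure of the test functions in \<open>H\<^sup>1(D)\<close>.\<close>

definition H10 :: "'a::euclidean_space set \<Rightarrow> ('a \<Rightarrow> real) set" where
  "H10 D = {v \<in> H1 D. \<exists>\<phi>. (\<forall>n. \<phi> n \<in> test_functions D) \<and>
     (\<lambda>n. L2_norm D (\<lambda>x. v x - \<phi> n x)) \<longlonglongrightarrow> 0 \<and>
     (\<lambda>n. L2_norm D (\<lambda>x. weak_grad D v x - grad (\<phi> n) x)) \<longlonglongrightarrow> 0}"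

definition V_norm :: "'a::euclidean_space set \<Rightarrow> ('a \<Rightarrow> real) \<Rightarrow> real" where
  "V_norm D v = L2_norm D (weak_grad D v)"

text \<open>\<open>\<Delta>v\<close> is the distributional divergence of the weak gradient.\<close>

definition is_weak_laplacian :: "'a::euclidean_space set \<Rightarrow> ('a \<Rightarrow> real) \<Rightarrow> ('a \<Rightarrow> real) \<Rightarrow> bool" where
  "is_weak_laplacian D v g \<longleftrightarrow> g \<in> L2 D \<and>
     (\<forall>\<phi>\<in>test_functions D.
        (LINT x|lebesgue_on D. weak_grad D v x \<bullet> grad \<phi> x) = - (LINT x|lebesgue_on D. g x * \<phi> x))"

definition weak_laplacian :: "'a::euclidean_space set \<Rightarrow> ('a \<Rightarrow> real) \<Rightarrow> 'a \<Rightarrow> real" where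
  "weak_laplacian D v = (SOME g. is_weak_laplacian D v g)"

definition W_space :: "'a::euclidean_space set \<Rightarrow> ('a \<Rightarrow> real) set" where
  "W_space D = {v \<in> H10 D. \<exists>g. is_weak_laplacian D v g}"

definition W_norm :: "'a::euclidean_space set \<Rightarrow> ('a \<Rightarrow> real) \<Rightarrow> real" where
  "W_norm D v = L2_norm D (weak_laplacian D v)"

text \<open>The Hoelder norm, equal to \<open>\<infinity>\<close> outside \<open>C\<^sup>\<alpha>(D)\<close>.\<close>

definition holder_norm :: "'a::euclidean_space set \<Rightarrow> real \<Rightarrow> ('a \<Rightarrow> real) \<Rightarrow> ennreal" where
  "holder_norm D \<alpha> v = e2ennreal (Linf_norm D v) +
     (SUP (x1, x2) \<in> {(x1, x2). x1 \<in> D \<and> x2 \<in> D \<and> x1 \<noteq> x2}.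
        ennreal (\<bar>v x1 - v x2\<bar> / norm (x1 - x2) powr \<alpha>))"

definition holder_space :: "'a::euclidean_space set \<Rightarrow> real \<Rightarrow> ('a \<Rightarrow> real) set" where
  "holder_space D \<alpha> = {v. holder_norm D \<alpha> v < \<infinity>}"

section \<open>Finite-dimensional subspaces and Galerkin solutions\<close>

text \<open>
  \<open>S\<close> represents an \<open>n\<close>-dimensional subspace of \<open>H\<^sup>1\<^sub>0(D)\<close>: linear independence and spanning are
  understood modulo equality almost everywhere. \<open>S\<close> need not contain every representative of its
  elements, so it may consist, for instance, of continuous finite element functions only.
\<close>

definition subspace_of_dim :: "'a::euclidean_space set \<Rightarrow> ('a \<Rightarrow> real) set \<Rightarrow> nat \<Rightarrow> bool" where
  "subspace_of_dim D S n \<longleftrightarrow> S \<subseteq> H10 D \<and>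
     (\<lambda>x. 0) \<in> S \<and>
     (\<forall>v\<in>S. \<forall>w\<in>S. (\<lambda>x. v x + w x) \<in> S) \<and>
     (\<forall>c. \<forall>v\<in>S. (\<lambda>x. c * v x) \<in> S) \<and>
     (\<exists>\<phi>. (\<forall>i<n. \<phi> i \<in> S) \<and>
        (\<forall>c. (AE x in lebesgue_on D. (\<Sum>i<n. c i * \<phi> i x) = 0) \<longrightarrow> (\<forall>i<n. c i = 0)) \<and>
        (\<forall>v\<in>S. \<exists>c. AE x in lebesgue_on D. v x = (\<Sum>i<n. c i * \<phi> i x)))"

text \<open>
  Galerkin solution in \<open>S\<close> for the diffusion coefficient \<open>a\<close> and the load \<open>f\<close>; for \<open>S = H10 D\<close> this
  is the weak solution of the Dirichlet problem.
\<close>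

definition galerkin_solution ::
    "'a::euclidean_space set \<Rightarrow> ('a \<Rightarrow> real) set \<Rightarrow> ('a \<Rightarrow> real) \<Rightarrow> ('a \<Rightarrow> real) \<Rightarrow> ('a \<Rightarrow> real) \<Rightarrow> bool" where
  "galerkin_solution D S a f u \<longleftrightarrow> u \<in> S \<and>
     (\<forall>v\<in>S. (LINT x|lebesgue_on D. a x * (weak_grad D u x \<bullet> weak_grad D v x)) =
             (LINT x|lebesgue_on D. f x * v x))"

section \<open>The Gaussian parameter space\<close>

text \<open>The parameters \<open>y\<^sub>1, y\<^sub>2, \<dots>\<close> are indexed from 0.\<close>

definition gauss :: "(nat \<Rightarrow> real) measure" where
  "gauss = PiM UNIV (\<lambda>_. density lborel std_normal_density)"

text \<open>Degenerate marginals, of variance zero, are allowed.\<close>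

definition centered_gaussian_process ::
    "'b measure \<Rightarrow> 'a set \<Rightarrow> ('b \<Rightarrow> 'a \<Rightarrow> real) \<Rightarrow> bool" where
  "centered_gaussian_process M D X \<longleftrightarrow>
     (\<forall>x\<in>D. (\<lambda>\<omega>. X \<omega> x) \<in> borel_measurable M) \<and>
     (\<forall>F c. finite F \<and> F \<subseteq> D \<longrightarrow>
        (\<exists>\<sigma>\<ge>0. distr M borel (\<lambda>\<omega>. \<Sum>x\<in>F. c x * X \<omega> x) =
           (if \<sigma> = 0 then return borel 0 else density lborel (normal_density 0 \<sigma>))))"

section \<open>Bochner space\<close>

text \<open>
  Strong measurability of \<open>v : \<Omega> \<rightarrow> H\<^sup>1\<^sub>0(D)\<close>: \<open>v\<close> is almost everywhere the limit of simple functions.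
  It does not depend on the values of \<open>v\<close> on a null set; neither does the \<open>nn_integral\<close> below.
\<close>

definition strongly_measurable ::
    "'b measure \<Rightarrow> 'a::euclidean_space set \<Rightarrow> ('b \<Rightarrow> 'a \<Rightarrow> real) \<Rightarrow> bool" where
  "strongly_measurable M D v \<longleftrightarrow> (AE \<omega> in M. v \<omega> \<in> H10 D) \<and>
     (\<exists>s. (\<forall>n. simple_function M (s n) \<and> (\<forall>\<omega>\<in>space M. s n \<omega> \<in> H10 D)) \<and>
          (AE \<omega> in M. (\<lambda>n. V_norm D (\<lambda>x. v \<omega> x - s n \<omega> x)) \<longlonglongrightarrow> 0))"

definition bochner_L2 ::
    "'b measure \<Rightarrow> 'a::euclidean_space set \<Rightarrow> ('b \<Rightarrow> 'a \<Rightarrow> real) set" where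
  "bochner_L2 M D = {v. strongly_measurable M D v \<and>
     (\<integral>\<^sup>+\<omega>. ennreal ((V_norm D (v \<omega>))\<^sup>2) \<partial>M) < \<infinity>}"

definition bochner_L2_norm ::
    "'b measure \<Rightarrow> 'a::euclidean_space set \<Rightarrow> ('b \<Rightarrow> 'a \<Rightarrow> real) \<Rightarrow> real" where
  "bochner_L2_norm M D v = sqrt (enn2real (\<integral>\<^sup>+\<omega>. ennreal ((V_norm D (v \<omega>))\<^sup>2) \<partial>M))"

end

theory Submission
  imports Defs
begin

text \<open>
  The theorem is first proved for a fixed parameter \<open>y\<close>. Let \<open>B\<close> bound both \<open>b(y)\<close> and its Hoelder
  constant on \<open>D\<close>. The solution \<open>u(y)\<close> need not lie in \<open>W\<close>, since the coefficient is not differentiable.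
  So let \<open>\<delta> = n\<^sub>h powr (- t)\<close> and mollify \<open>b(y)\<close> at the scale \<open>\<delta>\<close>. This gives a smooth \<open>\<beta>\<close> with
  \<open>\<bar>\<beta> - b(y)\<bar> \<le> B \<delta> powr \<alpha>\<close> and \<open>\<bar>grad \<beta>\<bar>\<close> of order \<open>B \<delta> powr (\<alpha> - 1)\<close> (\<open>mollification\<close>). Let \<open>w\<close> be
  the solution with the coefficient \<open>exp \<beta>\<close>; it exists by \<open>galerkin_exists\<close>. Perturbing the coefficient
  changes the solution by at most a multiple, depending on \<open>B\<close>, of \<open>\<delta> powr \<alpha>\<close> (\<open>galerkin_stability\<close>). On the other hand
  \<open>- \<Delta> w = exp (- \<beta>) f + grad \<beta> \<bullet> grad w\<close> is square integrable with norm of order \<open>\<delta> powr (\<alpha> - 1)\<close>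
  (\<open>smooth_coefficient_regularity\<close>), so \<open>V\<^sub>h\<close> approximates \<open>w\<close> up to \<open>n\<^sub>h powr (- t) \<delta> powr (\<alpha> - 1)\<close>, which is
  \<open>\<delta> powr \<alpha>\<close> again. With Cea's lemma, \<open>\<parallel>u(y) - u\<^sub>h(y)\<parallel> \<le> K exp (8 B) \<delta> powr \<alpha>\<close>
  (\<open>galerkin_holder_error\<close>). In effect \<open>w\<close> realises an interpolation between \<open>V\<close> and \<open>W\<close>.

  Taking mean squares requires the expectation of \<open>exp (16 B)\<close> to be finite. For a general random
  variable this does not follow from finite moments of all orders; here it is a consequence of
  Gaussianity, in the spirit of Fernique's theorem. If \<open>y\<close> and \<open>z\<close> are independent, then \<open>(y + z) / sqrt 2\<close>
  and \<open>(y - z) / sqrt 2\<close> are independent with the same law (\<open>rotate_pair_distr\<close>). Since \<open>b\<close> is linear in \<open>y\<close>,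
  the norm \<open>r\<close> of \<open>b(y)\<close> is at most \<open>1 / sqrt 2\<close> times the sum of two independent copies of itself. For its
  moments \<open>m\<^sub>k\<close> this gives \<open>(sqrt 2 ^ k - 2) m\<^sub>k \<le> \<Sum>\<^sub>0\<^sub><\<^sub>j\<^sub><\<^sub>k (k choose j) m\<^sub>j m\<^sub>k\<^sub>-\<^sub>j\<close>, hence \<open>m\<^sub>k / k!\<close> grows at most
  geometrically and a small exponential moment is finite; the same inequality for exponentials
  enlarges the exponent arbitrarily (\<open>exp_moment_finite\<close>).

  Strong measurability holds because the solution depends continuously on the field in the supremum
  norm, and a Hoelder continuous field on a bounded set is known up to a small uniform error from
  finitely many rounded point values (\<open>strongly_measurable_of_field\<close>).
\<close>

section \<open>Smooth functions\<close>

lemma grad_eqI: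
  assumes "(\<phi> has_derivative (\<lambda>h. g \<bullet> h)) (at x)"
  shows "grad \<phi> x = g"
proof -
  have "frechet_derivative \<phi> (at x) = (\<lambda>h. g \<bullet> h)"
    using assms by (rule frechet_derivative_at[symmetric])
  then show ?thesis unfolding grad_def by (simp add: euclidean_representation)
qed

lemma has_derivative_grad:
  fixes \<phi> :: "'a::euclidean_space \<Rightarrow> real"
  assumes "\<phi> differentiable (at x)"
  shows "(\<phi> has_derivative (\<lambda>h. grad \<phi> x \<bullet> h)) (at x)"
proof -
  let ?L = "frechet_derivative \<phi> (at x)"
  have d: "(\<phi> has_derivative ?L) (at x)"
    using assms frechet_derivative_works by blast
  then have lin: "linear ?L" by (rule has_derivative_linear)
  have "?L h = grad \<phi> x \<bullet> h" for h
  proof -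
    have "?L h = ?L (\<Sum>i\<in>Basis. (h \<bullet> i) *\<^sub>R i)" by (simp add: euclidean_representation)
    also have "\<dots> = (\<Sum>i\<in>Basis. (h \<bullet> i) * ?L i)"
      by (simp add: linear_sum[OF lin] linear_cmul[OF lin])
    also have "\<dots> = grad \<phi> x \<bullet> h"
      unfolding grad_def inner_sum_left by (intro sum.cong) (simp_all add: inner_commute)
    finally show ?thesis .
  qed
  then have "?L = (\<lambda>h. grad \<phi> x \<bullet> h)" by blast
  with d show ?thesis by simp
qed

lemma Ck_SucI:
  assumes "\<And>x. (\<phi> has_derivative (\<lambda>h. g x \<bullet> h)) (at x)"
    and "\<And>i. i \<in> Basis \<Longrightarrow> Ck k (\<lambda>x. g x \<bullet> i)"
  shows "Ck (Suc k) \<phi>"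
proof -
  have "grad \<phi> = g" using grad_eqI[OF assms(1)] by blast
  then show ?thesis using assms by (auto simp: differentiable_def)
qed

lemma Ck_SucD_derivative: "Ck (Suc k) \<phi> \<Longrightarrow> (\<phi> has_derivative (\<lambda>h. grad \<phi> x \<bullet> h)) (at x)"
  by (simp add: has_derivative_grad)

lemma Ck_SucD_grad: "Ck (Suc k) \<phi> \<Longrightarrow> i \<in> Basis \<Longrightarrow> Ck k (\<lambda>x. grad \<phi> x \<bullet> i)"
  by simp

lemma Ck_continuous: "Ck k \<phi> \<Longrightarrow> continuous_on UNIV \<phi>"
  by (cases k) (auto intro: continuous_at_imp_continuous_on differentiable_imp_continuous_within)

lemma Ck_pred: "Ck (Suc k) \<phi> \<Longrightarrow> Ck k \<phi>"
proof (induction k arbitrary: \<phi>)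
  case 0 then show ?case using Ck_continuous Ck.simps(1) by blast
next
  case (Suc k) then show ?case by (metis Ck.simps(2))
qed

lemma Ck_grad_continuous:
  assumes "Ck (Suc k) \<phi>" shows "continuous_on UNIV (grad \<phi>)"
  unfolding continuous_on_componentwise[of UNIV "grad \<phi>"]
  using Ck_continuous[OF Ck_SucD_grad[OF assms]] by blast

lemma Ck_const: "Ck k (\<lambda>x. c)"
proof (induction k arbitrary: c)
  case (Suc k) show ?case by (rule Ck_SucI[where g = "\<lambda>x. 0"]) (auto simp: Suc)
qed simp

lemma Ck_inner_const: "Ck k (\<lambda>x. x \<bullet> c)"
proof (cases k)
  case (Suc j) show ?thesis unfolding Suc
    by (rule Ck_SucI[where g = "\<lambda>x. c"]) (auto intro!: Ck_const derivative_eq_intros simp: inner_commute)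
qed (auto intro!: continuous_intros)

lemma Ck_add: "Ck k \<phi> \<Longrightarrow> Ck k \<eta> \<Longrightarrow> Ck k (\<lambda>x. \<phi> x + \<eta> x)"
proof (induction k arbitrary: \<phi> \<eta>)
  case 0 then show ?case by (auto intro!: continuous_intros)
next
  case (Suc k) show ?case
  proof (rule Ck_SucI[where g = "\<lambda>x. grad \<phi> x + grad \<eta> x"])
    fix x show "((\<lambda>x. \<phi> x + \<eta> x) has_derivative (\<bullet>) (grad \<phi> x + grad \<eta> x)) (at x)"
      by (rule has_derivative_eq_rhs[OF has_derivative_add[OF
            Ck_SucD_derivative[OF Suc.prems(1)] Ck_SucD_derivative[OF Suc.prems(2)]]])
         (simp add: inner_add_left fun_eq_iff)
  next
    fix i :: 'a assume "i \<in> Basis"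
    then show "Ck k (\<lambda>x. (grad \<phi> x + grad \<eta> x) \<bullet> i)"
      using Suc.IH[OF Ck_SucD_grad[OF Suc.prems(1)] Ck_SucD_grad[OF Suc.prems(2)]]
      by (simp add: inner_add_left)
  qed
qed

lemma has_derivative_mult_grad:
  assumes "(\<phi> has_derivative (\<lambda>h. g \<bullet> h)) (at x)" "(\<eta> has_derivative (\<lambda>h. g' \<bullet> h)) (at x)"
  shows "((\<lambda>x. \<phi> x * \<eta> x) has_derivative (\<lambda>h. (\<phi> x *\<^sub>R g' + \<eta> x *\<^sub>R g) \<bullet> h)) (at x)"
  using has_derivative_mult[OF assms] by (simp add: inner_add_left algebra_simps)

lemma Ck_mult: "Ck k \<phi> \<Longrightarrow> Ck k \<eta> \<Longrightarrow> Ck k (\<lambda>x. \<phi> x * \<eta> x)"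
proof (induction k arbitrary: \<phi> \<eta>)
  case 0 then show ?case by (auto intro!: continuous_intros)
next
  case (Suc k) show ?case
  proof (rule Ck_SucI[where g = "\<lambda>x. \<phi> x *\<^sub>R grad \<eta> x + \<eta> x *\<^sub>R grad \<phi> x"])
    fix i :: 'a assume i: "i \<in> Basis"
    have "Ck k (\<lambda>x. \<phi> x * (grad \<eta> x \<bullet> i) + \<eta> x * (grad \<phi> x \<bullet> i))"
      by (intro Ck_add Suc.IH Ck_pred[OF Suc.prems(1)] Ck_pred[OF Suc.prems(2)]
          Ck_SucD_grad[OF Suc.prems(1) i] Ck_SucD_grad[OF Suc.prems(2) i])
    then show "Ck k (\<lambda>x. (\<phi> x *\<^sub>R grad \<eta> x + \<eta> x *\<^sub>R grad \<phi> x) \<bullet> i)" by (simp add: inner_add_left)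
  qed (intro has_derivative_mult_grad Ck_SucD_derivative[OF Suc.prems(1)] Ck_SucD_derivative[OF Suc.prems(2)])
qed

lemma Ck_cmult: "Ck k \<phi> \<Longrightarrow> Ck k (\<lambda>x. c * \<phi> x)"
  by (intro Ck_mult Ck_const)

lemma Ck_diff: "Ck k \<phi> \<Longrightarrow> Ck k \<eta> \<Longrightarrow> Ck k (\<lambda>x. \<phi> x - \<eta> x)"
  using Ck_add[OF _ Ck_cmult[of k \<eta> "-1"]] by simp

lemma Ck_sum: "finite I \<Longrightarrow> (\<And>i. i \<in> I \<Longrightarrow> Ck k (\<phi> i)) \<Longrightarrow> Ck k (\<lambda>x. \<Sum>i\<in>I. \<phi> i x)"
  by (induction I rule: finite_induct) (auto intro: Ck_const Ck_add)

lemma Ck_prod: "finite I \<Longrightarrow> (\<And>i. i \<in> I \<Longrightarrow> Ck k (\<phi> i)) \<Longrightarrow> Ck k (\<lambda>x. \<Prod>i\<in>I. \<phi> i x)"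
  by (induction I rule: finite_induct) (auto intro: Ck_const Ck_mult)

text \<open>
  All outer functions are treated at once, because the chain rule replaces \<open>h\<close> by its derivative in the
  inductive step.
\<close>

lemma Ck_compose:
  fixes h :: "real \<Rightarrow> real"
  shows "Ck k h \<Longrightarrow> Ck k \<phi> \<Longrightarrow> Ck k (\<lambda>x. h (\<phi> x))"
proof (induction k arbitrary: h)
  case 0 then show ?case by (auto intro: continuous_on_compose2)
next
  case (Suc k) show ?case
  proof (rule Ck_SucI[where g = "\<lambda>x. grad h (\<phi> x) *\<^sub>R grad \<phi> x"])
    fix x show "((\<lambda>x. h (\<phi> x)) has_derivative (\<bullet>) (grad h (\<phi> x) *\<^sub>R grad \<phi> x)) (at x)"
      by (rule has_derivative_eq_rhs[OF has_derivative_compose[OF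
            Ck_SucD_derivative[OF Suc.prems(2)] Ck_SucD_derivative[OF Suc.prems(1)]]])
         (simp add: fun_eq_iff)
  next
    fix i :: 'a assume i: "i \<in> Basis"
    have "Ck k (\<lambda>x. grad h (\<phi> x) * (grad \<phi> x \<bullet> i))"
      using Ck_SucD_grad[OF Suc.prems(1), of 1]
      by (intro Ck_mult Suc.IH[where h = "grad h"] Ck_pred[OF Suc.prems(2)] Ck_SucD_grad[OF Suc.prems(2) i]) auto
    then show "Ck k (\<lambda>x. (grad h (\<phi> x) *\<^sub>R grad \<phi> x) \<bullet> i)" by simp
  qed
qed

lemma Ck_real_SucI:
  fixes h :: "real \<Rightarrow> real"
  assumes "\<And>x. (h has_real_derivative h' x) (at x)" "Ck k h'"
  shows "Ck (Suc k) h"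
  by (rule Ck_SucI[where g = h']) (use assms in \<open>auto simp: has_field_derivative_def\<close>)

lemma Ck_exp_real: "Ck k (exp :: real \<Rightarrow> real)"
proof (induction k)
  case (Suc k) show ?case by (rule Ck_real_SucI[OF DERIV_exp Suc])
qed (auto intro: continuous_intros)

lemmas Ck_exp = Ck_compose[OF Ck_exp_real]

text \<open>
  \<open>flat_exp 0\<close> is the classical smooth function that vanishes exactly on the nonpositive half-line. The
  factors \<open>1 / x ^ m\<close> make the family closed under differentiation up to linear combinations, so that
  smoothness of all its members follows by one induction.
\<close>

definition flat_exp :: "nat \<Rightarrow> real \<Rightarrow> real" where
  "flat_exp m x = (if x > 0 then exp (- 1 / x) / x ^ m else 0)"

lemma flat_exp_nonneg: "0 \<le> flat_exp m x" by (simp add: flat_exp_def)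

lemma flat_exp_pos: "x > 0 \<Longrightarrow> 0 < flat_exp m x" by (simp add: flat_exp_def)

lemma flat_exp_eq_0: "x \<le> 0 \<Longrightarrow> flat_exp m x = 0" by (simp add: flat_exp_def)

lemma flat_exp_0_le_1: "flat_exp 0 x \<le> 1" by (simp add: flat_exp_def)

lemma flat_exp_mono_0: "x \<le> y \<Longrightarrow> flat_exp 0 x \<le> flat_exp 0 y"
  by (auto simp: flat_exp_def frac_le)

text \<open>
  For \<open>x > 0\<close>, the exponential series at \<open>1 / x\<close> dominates its term of order \<open>m + 1\<close>. The bound gives the
  derivative at \<open>0\<close> and, with \<open>m = 2\<close>, bounds the gradient of the mollifier.
\<close>

lemma flat_exp_le: "\<bar>flat_exp m x\<bar> \<le> fact (Suc m) * \<bar>x\<bar>"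
proof (cases "x > 0")
  case True
  have "(1 / x) ^ Suc m / fact (Suc m) \<le> (\<Sum>k. (1 / x) ^ k / fact k)"
  proof -
    have s: "summable (\<lambda>k. (1 / x) ^ k / fact k)"
      using summable_exp_generic[of "1/x"] by (simp add: field_simps)
    have "(\<Sum>k\<in>{Suc m}. (1 / x) ^ k / fact k) \<le> (\<Sum>k. (1 / x) ^ k / fact k)"
      by (rule sum_le_suminf[OF s]) (use True in auto)
    then show ?thesis by simp
  qed
  also have "\<dots> = exp (1 / x)" by (simp add: exp_def field_simps)
  finally have "1 / (x ^ Suc m * fact (Suc m)) \<le> exp (1 / x)"
    by (simp only: power_one_over divide_divide_eq_left)
  then have "1 \<le> exp (1 / x) * (x ^ Suc m * fact (Suc m))"
    by (subst (asm) pos_divide_le_eq) (use True in auto)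
  then have "exp (- (1 / x)) * 1 \<le> exp (- (1 / x)) * (exp (1 / x) * (x ^ Suc m * fact (Suc m)))"
    by (intro mult_left_mono) auto
  also have "\<dots> = x ^ Suc m * fact (Suc m)"
    by (simp only: mult.assoc[symmetric] exp_add[symmetric]) simp
  finally have "exp (- 1 / x) \<le> x ^ Suc m * fact (Suc m)" by simp
  then have "exp (- 1 / x) / x ^ m \<le> x * fact (Suc m)"
    using True by (simp add: field_simps)
  then show ?thesis using True by (simp add: flat_exp_def mult.commute)
next
  case False
  then have "flat_exp m x = 0" by (simp add: flat_exp_def)
  moreover have "0 \<le> fact (Suc m) * \<bar>x\<bar>" by (intro mult_nonneg_nonneg) auto
  ultimately show ?thesis by simp
qed

lemma flat_exp_has_derivative: 
  "(flat_exp m has_real_derivative (flat_exp (m + 2) x - real m * flat_exp (m + 1) x)) (at x)"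
proof -
  consider "x > 0" | "x < 0" | "x = 0" by linarith
  then show ?thesis
  proof cases
    case 1
    have "((\<lambda>x. exp (- 1 / x) / x ^ m) has_real_derivative
        (exp (- 1 / x) * (1 / x\<^sup>2) * x ^ m - exp (- 1 / x) * (real m * x ^ (m - 1))) / (x ^ m * x ^ m)) (at x)"
      using 1 by (auto intro!: derivative_eq_intros simp: power2_eq_square)
    moreover have "(exp (- 1 / x) * (1 / x\<^sup>2) * x ^ m - exp (- 1 / x) * (real m * x ^ (m - 1))) / (x ^ m * x ^ m)
        = flat_exp (m + 2) x - real m * flat_exp (m + 1) x"
      using 1 by (cases m) (simp_all add: flat_exp_def field_simps power2_eq_square)
    ultimately have D: "((\<lambda>x. exp (- 1 / x) / x ^ m) has_real_derivative (flat_exp (m + 2) x - real m * flat_exp (m + 1) x)) (at x)"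
      by simp
    have "eventually (\<lambda>y. y > 0) (nhds x)"
      using 1 by (rule order_tendstoD[OF filterlim_ident])
    then have ev: "eventually (\<lambda>y. exp (- 1 / y) / y ^ m = flat_exp m y) (nhds x)"
      by eventually_elim (simp add: flat_exp_def)
    show ?thesis by (rule iffD1[OF DERIV_cong_ev[OF refl ev refl] D])
  next
    case 2
    have "eventually (\<lambda>y. y < 0) (nhds x)"
      using 2 by (rule order_tendstoD[OF filterlim_ident])
    then have "eventually (\<lambda>y. flat_exp m y = 0) (nhds x)"
      by eventually_elim (simp add: flat_exp_def)
    then have "(flat_exp m has_real_derivative 0) (at x) \<longleftrightarrow> ((\<lambda>_. 0) has_real_derivative 0) (at x)"
      by (intro DERIV_cong_ev) auto
    then show ?thesis using 2 by (simp add: flat_exp_def)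
  next
    case 3
    have "(\<lambda>h. flat_exp m h / h) \<midarrow>0\<rightarrow> 0"
    proof (rule tendsto_0_le[where K = "fact (Suc (Suc m))"])
      show "(\<lambda>h::real. h) \<midarrow>0\<rightarrow> 0" by (rule tendsto_ident_at)
      show "\<forall>\<^sub>F h in at 0. norm (flat_exp m h / h) \<le> norm h * fact (Suc (Suc m))"
      proof (intro always_eventually allI)
        fix h :: real
        have "\<bar>flat_exp m h / h\<bar> = \<bar>flat_exp (Suc m) h\<bar>" by (simp add: flat_exp_def field_simps)
        then show "norm (flat_exp m h / h) \<le> norm h * fact (Suc (Suc m))"
          using flat_exp_le[of "Suc m" h] by (simp add: mult.commute)
      qed
    qed
    then have "(flat_exp m has_real_derivative 0) (at 0)" by (simp add: DERIV_def flat_exp_eq_0)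
    then show ?thesis using 3 by (simp add: flat_exp_eq_0)
  qed
qed

lemma Ck_flat_exp_real: "Ck k (flat_exp m)"
proof (induction k arbitrary: m)
  case 0 show ?case
    using DERIV_isCont[OF flat_exp_has_derivative] by (auto intro: continuous_at_imp_continuous_on)
next
  case (Suc k) show ?case
    by (rule Ck_real_SucI[OF flat_exp_has_derivative]) (intro Ck_diff Ck_cmult Suc)
qed

lemmas Ck_flat_exp = Ck_compose[OF Ck_flat_exp_real]

text \<open>
  Differentiation under the integral sign falls on the kernel only, so \<open>g\<close> need only be continuous. The
  domain of integration is a fixed box, which is no restriction for a compactly supported kernel as long
  as \<open>x\<close> stays away from the boundary of the box.
\<close>

lemma has_derivative_convolution:
  fixes \<rho> g :: "'a::euclidean_space \<Rightarrow> real"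
  assumes g: "continuous_on (cbox c d) g" and \<rho>: "Ck (Suc k) \<rho>"
  shows "((\<lambda>x. integral (cbox c d) (\<lambda>w. g w * \<rho> (x - w))) has_derivative
     (\<lambda>h. integral (cbox c d) (\<lambda>w. g w *\<^sub>R grad \<rho> (x - w)) \<bullet> h)) (at x)"
proof -
  define F where "F x w = blinfun_inner_left (g w *\<^sub>R grad \<rho> (x - w))" for x w
  have gr: "continuous_on UNIV (grad \<rho>)" by (rule Ck_grad_continuous[OF \<rho>])
  have r: "continuous_on UNIV \<rho>" by (rule Ck_continuous[OF \<rho>])
  have cv: "continuous_on (cbox c d) (\<lambda>w. g w *\<^sub>R grad \<rho> (x - w))" for x
    by (intro continuous_intros g continuous_on_compose2[OF gr]) auto
  have contF: "continuous_on (UNIV \<times> cbox c d) (\<lambda>(x, w). F x w)"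
    unfolding F_def split_beta
    by (intro continuous_intros continuous_on_compose2[OF gr] continuous_on_compose2[OF g]
        bounded_linear.continuous_on[OF bounded_linear_blinfun_inner_left]) auto
  have "((\<lambda>x. integral (cbox c d) (\<lambda>w. g w * \<rho> (x - w))) has_derivative
     blinfun_apply (integral (cbox c d) (F x))) (at x within UNIV)"
  proof (rule leibniz_rule[where U = UNIV and fx = F])
    fix x w :: 'a
    have "((\<lambda>x. x - w) has_derivative (\<lambda>h. h)) (at x)" by (auto intro!: derivative_eq_intros)
    from has_derivative_compose[OF this Ck_SucD_derivative[OF \<rho>]]
    have "((\<lambda>x. \<rho> (x - w)) has_derivative (\<lambda>h. grad \<rho> (x - w) \<bullet> h)) (at x)" .
    from has_derivative_mult_right[OF this, of "g w"]
    show "((\<lambda>x. g w * \<rho> (x - w)) has_derivative blinfun_apply (F x w)) (at x)"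
      by (simp add: F_def inner_commute)
  next
    fix x show "(\<lambda>w. g w * \<rho> (x - w)) integrable_on cbox c d"
      by (intro integrable_continuous continuous_intros g continuous_on_compose2[OF r]) auto
  qed (use contF in auto)
  moreover have "blinfun_apply (integral (cbox c d) (F x)) h =
     integral (cbox c d) (\<lambda>w. g w *\<^sub>R grad \<rho> (x - w)) \<bullet> h" for h
  proof -
    have "F x integrable_on cbox c d"
      unfolding F_def by (intro integrable_continuous
        bounded_linear.continuous_on[OF bounded_linear_blinfun_inner_left] cv)
    from integral_linear[OF this blinfun.bounded_linear_left[of h]]
    have "blinfun_apply (integral (cbox c d) (F x)) h = integral (cbox c d) (\<lambda>w. (g w *\<^sub>R grad \<rho> (x - w)) \<bullet> h)"
      by (simp add: o_def F_def inner_commute)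
    also have "\<dots> = integral (cbox c d) (\<lambda>w. g w *\<^sub>R grad \<rho> (x - w)) \<bullet> h"
      using integral_linear[OF integrable_continuous[OF cv[of x]] bounded_linear_inner_left[of h]]
      by (simp add: o_def)
    finally show ?thesis .
  qed
  then have "blinfun_apply (integral (cbox c d) (F x)) =
      (\<lambda>h. integral (cbox c d) (\<lambda>w. g w *\<^sub>R grad \<rho> (x - w)) \<bullet> h)" by blast
  ultimately show ?thesis by simp
qed

lemma Ck_convolution:
  fixes \<rho> g :: "'a::euclidean_space \<Rightarrow> real"
  assumes g: "continuous_on (cbox c d) g"
  shows "Ck k \<rho> \<Longrightarrow> Ck k (\<lambda>x. integral (cbox c d) (\<lambda>w. g w * \<rho> (x - w)))"
proof (induction k arbitrary: \<rho>)
  case 0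
  have r: "continuous_on UNIV \<rho>" using 0 by simp
  have "continuous_on (UNIV \<times> cbox c d) (\<lambda>(x, w). g w * \<rho> (x - w))"
    unfolding split_beta
    by (intro continuous_on_mult continuous_on_compose2[OF g] continuous_on_compose2[OF r] continuous_intros) auto
  from integral_continuous_on_param[OF this] show ?case by simp
next
  case (Suc k)
  have gr: "continuous_on UNIV (grad \<rho>)" by (rule Ck_grad_continuous[OF Suc.prems])
  show ?case
  proof (rule Ck_SucI[OF has_derivative_convolution[OF g Suc.prems]])
    fix i :: 'a assume i: "i \<in> Basis"
    have "integral (cbox c d) (\<lambda>w. g w *\<^sub>R grad \<rho> (x - w)) \<bullet> i =
        integral (cbox c d) (\<lambda>w. g w * (grad \<rho> (x - w) \<bullet> i))" for x
    proof -
      have "continuous_on (cbox c d) (\<lambda>w. g w *\<^sub>R grad \<rho> (x - w))"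
        by (intro continuous_intros g continuous_on_compose2[OF gr]) auto
      from integral_linear[OF integrable_continuous[OF this] bounded_linear_inner_left[of i]]
      show ?thesis by (simp add: o_def)
    qed
    then show "Ck k (\<lambda>x. integral (cbox c d) (\<lambda>w. g w *\<^sub>R grad \<rho> (x - w)) \<bullet> i)"
      using Suc.IH[OF Ck_SucD_grad[OF Suc.prems i]] by simp
  qed
qed

section \<open>Square integrable functions\<close>

lemma L2D: "v \<in> L2 D \<Longrightarrow> v \<in> borel_measurable (lebesgue_on D)"
  "v \<in> L2 D \<Longrightarrow> integrable (lebesgue_on D) (\<lambda>x. (norm (v x))\<^sup>2)"
  by (auto simp: L2_def)

lemma L2I_bound:
  assumes "v \<in> borel_measurable (lebesgue_on D)" "integrable (lebesgue_on D) g"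
    "\<And>x. x \<in> D \<Longrightarrow> (norm (v x))\<^sup>2 \<le> g x"
  shows "v \<in> L2 D"
  unfolding L2_def
proof (intro CollectI conjI)
  show "integrable (lebesgue_on D) (\<lambda>x. (norm (v x))\<^sup>2)"
    by (rule Bochner_Integration.integrable_bound[OF assms(2)])
       (use assms in \<open>auto intro!: AE_I2 order_trans[OF assms(3)] simp: space_restrict_space\<close>)
qed fact

lemma L2_add:
  assumes "v \<in> L2 D" "w \<in> L2 D"
  shows "(\<lambda>x. v x + w x) \<in> L2 D"
proof (rule L2I_bound[where g = "\<lambda>x. 2 * (norm (v x))\<^sup>2 + 2 * (norm (w x))\<^sup>2"])
  show "(norm (v x + w x))\<^sup>2 \<le> 2 * (norm (v x))\<^sup>2 + 2 * (norm (w x))\<^sup>2" for x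
  proof -
    have "(norm (v x + w x))\<^sup>2 \<le> (norm (v x) + norm (w x))\<^sup>2"
      by (intro power_mono norm_triangle_ineq) auto
    also have "\<dots> \<le> 2 * (norm (v x))\<^sup>2 + 2 * (norm (w x))\<^sup>2"
      using sum_squares_bound[of "norm (v x)" "norm (w x)"] by (simp add: power2_sum)
    finally show ?thesis .
  qed
qed (use assms in \<open>auto intro!: borel_measurable_add Bochner_Integration.integrable_add
    integrable_mult_right dest: L2D\<close>)

lemma L2_bounded_mult:
  assumes "v \<in> L2 D" "a \<in> borel_measurable (lebesgue_on D)" "\<And>x. x \<in> D \<Longrightarrow> \<bar>a x\<bar> \<le> M"
  shows "(\<lambda>x. a x *\<^sub>R v x) \<in> L2 D"
proof (rule L2I_bound[where g = "\<lambda>x. M\<^sup>2 * (norm (v x))\<^sup>2"])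
  show "(norm (a x *\<^sub>R v x))\<^sup>2 \<le> M\<^sup>2 * (norm (v x))\<^sup>2" if "x \<in> D" for x
    using assms(3)[OF that] by (auto simp: power_mult_distrib intro!: mult_right_mono abs_le_square_iff[THEN iffD1])
qed (use assms in \<open>auto intro!: borel_measurable_scaleR dest: L2D\<close>)

lemma L2_scaleR: "v \<in> L2 D \<Longrightarrow> (\<lambda>x. c *\<^sub>R v x) \<in> L2 D"
  by (rule L2_bounded_mult[where M = "\<bar>c\<bar>"]) auto

lemma L2_diff: "v \<in> L2 D \<Longrightarrow> w \<in> L2 D \<Longrightarrow> (\<lambda>x. v x - w x) \<in> L2 D"
  using L2_add[of v D "\<lambda>x. (-1) *\<^sub>R w x"] L2_scaleR[of w D "-1"] by simp

lemma L2_inner_integrable: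
  assumes "v \<in> L2 D" "w \<in> L2 D"
  shows "integrable (lebesgue_on D) (\<lambda>x. v x \<bullet> w x)"
proof (rule Bochner_Integration.integrable_bound[where f = "\<lambda>x. (norm (v x))\<^sup>2 + (norm (w x))\<^sup>2"])
  show "AE x in lebesgue_on D. norm (v x \<bullet> w x) \<le> norm ((norm (v x))\<^sup>2 + (norm (w x))\<^sup>2)"
  proof (intro AE_I2)
    fix x
    have "\<bar>v x \<bullet> w x\<bar> \<le> norm (v x) * norm (w x)" by (rule Cauchy_Schwarz_ineq2)
    also have "\<dots> \<le> 2 * norm (v x) * norm (w x)" by simp
    also have "\<dots> \<le> (norm (v x))\<^sup>2 + (norm (w x))\<^sup>2" by (rule sum_squares_bound)
    finally show "norm (v x \<bullet> w x) \<le> norm ((norm (v x))\<^sup>2 + (norm (w x))\<^sup>2)" by simp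
  qed
qed (use assms in \<open>auto intro!: borel_measurable_inner dest: L2D\<close>)

lemma L2_mult_integrable:
  fixes v :: "'a::euclidean_space \<Rightarrow> real"
  assumes "v \<in> L2 D" "w \<in> L2 D"
  shows "integrable (lebesgue_on D) (\<lambda>x. v x * w x)"
  using L2_inner_integrable[OF assms] by simp

lemma L2_scaleR_integrable:
  fixes v :: "'a::euclidean_space \<Rightarrow> real" and w :: "'a \<Rightarrow> 'b::euclidean_space"
  assumes "v \<in> L2 D" "w \<in> L2 D"
  shows "integrable (lebesgue_on D) (\<lambda>x. v x *\<^sub>R w x)"
proof -
  have n: "(\<lambda>x. norm (w x)) \<in> L2 D" "(\<lambda>x. \<bar>v x\<bar>) \<in> L2 D"
    using assms by (auto simp: L2_def)
  have "integrable (lebesgue_on D) (\<lambda>x. \<bar>v x\<bar> * norm (w x))"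
    by (rule L2_mult_integrable[OF n(2) n(1)])
  then show ?thesis
    by (rule Bochner_Integration.integrable_bound)
       (use assms in \<open>auto intro!: borel_measurable_scaleR dest: L2D\<close>)
qed

lemma L2_norm_sq: "(L2_norm D v)\<^sup>2 = (LINT x|lebesgue_on D. (norm (v x))\<^sup>2)"
  by (simp add: L2_norm_def)

lemma L2_norm_nonneg [simp]: "0 \<le> L2_norm D v"
  by (simp add: L2_norm_def)

text \<open>
  The quadratic polynomial \<open>s \<mapsto> \<integral> |v + s w|\<^sup>2\<close> is nonnegative, which forces its discriminant to be
  nonpositive.
\<close>

lemma L2_Cauchy_Schwarz:
  assumes v: "v \<in> L2 D" and w: "w \<in> L2 D"
  shows "\<bar>LINT x|lebesgue_on D. v x \<bullet> w x\<bar> \<le> L2_norm D v * L2_norm D w"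
proof -
  let ?A = "LINT x|lebesgue_on D. (norm (v x))\<^sup>2" and ?B = "LINT x|lebesgue_on D. (norm (w x))\<^sup>2"
    and ?C = "LINT x|lebesgue_on D. v x \<bullet> w x"
  note i = L2D(2)[OF v] L2D(2)[OF w] L2_inner_integrable[OF v w]
  have q: "0 \<le> ?A + 2 * s * ?C + s\<^sup>2 * ?B" for s
  proof -
    have "0 \<le> (LINT x|lebesgue_on D. (norm (v x + s *\<^sub>R w x))\<^sup>2)" by simp
    also have "(\<lambda>x. (norm (v x + s *\<^sub>R w x))\<^sup>2) =
        (\<lambda>x. (norm (v x))\<^sup>2 + 2 * s * (v x \<bullet> w x) + s\<^sup>2 * (norm (w x))\<^sup>2)"
      unfolding power2_norm_eq_inner
      by (auto simp: fun_eq_iff inner_add inner_commute power2_eq_square algebra_simps)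
    also have "(LINT x|lebesgue_on D. \<dots> x) = ?A + 2 * s * ?C + s\<^sup>2 * ?B" using i by simp
    finally show ?thesis .
  qed
  have AB: "0 \<le> ?A" "0 \<le> ?B" by auto
  have "?C\<^sup>2 \<le> ?A * ?B"
  proof (cases "?B = 0")
    case True
    have "?C = 0"
    proof (rule ccontr)
      assume "?C \<noteq> 0"
      then have "2 * (- (?A + 1) / (2 * ?C)) * ?C = - (?A + 1)" by (simp add: field_simps)
      moreover have "0 \<le> ?A + 2 * s * ?C" for s using q[of s] True by simp
      ultimately show False using linorder_not_le by (smt (verit))
    qed
    then show ?thesis using True by simp
  next
    case False
    then have B: "?B > 0" using AB by linarith
    have "0 \<le> (?A + 2 * (- ?C / ?B) * ?C + (- ?C / ?B)\<^sup>2 * ?B) * ?B"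
      using q[of "- ?C / ?B"] AB by (intro mult_nonneg_nonneg) auto
    also have "\<dots> = ?A * ?B - ?C\<^sup>2" using B by (simp add: field_simps power2_eq_square)
    finally show ?thesis by simp
  qed
  then have "sqrt (?C\<^sup>2) \<le> sqrt (?A * ?B)" by (rule real_sqrt_le_mono)
  then show ?thesis by (simp add: L2_norm_def real_sqrt_mult)
qed

lemma L2_norm_triangle:
  assumes v: "v \<in> L2 D" and w: "w \<in> L2 D"
  shows "L2_norm D (\<lambda>x. v x + w x) \<le> L2_norm D v + L2_norm D w"
proof (rule power2_le_imp_le)
  note i = L2D(2)[OF v] L2D(2)[OF w] L2_inner_integrable[OF v w]
  have "(L2_norm D (\<lambda>x. v x + w x))\<^sup>2 = (LINT x|lebesgue_on D. (norm (v x))\<^sup>2 + 2 * (v x \<bullet> w x) + (norm (w x))\<^sup>2)"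
    unfolding L2_norm_sq power2_norm_eq_inner
    by (simp add: inner_add inner_commute algebra_simps)
  also have "\<dots> = (L2_norm D v)\<^sup>2 + 2 * (LINT x|lebesgue_on D. v x \<bullet> w x) + (L2_norm D w)\<^sup>2"
    unfolding L2_norm_sq using i by simp
  also have "\<dots> \<le> (L2_norm D v + L2_norm D w)\<^sup>2"
    using L2_Cauchy_Schwarz[OF v w] by (simp add: power2_sum)
  finally show "(L2_norm D (\<lambda>x. v x + w x))\<^sup>2 \<le> (L2_norm D v + L2_norm D w)\<^sup>2" .
qed simp

lemma L2_norm_scaleR: "L2_norm D (\<lambda>x. c *\<^sub>R v x) = \<bar>c\<bar> * L2_norm D v"
  by (simp add: L2_norm_def power_mult_distrib real_sqrt_mult)

lemma L2_norm_minus_commute: "L2_norm D (\<lambda>x. v x - w x) = L2_norm D (\<lambda>x. w x - v x)"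
  by (simp add: L2_norm_def norm_minus_commute)

lemma L2_norm_triangle_diff:
  assumes "u \<in> L2 D" "v \<in> L2 D" "w \<in> L2 D"
  shows "L2_norm D (\<lambda>x. u x - w x) \<le> L2_norm D (\<lambda>x. u x - v x) + L2_norm D (\<lambda>x. v x - w x)"
  using L2_norm_triangle[OF L2_diff[OF assms(1,2)] L2_diff[OF assms(2,3)]] by simp

lemma L2_norm_le_add:
  assumes "v \<in> L2 D" "w \<in> L2 D"
  shows "L2_norm D v \<le> L2_norm D (\<lambda>x. v x - w x) + L2_norm D w"
  using L2_norm_triangle[OF L2_diff[OF assms] assms(2)] by simp

lemma L2_norm_cong_AE:
  assumes "v \<in> L2 D" "w \<in> L2 D" "AE x in lebesgue_on D. v x = w x"
  shows "L2_norm D v = L2_norm D w"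
  unfolding L2_norm_def
  by (rule arg_cong[where f = sqrt], rule integral_cong_AE)
     (use assms in \<open>auto dest: L2D elim: eventually_mono\<close>)

lemma L2_norm_bounded_mult:
  assumes "v \<in> L2 D" "a \<in> borel_measurable (lebesgue_on D)" "\<And>x. x \<in> D \<Longrightarrow> \<bar>a x\<bar> \<le> M" "0 \<le> M"
  shows "L2_norm D (\<lambda>x. a x *\<^sub>R v x) \<le> M * L2_norm D v"
proof (rule power2_le_imp_le)
  have "(L2_norm D (\<lambda>x. a x *\<^sub>R v x))\<^sup>2 \<le> (LINT x|lebesgue_on D. M\<^sup>2 * (norm (v x))\<^sup>2)"
    unfolding L2_norm_sq
  proof (rule integral_mono)
    show "(norm (a x *\<^sub>R v x))\<^sup>2 \<le> M\<^sup>2 * (norm (v x))\<^sup>2" if "x \<in> space (lebesgue_on D)" for x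
      using assms(3)[of x] that by (auto simp: power_mult_distrib space_restrict_space
          intro!: mult_right_mono abs_le_square_iff[THEN iffD1])
  qed (use L2D(2)[OF L2_bounded_mult[OF assms(1-3)]] L2D(2)[OF assms(1)] in auto)
  also have "\<dots> = (M * L2_norm D v)\<^sup>2" by (simp add: L2_norm_sq power_mult_distrib)
  finally show "(L2_norm D (\<lambda>x. a x *\<^sub>R v x))\<^sup>2 \<le> (M * L2_norm D v)\<^sup>2" .
qed (use assms in simp)

lemma L2_tendsto_inner:
  assumes "v \<in> L2 D" "\<And>n. \<phi> n \<in> L2 D" "w \<in> L2 D"
    and "(\<lambda>n. L2_norm D (\<lambda>x. v x - \<phi> n x)) \<longlonglongrightarrow> 0"
  shows "(\<lambda>n. LINT x|lebesgue_on D. \<phi> n x \<bullet> w x) \<longlonglongrightarrow> (LINT x|lebesgue_on D. v x \<bullet> w x)"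
proof (rule LIM_zero_cancel, rule tendsto_0_le[OF assms(4), where K = "L2_norm D w"], rule always_eventually, rule allI)
  fix n
  have "(LINT x|lebesgue_on D. \<phi> n x \<bullet> w x) - (LINT x|lebesgue_on D. v x \<bullet> w x) =
      - (LINT x|lebesgue_on D. (v x - \<phi> n x) \<bullet> w x)"
    using L2_inner_integrable[OF assms(1,3)] L2_inner_integrable[OF assms(2)[of n] assms(3)]
    by (simp add: inner_diff_left)
  then show "norm ((LINT x|lebesgue_on D. \<phi> n x \<bullet> w x) - (LINT x|lebesgue_on D. v x \<bullet> w x))
      \<le> norm (L2_norm D (\<lambda>x. v x - \<phi> n x)) * L2_norm D w"
    using L2_Cauchy_Schwarz[OF L2_diff[OF assms(1) assms(2)[of n]] assms(3)] by simp
qed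

lemma L2_tendsto_norm:
  assumes "v \<in> L2 D" "\<And>n. \<phi> n \<in> L2 D"
    and "(\<lambda>n. L2_norm D (\<lambda>x. v x - \<phi> n x)) \<longlonglongrightarrow> 0"
  shows "(\<lambda>n. L2_norm D (\<phi> n)) \<longlonglongrightarrow> L2_norm D v"
proof (rule LIM_zero_cancel, rule tendsto_0_le[OF assms(3), where K = 1], rule always_eventually, rule allI)
  fix n
  show "norm (L2_norm D (\<phi> n) - L2_norm D v) \<le> norm (L2_norm D (\<lambda>x. v x - \<phi> n x)) * 1"
    using L2_norm_le_add[OF assms(1) assms(2)[of n]] L2_norm_le_add[OF assms(2)[of n] assms(1)]
      L2_norm_minus_commute[of D v "\<phi> n"] by (simp add: abs_le_iff)
qed

lemma L2_nn_integral:
  "v \<in> L2 D \<Longrightarrow> (\<integral>\<^sup>+x. ennreal ((norm (v x))\<^sup>2) \<partial>lebesgue_on D) = ennreal ((L2_norm D v)\<^sup>2)"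
  unfolding L2_norm_sq by (rule nn_integral_eq_integral) (auto dest: L2D)

text \<open>
  Riesz and Fischer: along a sufficiently fast subsequence the increments are summable almost everywhere,
  which yields a pointwise limit; Fatou's lemma turns the Cauchy property into convergence to it. On a set
  of finite measure the increments can be summed in \<open>L\<^sup>1\<close>.
\<close>

lemma L2_complete:
  fixes v :: "nat \<Rightarrow> 'a::euclidean_space \<Rightarrow> 'b::euclidean_space"
  assumes fin: "emeasure lebesgue D < \<infinity>" "D \<in> sets lebesgue"
    and v: "\<And>n. v n \<in> L2 D"
    and Cauchy: "\<And>e. e > 0 \<Longrightarrow> \<exists>N. \<forall>m\<ge>N. \<forall>n\<ge>N. L2_norm D (\<lambda>x. v m x - v n x) < e"
  shows "\<exists>w\<in>L2 D. (\<lambda>n. L2_norm D (\<lambda>x. w x - v n x)) \<longlonglongrightarrow> 0"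
proof -
  let ?M = "lebesgue_on D"
  have "\<forall>k. \<exists>N. \<forall>m\<ge>N. \<forall>n\<ge>N. L2_norm D (\<lambda>x. v m x - v n x) < (1/2)^k"
    using Cauchy by simp
  then obtain N where N: "\<And>k m n. m \<ge> N k \<Longrightarrow> n \<ge> N k \<Longrightarrow> L2_norm D (\<lambda>x. v m x - v n x) < (1/2)^k"
    by metis
  (* Monotone, and at least as large as both N k and k. *)
  define r where "r k = (\<Sum>j\<le>k. N j) + k" for k
  have r_N: "N k \<le> r k" "N k \<le> r (Suc k)" for k
    using member_le_sum[of k "{..k}" N] by (auto simp: r_def)
  have r_ge: "k \<le> r k" for k by (simp add: r_def)
  define g where "g k x = norm (v (r (Suc k)) x - v (r k) x)" for k x
  have d: "(\<lambda>x. v m x - v n x) \<in> L2 D" for m n by (intro L2_diff v)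
  have [measurable]: "v n \<in> borel_measurable ?M" for n using L2D(1)[OF v] .
  have [measurable]: "g k \<in> borel_measurable ?M" for k unfolding g_def by measurable
  have gL2: "g k \<in> L2 D" for k using d[of "r (Suc k)" "r k"] by (auto simp: L2_def g_def)
  have finM: "finite_measure ?M"
    using fin by (intro finite_measureI) (simp add: emeasure_restrict_space)
  then have one: "(\<lambda>x. 1::real) \<in> L2 D"
    by (auto simp: L2_def intro: finite_measure.integrable_const)
  have gint: "(\<integral>\<^sup>+x. ennreal (g k x) \<partial>?M) \<le> ennreal (L2_norm D (\<lambda>x. 1::real) * (1/2)^k)" for k
  proof -
    have i: "integrable ?M (g k)" using L2_mult_integrable[OF gL2 one] by simp
    have "(\<integral>\<^sup>+x. ennreal (g k x) \<partial>?M) = ennreal (LINT x|?M. g k x)"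
      by (rule nn_integral_eq_integral[OF i]) (simp add: g_def)
    also have "\<dots> \<le> ennreal (L2_norm D (\<lambda>x. 1::real) * (1/2)^k)"
    proof (rule ennreal_leI)
      have "(LINT x|?M. g k x) \<le> L2_norm D (g k) * L2_norm D (\<lambda>x. 1::real)"
        using L2_Cauchy_Schwarz[OF gL2[of k] one] by simp
      also have "\<dots> \<le> (1/2)^k * L2_norm D (\<lambda>x. 1::real)"
        using N[OF r_N(2) r_N(1), of k] by (intro mult_right_mono) (auto simp: g_def L2_norm_def)
      finally show "(LINT x|?M. g k x) \<le> L2_norm D (\<lambda>x. 1::real) * (1/2)^k" by (simp add: mult.commute)
    qed
    finally show ?thesis .
  qed
  have "(\<integral>\<^sup>+x. (\<Sum>k. ennreal (g k x)) \<partial>?M) = (\<Sum>k. \<integral>\<^sup>+x. ennreal (g k x) \<partial>?M)"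
    by (rule nn_integral_suminf) measurable
  also have "\<dots> \<le> (\<Sum>k. ennreal (L2_norm D (\<lambda>x. 1::real) * (1/2)^k))"
    by (intro suminf_le gint) auto
  also have "\<dots> = ennreal (\<Sum>k. L2_norm D (\<lambda>x. 1::real) * (1/2)^k)"
    by (intro suminf_ennreal_eq summable_sums summable_mult summable_geometric) auto
  also have "\<dots> < \<infinity>" by simp
  finally have "(\<integral>\<^sup>+x. (\<Sum>k. ennreal (g k x)) \<partial>?M) \<noteq> \<infinity>" by simp
  then have "AE x in ?M. (\<Sum>k. ennreal (g k x)) \<noteq> \<infinity>"
    by (intro nn_integral_PInf_AE) measurable
  then have conv: "AE x in ?M. convergent (\<lambda>k. v (r k) x)"
  proof eventually_elim
    case (elim x)
    then have "summable (\<lambda>k. g k x)"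
      by (intro summable_suminf_not_top) (auto simp: g_def)
    then have "summable (\<lambda>k. v (r (Suc k)) x - v (r k) x)"
      unfolding g_def by (rule summable_norm_cancel)
    then have "convergent (\<lambda>n. \<Sum>k<n. v (r (Suc k)) x - v (r k) x)"
      by (simp add: summable_iff_convergent)
    then have "convergent (\<lambda>n. v (r n) x - v (r 0) x)"
      using sum_lessThan_telescope[of "\<lambda>k. v (r k) x"] by simp
    from convergent_add[OF this convergent_const[of "v (r 0) x"]] show ?case by simp
  qed
  define w where "w x = lim (\<lambda>k. v (r k) x)" for x
  have [measurable]: "w \<in> borel_measurable ?M" unfolding w_def by measurable
  have est: "(\<lambda>x. w x - v n x) \<in> L2 D \<and> L2_norm D (\<lambda>x. w x - v n x) \<le> e"
    if e: "e > 0" and n: "\<And>m. m \<ge> n \<Longrightarrow> L2_norm D (\<lambda>x. v m x - v n x) \<le> e" for e n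
  proof -
    have "(\<integral>\<^sup>+x. ennreal ((norm (w x - v n x))\<^sup>2) \<partial>?M)
        = (\<integral>\<^sup>+x. liminf (\<lambda>k. ennreal ((norm (v (r k) x - v n x))\<^sup>2)) \<partial>?M)"
    proof (rule nn_integral_cong_AE, use conv in eventually_elim)
      case (elim x)
      then have "(\<lambda>k. v (r k) x) \<longlonglongrightarrow> w x" by (simp add: w_def convergent_LIMSEQ_iff)
      then have "(\<lambda>k. ennreal ((norm (v (r k) x - v n x))\<^sup>2)) \<longlonglongrightarrow> ennreal ((norm (w x - v n x))\<^sup>2)"
        by (intro tendsto_intros)
      then show ?case by (intro lim_imp_Liminf[symmetric]) auto
    qed
    also have "\<dots> \<le> liminf (\<lambda>k. \<integral>\<^sup>+x. ennreal ((norm (v (r k) x - v n x))\<^sup>2) \<partial>?M)"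
      by (rule nn_integral_liminf) measurable
    also have "\<dots> \<le> liminf (\<lambda>k::nat. ennreal (e\<^sup>2))"
    proof (rule Liminf_mono)
      show "\<forall>\<^sub>F k in sequentially. (\<integral>\<^sup>+x. ennreal ((norm (v (r k) x - v n x))\<^sup>2) \<partial>?M) \<le> ennreal (e\<^sup>2)"
        using eventually_ge_at_top[of n]
      proof eventually_elim
        case (elim k)
        then have "L2_norm D (\<lambda>x. v (r k) x - v n x) \<le> e" using n[of "r k"] r_ge[of k] by simp
        then show ?case unfolding L2_nn_integral[OF d] by (intro ennreal_leI power_mono) auto
      qed
    qed
    also have "\<dots> = ennreal (e\<^sup>2)" by (simp add: Liminf_const)
    finally have le: "(\<integral>\<^sup>+x. ennreal ((norm (w x - v n x))\<^sup>2) \<partial>?M) \<le> ennreal (e\<^sup>2)" .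
    have "integrable ?M (\<lambda>x. (norm (w x - v n x))\<^sup>2)"
      by (rule integrableI_nonneg) (use le in \<open>auto simp: le_less_trans less_top[symmetric] top_unique\<close>)
    then have L: "(\<lambda>x. w x - v n x) \<in> L2 D" by (simp add: L2_def)
    have "(L2_norm D (\<lambda>x. w x - v n x))\<^sup>2 \<le> e\<^sup>2"
      using le unfolding L2_nn_integral[OF L] by simp
    then show ?thesis using L e by (auto intro: power2_le_imp_le)
  qed
  have ev: "\<exists>N. \<forall>n\<ge>N. (\<lambda>x. w x - v n x) \<in> L2 D \<and> L2_norm D (\<lambda>x. w x - v n x) \<le> e" if "e > 0" for e
  proof -
    obtain N where "\<forall>m\<ge>N. \<forall>n\<ge>N. L2_norm D (\<lambda>x. v m x - v n x) < e" using Cauchy[OF \<open>e > 0\<close>] by blast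
    then show ?thesis using that by (intro exI[of _ N] allI impI est) (auto intro: less_imp_le)
  qed
  obtain n0 where "(\<lambda>x. w x - v n0 x) \<in> L2 D" using ev[of 1] by auto
  from L2_add[OF this v[of n0]] have "w \<in> L2 D" by simp
  moreover have "(\<lambda>n. L2_norm D (\<lambda>x. w x - v n x)) \<longlonglongrightarrow> 0"
  proof (rule LIMSEQ_I)
    fix e :: real assume "e > 0"
    then obtain N where "\<forall>n\<ge>N. L2_norm D (\<lambda>x. w x - v n x) \<le> e / 2" using ev[of "e/2"] by auto
    then show "\<exists>N. \<forall>n\<ge>N. norm (L2_norm D (\<lambda>x. w x - v n x) - 0) < e"
      using \<open>e > 0\<close> by (intro exI[of _ N]) (auto intro: le_less_trans)
  qed
  ultimately show ?thesis by blast
qed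

section \<open>Test functions and the fundamental lemma\<close>

text \<open>
  Boxes are stable under intersection and generate the Borel sets.
\<close>

lemma set_integral_zero_of_boxes:
  fixes g :: "'a::euclidean_space \<Rightarrow> real"
  assumes g: "integrable lborel g"
    and box: "\<And>a b. (LINT x:box a b|lborel. g x) = 0"
    and A: "A \<in> sets borel"
  shows "(LINT x:A|lborel. g x) = 0"
proof -
  let ?G = "range (\<lambda>(a, b). box a b :: 'a set)"
  have S: "sigma_sets UNIV ?G = sets borel"
    by (subst borel_eq_box) (simp add: sets_measure_of)
  have si: "set_integrable lborel X g" if "X \<in> sets borel" for X
    using integrable_mult_indicator[OF _ g, of X] that by (simp add: set_integrable_def)
  have univ: "(LINT x:UNIV|lborel. g x) = 0"
  proof -
    define B where "B i = box (- (real i *\<^sub>R One)) (real i *\<^sub>R One :: 'a)" for i :: nat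
    have "(\<lambda>i. LINT x:B i|lborel. g x) \<longlonglongrightarrow> (LINT x:(\<Union>i. B i)|lborel. g x)"
    proof (rule set_integral_cont_up)
      show "incseq B" unfolding B_def incseq_def
      proof (intro allI impI subset_box_imp(4))
        fix m n :: nat assume "m \<le> n"
        then show "\<forall>i\<in>Basis. (- (real n *\<^sub>R One)) \<bullet> i \<le> (- (real m *\<^sub>R One)) \<bullet> i \<and>
            (real m *\<^sub>R One) \<bullet> i \<le> (real n *\<^sub>R One :: 'a) \<bullet> i" by simp
      qed
    qed (auto intro!: si simp: B_def)
    moreover have "(\<Union>i. B i) = UNIV" by (simp add: B_def UN_box_eq_UNIV)
    moreover have "(LINT x:B i|lborel. g x) = 0" for i unfolding B_def by (rule box)
    ultimately show ?thesis by (simp add: LIMSEQ_const_iff)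
  qed
  have G: "Int_stable ?G" "?G \<subseteq> Pow UNIV" by (auto simp: Int_stable_def box_Int_box)
  have "A \<in> sigma_sets UNIV ?G" using A S by simp
  from G this show ?thesis
  proof (induction rule: sigma_sets_induct_disjoint)
    case (basic A) then show ?case using box by auto
  next
    case empty show ?case by (simp add: set_lebesgue_integral_def)
  next
    case (compl A)
    then have A: "A \<in> sets borel" using S by simp
    have "(LINT x:A \<union> (UNIV - A)|lborel. g x) = (LINT x:A|lborel. g x) + (LINT x:UNIV - A|lborel. g x)"
      using A by (intro set_integral_Un si) auto
    then show ?case using compl univ by simp
  next
    case (union A)
    then have A: "A i \<in> sets borel" for i using S by auto
    have "(LINT x:(\<Union>i. A i)|lborel. g x) = (\<Sum>i. LINT x:A i|lborel. g x)"
      using union A by (intro lebesgue_integral_countable_add si) (auto simp: disjoint_family_on_def)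
    then show ?case using union by simp
  qed
qed

lemma AE_zero_of_boxes:
  fixes g :: "'a::euclidean_space \<Rightarrow> real"
  assumes g: "integrable lborel g"
    and box: "\<And>a b. (LINT x:box a b|lborel. g x) = 0"
  shows "AE x in lborel. g x = 0"
  using set_integral_zero_of_boxes[OF assms]
  by (intro density_unique_real[OF g]) (auto simp: set_lebesgue_integral_def)

lemma integral_lebesgue_on_supported:
  fixes g :: "'a::euclidean_space \<Rightarrow> 'b::euclidean_space"
  assumes "g \<in> borel_measurable borel" "D \<in> sets lebesgue" "\<And>x. x \<notin> D \<Longrightarrow> g x = 0"
  shows "(LINT x|lebesgue_on D. g x) = (LINT x|lborel. g x)"
    and "integrable (lebesgue_on D) g \<longleftrightarrow> integrable lborel g"
proof -
  have e: "(\<lambda>x. indicator D x *\<^sub>R g x) = g" using assms(3) by (auto simp: indicator_def fun_eq_iff)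
  have m: "g \<in> borel_measurable lborel" using assms(1) by simp
  show "(LINT x|lebesgue_on D. g x) = (LINT x|lborel. g x)"
    using assms(2) e integral_completion[OF m] by (simp add: integral_restrict_space)
  show "integrable (lebesgue_on D) g \<longleftrightarrow> integrable lborel g"
    using assms(2) e integrable_completion[OF m] by (simp add: integrable_restrict_space)
qed

lemma integrable_compact_support:
  fixes g :: "'a::euclidean_space \<Rightarrow> 'b::euclidean_space"
  assumes "continuous_on UNIV g" "compact K" "\<And>x. x \<notin> K \<Longrightarrow> g x = 0"
  shows "integrable lborel g"
proof -
  have "(\<lambda>x. indicator K x *\<^sub>R g x) = g" using assms(3) by (auto simp: indicator_def fun_eq_iff)
  then show ?thesis
    using borel_integrable_compact[OF assms(2) continuous_on_subset[OF assms(1)]] by simp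
qed

lemma L2_compact_support:
  fixes g :: "'a::euclidean_space \<Rightarrow> 'b::euclidean_space"
  assumes "continuous_on UNIV g" "compact K" "\<And>x. x \<notin> K \<Longrightarrow> g x = 0" "K \<subseteq> D" "D \<in> sets lebesgue"
  shows "g \<in> L2 D"
proof -
  have g: "g \<in> borel_measurable borel" using assms(1) by (rule borel_measurable_continuous_onI)
  have "integrable lborel (\<lambda>x. (norm (g x))\<^sup>2)"
    by (rule integrable_compact_support[OF _ assms(2)])
       (use assms in \<open>auto intro!: continuous_intros\<close>)
  then have "integrable (lebesgue_on D) (\<lambda>x. (norm (g x))\<^sup>2)"
    using assms g by (subst integral_lebesgue_on_supported(2)) auto
  moreover have "g \<in> borel_measurable (lebesgue_on D)"
    using g by (intro measurable_restrict_space1 measurable_completion) simp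
  ultimately show ?thesis by (simp add: L2_def)
qed

lemma grad_zero_outside:
  fixes \<phi> :: "'a::euclidean_space \<Rightarrow> real"
  assumes "compact K" "\<And>x. x \<notin> K \<Longrightarrow> \<phi> x = 0" "x \<notin> K"
  shows "grad \<phi> x = 0"
proof (rule grad_eqI)
  have "open (- K)" using assms(1) compact_imp_closed by blast
  then have "(\<phi> has_derivative (\<lambda>h. 0)) (at x)"
    by (rule has_derivative_transform_within_open[OF has_derivative_const, of _ _ 0])
       (use assms in auto)
  then show "(\<phi> has_derivative (\<bullet>) 0) (at x)"
    by (rule has_derivative_eq_rhs) (simp add: fun_eq_iff)
qed

lemma lborel_integral_translate:
  fixes \<phi> :: "'a::euclidean_space \<Rightarrow> real"
  assumes "\<phi> \<in> borel_measurable borel"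
  shows "(LINT x|lborel. \<phi> (v + x)) = (LINT x|lborel. \<phi> x)"
proof -
  have "(LINT x|lborel. \<phi> x) = (LINT x|distr lborel borel ((+) v). \<phi> x)" by (simp add: lborel_distr_plus)
  also have "\<dots> = (LINT x|lborel. \<phi> (v + x))" using assms by (subst integral_distr) auto
  finally show ?thesis by simp
qed

text \<open>
  Every difference quotient of \<open>\<phi>\<close> in the direction \<open>e\<close> has integral zero by translation invariance, and the
  quotients converge boundedly, on a common compact support, to the directional derivative.
\<close>

lemma integral_grad_zero:
  fixes \<phi> :: "'a::euclidean_space \<Rightarrow> real"
  assumes C: "Ck (Suc 0) \<phi>" and K: "compact K" "\<And>x. x \<notin> K \<Longrightarrow> \<phi> x = 0"
  shows "(LINT x|lborel. grad \<phi> x \<bullet> e) = 0"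
proof -
  have c: "continuous_on UNIV \<phi>" by (rule Ck_continuous[OF C])
  have cg: "continuous_on UNIV (\<lambda>x. grad \<phi> x \<bullet> e)"
    by (intro continuous_intros Ck_grad_continuous[OF C])
  have z: "grad \<phi> x = 0" if "x \<notin> K" for x by (rule grad_zero_outside[OF K that])
  have "compact ((\<lambda>x. grad \<phi> x \<bullet> e) ` K)"
    by (intro compact_continuous_image continuous_on_subset[OF cg] K) auto
  then obtain B where B: "\<And>x. x \<in> K \<Longrightarrow> \<bar>grad \<phi> x \<bullet> e\<bar> \<le> B"
    unfolding compact_eq_bounded_closed bounded_iff by force
  define B' where "B' = max B 0"
  have B': "\<bar>grad \<phi> x \<bullet> e\<bar> \<le> B'" for x
    using B[of x] z[of x] by (cases "x \<in> K") (auto simp: B'_def)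
  obtain R where R: "\<And>x. x \<in> K \<Longrightarrow> norm x \<le> R"
    using compact_imp_bounded[OF K(1)] unfolding bounded_iff by blast
  define K' where "K' = cball (0::'a) (R + norm e)"
  define s where "s n = inverse (real (Suc n))" for n
  have s: "0 < s n" "s n \<le> 1" for n by (auto simp: s_def inverse_eq_divide)
  define q where "q n x = (\<phi> (x + s n *\<^sub>R e) - \<phi> x) / s n" for n x
  have line: "((\<lambda>t. \<phi> (x + t *\<^sub>R e)) has_real_derivative (grad \<phi> (x + t *\<^sub>R e) \<bullet> e)) (at t)" for x t
  proof -
    have "((\<lambda>t. x + t *\<^sub>R e) has_derivative (\<lambda>h. h *\<^sub>R e)) (at t)"
      by (auto intro!: derivative_eq_intros)
    from has_derivative_compose[OF this Ck_SucD_derivative[OF C]]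
    show ?thesis unfolding has_field_derivative_def
      by (rule has_derivative_eq_rhs) (auto simp: fun_eq_iff)
  qed
  have qb: "\<bar>q n x\<bar> \<le> B'" for n x
  proof -
    obtain t where t: "\<phi> (x + s n *\<^sub>R e) - \<phi> (x + 0 *\<^sub>R e) = (s n - 0) * (grad \<phi> (x + t *\<^sub>R e) \<bullet> e)"
      using MVT2[OF s(1)[of n], of "\<lambda>t. \<phi> (x + t *\<^sub>R e)", OF line] by blast
    then have "q n x = grad \<phi> (x + t *\<^sub>R e) \<bullet> e" using s(1)[of n] by (simp add: q_def)
    then show ?thesis using B' by simp
  qed
  have q0: "q n x = 0" if "x \<notin> K'" for n x
  proof -
    have n: "norm x > R + norm e" using that by (simp add: K'_def)
    have "norm x \<le> norm (x + s n *\<^sub>R e) + norm (s n *\<^sub>R e)"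
      by (metis add_diff_cancel norm_triangle_ineq4)
    also have "norm (s n *\<^sub>R e) \<le> norm e" using s[of n] by (simp add: mult_left_le_one_le)
    finally have "x + s n *\<^sub>R e \<notin> K" using R n by fastforce
    moreover have "x \<notin> K" using R n norm_ge_zero[of e] by (metis add_increasing2 linorder_not_le)
    ultimately show ?thesis using K by (simp add: q_def)
  qed
  have meas: "\<phi> \<in> borel_measurable borel" "(\<lambda>x. grad \<phi> x \<bullet> e) \<in> borel_measurable borel"
    using c cg by (auto intro: borel_measurable_continuous_onI)
  have i: "integrable lborel \<phi>" by (rule integrable_compact_support[OF c K])
  have tr: "integrable lborel (\<lambda>x. \<phi> (v + x))" for v
  proof -
    have "integrable (distr lborel borel ((+) v)) \<phi>" using i by (simp add: lborel_distr_plus)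
    then show ?thesis using meas(1) by (subst (asm) integrable_distr_eq) auto
  qed
  have q_int: "(LINT x|lborel. q n x) = 0" for n
    unfolding q_def using tr[of "s n *\<^sub>R e"] lborel_integral_translate[OF meas(1), of "s n *\<^sub>R e"] i
    by (simp add: add.commute)
  have "(\<lambda>n. LINT x|lborel. q n x) \<longlonglongrightarrow> (LINT x|lborel. grad \<phi> x \<bullet> e)"
  proof (rule integral_dominated_convergence[where w = "\<lambda>x. indicator K' x *\<^sub>R B'"])
    show "integrable lborel (\<lambda>x. indicator K' x *\<^sub>R B')"
      by (rule borel_integrable_compact) (auto simp: K'_def)
    show "AE x in lborel. norm (q n x) \<le> indicator K' x *\<^sub>R B'" for n
      using qb q0 by (intro AE_I2) (auto simp: indicator_def)
    show "AE x in lborel. (\<lambda>n. q n x) \<longlonglongrightarrow> grad \<phi> x \<bullet> e"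
    proof (intro AE_I2)
      fix x
      have "(\<lambda>h. (\<phi> (x + (0 + h) *\<^sub>R e) - \<phi> (x + 0 *\<^sub>R e)) / h) \<midarrow>0\<rightarrow> grad \<phi> (x + 0 *\<^sub>R e) \<bullet> e"
        using line[of x 0] unfolding DERIV_def .
      moreover have "filterlim s (at 0) sequentially"
        unfolding filterlim_at using s(1) LIMSEQ_inverse_real_of_nat
        by (auto simp: s_def[abs_def] intro!: always_eventually)
      ultimately have "(\<lambda>n. (\<phi> (x + (0 + s n) *\<^sub>R e) - \<phi> (x + 0 *\<^sub>R e)) / s n) \<longlonglongrightarrow> grad \<phi> (x + 0 *\<^sub>R e) \<bullet> e"
        by (rule filterlim_compose)
      then show "(\<lambda>n. q n x) \<longlonglongrightarrow> grad \<phi> x \<bullet> e" by (simp add: q_def)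
    qed
  qed (use meas in \<open>auto simp: q_def\<close>)
  then show ?thesis by (simp add: q_int LIMSEQ_const_iff)
qed

lemma test_functionsD:
  assumes "\<phi> \<in> test_functions D"
  shows "Ck k \<phi>" "\<exists>K. compact K \<and> K \<subseteq> D \<and> (\<forall>x. x \<notin> K \<longrightarrow> \<phi> x = 0)"
  using assms by (auto simp: test_functions_def)

lemma test_functions_mult:
  assumes "\<phi> \<in> test_functions D" "\<And>k. Ck k \<eta>"
  shows "(\<lambda>x. \<phi> x * \<eta> x) \<in> test_functions D"
proof -
  obtain K where "compact K" "K \<subseteq> D" "\<And>x. x \<notin> K \<Longrightarrow> \<phi> x = 0" using test_functionsD(2)[OF assms(1)] by blast
  moreover have "Ck k (\<lambda>x. \<phi> x * \<eta> x)" for k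
    by (intro Ck_mult assms test_functionsD[OF assms(1)])
  ultimately show ?thesis unfolding test_functions_def by auto
qed

lemma test_functions_cmult: "\<phi> \<in> test_functions D \<Longrightarrow> (\<lambda>x. c * \<phi> x) \<in> test_functions D"
  using test_functions_mult[of \<phi> D "\<lambda>x. c"] by (simp add: Ck_const mult.commute)

lemma test_functions_add:
  assumes "\<phi> \<in> test_functions D" "\<eta> \<in> test_functions D"
  shows "(\<lambda>x. \<phi> x + \<eta> x) \<in> test_functions D"
proof -
  obtain K where K: "compact K" "K \<subseteq> D" "\<And>x. x \<notin> K \<Longrightarrow> \<phi> x = 0" using test_functionsD(2)[OF assms(1)] by blast
  obtain L where L: "compact L" "L \<subseteq> D" "\<And>x. x \<notin> L \<Longrightarrow> \<eta> x = 0" using test_functionsD(2)[OF assms(2)] by blast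
  have "Ck k (\<lambda>x. \<phi> x + \<eta> x)" for k
    by (intro Ck_add test_functionsD[OF assms(1)] test_functionsD[OF assms(2)])
  moreover have "compact (K \<union> L)" using K L by blast
  moreover have "\<forall>x. x \<notin> K \<union> L \<longrightarrow> \<phi> x + \<eta> x = 0" using K(3) L(3) by simp
  ultimately show ?thesis unfolding test_functions_def using K(2) L(2) by blast
qed

lemma test_functions_zero: "(\<lambda>x. 0) \<in> test_functions D"
  by (auto simp: test_functions_def Ck_const intro!: exI[of _ "{}"])

lemma grad_test:
  assumes "\<phi> \<in> test_functions D"
  shows "(\<phi> has_derivative (\<lambda>h. grad \<phi> x \<bullet> h)) (at x)" "continuous_on UNIV (grad \<phi>)" "continuous_on UNIV \<phi>"
  using Ck_SucD_derivative[OF test_functionsD(1)[OF assms]] Ck_grad_continuous[OF test_functionsD(1)[OF assms]]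
    Ck_continuous[OF test_functionsD(1)[OF assms]] by blast+

lemma grad_add_test:
  assumes "\<phi> \<in> test_functions D" "\<eta> \<in> test_functions D"
  shows "grad (\<lambda>x. \<phi> x + \<eta> x) x = grad \<phi> x + grad \<eta> x"
  by (rule grad_eqI, rule has_derivative_eq_rhs[OF has_derivative_add[OF grad_test(1)[OF assms(1)] grad_test(1)[OF assms(2)]]])
     (simp add: inner_add_left fun_eq_iff)

lemma grad_cmult_test:
  assumes "\<phi> \<in> test_functions D"
  shows "grad (\<lambda>x. c * \<phi> x) x = c *\<^sub>R grad \<phi> x"
  by (rule grad_eqI, rule has_derivative_eq_rhs[OF has_derivative_mult_right[OF grad_test(1)[OF assms]]])
     (simp add: fun_eq_iff)

locale bounded_open =
  fixes D :: "'a::euclidean_space set"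
  assumes open_D: "open D" and bounded_D: "bounded D"
begin

lemma lebesgue_D [measurable]: "D \<in> sets lebesgue"
  using open_D by (simp add: borel_open)

lemma finite_D: "emeasure lebesgue D < \<infinity>"
  using bounded_set_imp_lmeasurable[OF bounded_D] by (simp add: fmeasurable_def)

lemma finite_measure_D: "finite_measure (lebesgue_on D)"
  using finite_D by (intro finite_measureI) (simp add: emeasure_restrict_space)

lemma test_L2: "\<phi> \<in> test_functions D \<Longrightarrow> \<phi> \<in> L2 D"
  using test_functionsD(2)[of \<phi> D] grad_test(3)[of \<phi> D] by (blast intro: L2_compact_support[OF _ _ _ _ lebesgue_D])

lemma grad_test_L2: "\<phi> \<in> test_functions D \<Longrightarrow> grad \<phi> \<in> L2 D"
  using test_functionsD(2)[of \<phi> D] grad_test(2)[of \<phi> D]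
  by (blast intro: L2_compact_support[OF _ _ _ _ lebesgue_D] grad_zero_outside)

lemma integral_grad_test:
  assumes t: "\<phi> \<in> test_functions D"
  shows "(LINT x|lebesgue_on D. grad \<phi> x \<bullet> e) = 0"
proof -
  obtain K where K: "compact K" "K \<subseteq> D" "\<And>x. x \<notin> K \<Longrightarrow> \<phi> x = 0" using test_functionsD(2)[OF t] by blast
  have "(LINT x|lebesgue_on D. grad \<phi> x \<bullet> e) = (LINT x|lborel. grad \<phi> x \<bullet> e)"
  proof (rule integral_lebesgue_on_supported(1)[OF _ lebesgue_D])
    show "(\<lambda>x. grad \<phi> x \<bullet> e) \<in> borel_measurable borel"
      by (intro borel_measurable_continuous_onI continuous_intros grad_test(2)[OF t])
    show "grad \<phi> x \<bullet> e = 0" if "x \<notin> D" for x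
    proof -
      have "x \<notin> K" using that K(2) by blast
      then have "grad \<phi> x = 0" by (intro grad_zero_outside[OF K(1)]) (simp_all only: K(3) not_False_eq_True)
      then show ?thesis by simp
    qed
  qed
  also have "\<dots> = 0" by (rule integral_grad_zero[OF test_functionsD(1)[OF t] K(1,3)])
  finally show ?thesis .
qed

lemma integral_by_parts:
  assumes \<phi>: "\<phi> \<in> test_functions D" and \<eta>: "\<eta> \<in> test_functions D"
  shows "(LINT x|lebesgue_on D. \<phi> x *\<^sub>R grad \<eta> x) = - (LINT x|lebesgue_on D. \<eta> x *\<^sub>R grad \<phi> x)"
proof (rule euclidean_eqI)
  fix i :: 'a assume "i \<in> Basis"
  note int = L2_scaleR_integrable[OF test_L2[OF \<phi>] grad_test_L2[OF \<eta>]]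
    L2_scaleR_integrable[OF test_L2[OF \<eta>] grad_test_L2[OF \<phi>]]
  have t: "(\<lambda>x. \<phi> x * \<eta> x) \<in> test_functions D" by (rule test_functions_mult[OF \<phi> test_functionsD(1)[OF \<eta>]])
  have gr: "grad (\<lambda>x. \<phi> x * \<eta> x) x = \<phi> x *\<^sub>R grad \<eta> x + \<eta> x *\<^sub>R grad \<phi> x" for x
    by (rule grad_eqI[OF has_derivative_mult_grad[OF grad_test(1)[OF \<phi>] grad_test(1)[OF \<eta>]]])
  have "0 = (LINT x|lebesgue_on D. grad (\<lambda>x. \<phi> x * \<eta> x) x \<bullet> i)"
    by (simp add: integral_grad_test[OF t])
  also have "\<dots> = (LINT x|lebesgue_on D. (\<phi> x *\<^sub>R grad \<eta> x) \<bullet> i + (\<eta> x *\<^sub>R grad \<phi> x) \<bullet> i)"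
    by (simp add: gr inner_add_left)
  also have "\<dots> = (LINT x|lebesgue_on D. (\<phi> x *\<^sub>R grad \<eta> x)) \<bullet> i + (LINT x|lebesgue_on D. (\<eta> x *\<^sub>R grad \<phi> x)) \<bullet> i"
    using int by (simp add: integrable_inner_left del: inner_scaleR_left)
  finally show "(LINT x|lebesgue_on D. \<phi> x *\<^sub>R grad \<eta> x) \<bullet> i = - (LINT x|lebesgue_on D. \<eta> x *\<^sub>R grad \<phi> x) \<bullet> i"
    by simp
qed

text \<open>
  As \<open>c\<close> tends to infinity, these test functions tend to the indicator of the open box while staying
  between \<open>0\<close> and \<open>1\<close>.
\<close>

lemma box_cutoff_test:
  assumes "cbox a b \<subseteq> D" and "c > 0"
  shows "(\<lambda>x. \<Prod>i\<in>Basis. flat_exp 0 (c * (x \<bullet> i - a \<bullet> i)) * flat_exp 0 (c * (b \<bullet> i - x \<bullet> i))) \<in> test_functions D"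
proof -
  let ?\<phi> = "\<lambda>x. \<Prod>i\<in>Basis. flat_exp 0 (c * (x \<bullet> i - a \<bullet> i)) * flat_exp 0 (c * (b \<bullet> i - x \<bullet> i))"
  have "Ck k ?\<phi>" for k
    by (intro Ck_prod Ck_mult Ck_flat_exp Ck_const Ck_diff Ck_inner_const) auto
  moreover have "?\<phi> x = 0" if x: "x \<notin> cbox a b" for x
  proof -
    obtain i where i: "i \<in> Basis" "x \<bullet> i < a \<bullet> i \<or> b \<bullet> i < x \<bullet> i" using x by (auto simp: mem_box not_le)
    then have "flat_exp 0 (c * (x \<bullet> i - a \<bullet> i)) * flat_exp 0 (c * (b \<bullet> i - x \<bullet> i)) = 0"
      using \<open>c > 0\<close> by (auto simp: flat_exp_eq_0 mult_nonneg_nonpos)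
    then show ?thesis using i(1) by (intro prod_zero) auto
  qed
  ultimately show ?thesis using assms unfolding test_functions_def
    by (auto intro!: exI[of _ "cbox a b"])
qed

lemma integral_box_zero:
  fixes g :: "'a \<Rightarrow> real"
  assumes g: "integrable (lebesgue_on D) g"
    and z: "\<And>\<phi>. \<phi> \<in> test_functions D \<Longrightarrow> (LINT x|lebesgue_on D. \<phi> x * g x) = 0"
    and D: "cbox a b \<subseteq> D"
  shows "(LINT x|lebesgue_on D. indicator (box a b) x * g x) = 0"
proof -
  define \<phi> where "\<phi> n x = (\<Prod>i\<in>Basis. flat_exp 0 (real (Suc n) * (x \<bullet> i - a \<bullet> i)) * flat_exp 0 (real (Suc n) * (b \<bullet> i - x \<bullet> i)))"
    for n x
  have t: "\<phi> n \<in> test_functions D" for n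
    unfolding \<phi>_def by (rule box_cutoff_test[OF D]) (rule of_nat_0_less_iff[THEN iffD2], simp)
  (* exp (-1 / (n y)) tends to 1 for positive y. *)
  have lim1: "(\<lambda>n. flat_exp 0 (real (Suc n) * y)) \<longlonglongrightarrow> (if y > 0 then 1 else 0)" for y
  proof (cases "y > 0")
    case True
    have "(\<lambda>n. exp (- ((1 / y) * inverse (real (Suc n))))) \<longlonglongrightarrow> exp (- ((1 / y) * 0))"
      by (intro tendsto_intros LIMSEQ_inverse_real_of_nat)
    moreover have "exp (- ((1 / y) * inverse (real (Suc n)))) = flat_exp 0 (real (Suc n) * y)" for n
      using True by (simp add: flat_exp_def field_simps add_pos_nonneg)
    ultimately show ?thesis using True by simp
  qed (simp add: flat_exp_eq_0 mult_nonneg_nonpos)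
  have lim: "(\<lambda>n. \<phi> n x) \<longlonglongrightarrow> indicator (box a b) x" for x
  proof -
    have "(\<lambda>n. \<phi> n x) \<longlonglongrightarrow> (\<Prod>i\<in>Basis. (if x \<bullet> i - a \<bullet> i > 0 then 1 else 0) * (if b \<bullet> i - x \<bullet> i > 0 then 1 else 0))"
      unfolding \<phi>_def by (intro tendsto_prod tendsto_mult lim1)
    also have "(\<Prod>i\<in>Basis. (if x \<bullet> i - a \<bullet> i > 0 then 1 else 0) * (if b \<bullet> i - x \<bullet> i > 0 then 1 else 0)) = (indicator (box a b) x :: real)"
    proof (cases "x \<in> box a b")
      case True then show ?thesis by (auto simp: mem_box intro!: prod.neutral)
    next
      case False
      then obtain i where "i \<in> Basis" "\<not> (a \<bullet> i < x \<bullet> i \<and> x \<bullet> i < b \<bullet> i)" by (auto simp: mem_box)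
      then show ?thesis using False by (auto intro!: prod_zero bexI[of _ i])
    qed
    finally show ?thesis .
  qed
  have bd: "\<bar>\<phi> n x\<bar> \<le> 1" for n x
    unfolding \<phi>_def abs_prod
    by (intro prod_le_1) (auto simp: abs_mult flat_exp_nonneg intro!: mult_le_one flat_exp_0_le_1 mult_nonneg_nonneg)
  have mg: "g \<in> borel_measurable (lebesgue_on D)" using g by simp
  have m\<phi>: "\<phi> n \<in> borel_measurable (lebesgue_on D)" for n using L2D(1)[OF test_L2[OF t]] .
  have "(\<lambda>n. LINT x|lebesgue_on D. \<phi> n x * g x) \<longlonglongrightarrow> (LINT x|lebesgue_on D. indicator (box a b) x * g x)"
  proof (rule integral_dominated_convergence[where w = "\<lambda>x. \<bar>g x\<bar>"])
    show "AE x in lebesgue_on D. (\<lambda>n. \<phi> n x * g x) \<longlonglongrightarrow> indicator (box a b) x * g x"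
      by (intro AE_I2 tendsto_intros lim)
    show "AE x in lebesgue_on D. norm (\<phi> n x * g x) \<le> \<bar>g x\<bar>" for n
      by (intro AE_I2) (auto simp: abs_mult intro!: mult_left_le_one_le bd)
    show "(\<lambda>x. indicator (box a b) x * g x) \<in> borel_measurable (lebesgue_on D)"
      by (rule borel_measurable_LIMSEQ_real[where u = "\<lambda>n x. \<phi> n x * g x"])
         (auto intro!: tendsto_intros lim borel_measurable_times m\<phi> mg)
  qed (use g mg m\<phi> in \<open>auto intro!: borel_measurable_times\<close>)
  then show ?thesis by (simp add: z[OF t] LIMSEQ_const_iff)
qed

text \<open>
  The fundamental lemma of the calculus of variations. On a closed box inside \<open>D\<close> the integral of \<open>g\<close>
  over every smaller box vanishes, so \<open>g\<close> vanishes there; countably many such boxes cover \<open>D\<close>. The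
  Lebesgue measurable \<open>g\<close> is first replaced by a Borel function.
\<close>

lemma fundamental_lemma:
  fixes g :: "'a \<Rightarrow> real"
  assumes g: "integrable (lebesgue_on D) g"
    and z: "\<And>\<phi>. \<phi> \<in> test_functions D \<Longrightarrow> (LINT x|lebesgue_on D. \<phi> x * g x) = 0"
  shows "AE x in lebesgue_on D. g x = 0"
proof -
  have gi: "integrable lebesgue (\<lambda>x. indicator D x * g x)"
    using g by (simp add: integrable_restrict_space)
  then obtain g' where g': "g' \<in> borel_measurable lborel" "AE x in lborel. indicator D x * g x = g' x"
    using completion_ex_borel_measurable_real[of "\<lambda>x. indicator D x * g x" lborel] by auto
  have AEg': "AE x in lebesgue. indicator D x * g x = g' x" using g'(2) by (rule AE_completion)
  have ig': "integrable lborel g'"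
  proof -
    have "integrable lebesgue g'"
      using gi AEg' g'(1) by (subst integrable_cong_AE[symmetric]) (auto intro: measurable_completion)
    then show ?thesis using integrable_completion[OF g'(1)] by simp
  qed
  have zero_box: "AE x in lebesgue. x \<in> cbox a b \<longrightarrow> g x = 0" if D: "cbox a b \<subseteq> D" for a b
  proof -
    have boxD: "box a b \<subseteq> D" using D box_subset_cbox by blast
    have "AE x in lborel. indicator (box a b) x * g' x = 0"
    proof (rule AE_zero_of_boxes)
      show "integrable lborel (\<lambda>x. indicator (box a b) x * g' x)"
        using integrable_mult_indicator[OF _ ig', of "box a b"] by simp
    next
      fix c d :: 'a
      obtain e f where ef: "box c d \<inter> box a b = box e f" using box_Int_box by blast
      have efD: "cbox e f \<subseteq> D" if "box e f \<noteq> {}"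
      proof -
        have "cbox e f = closure (box e f)" using closure_box[OF that] by simp
        also have "\<dots> \<subseteq> closure (box a b)" using ef by (intro closure_mono) blast
        also have "\<dots> \<subseteq> cbox a b" by (intro closure_minimal box_subset_cbox closed_cbox)
        finally show ?thesis using D by blast
      qed
      have "(LINT x:box c d|lborel. indicator (box a b) x * g' x) = (LINT x|lborel. indicator (box e f) x * g' x)"
        unfolding set_lebesgue_integral_def ef[symmetric] by (simp add: indicator_inter_arith mult.assoc)
      also have "\<dots> = (LINT x|lebesgue. indicator (box e f) x * g' x)"
        using g'(1) by (intro integral_completion[symmetric]) auto
      also have "\<dots> = (LINT x|lebesgue. indicator D x * (indicator (box e f) x * g x))"
      proof (rule integral_cong_AE)
        show "AE x in lebesgue. indicator (box e f) x * g' x = indicator D x * (indicator (box e f) x * g x)"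
          using AEg' by eventually_elim (auto simp: algebra_simps)
        show "(\<lambda>x. indicator D x * (indicator (box e f) x * g x)) \<in> borel_measurable lebesgue"
        proof -
          have "(\<lambda>x. indicator (box e f) x * (indicator D x * g x)) \<in> borel_measurable lebesgue"
            using borel_measurable_integrable[OF gi]
            by (rule borel_measurable_times[rotated]) (intro borel_measurable_indicator, simp)
          then show ?thesis by (simp add: mult.left_commute)
        qed
      qed (use g'(1) in \<open>auto intro!: borel_measurable_times measurable_completion\<close>)
      also have "\<dots> = (LINT x|lebesgue_on D. indicator (box e f) x * g x)"
        by (simp add: integral_restrict_space)
      also have "\<dots> = 0"
      proof (cases "box e f = {}")
        case False
        show ?thesis by (rule integral_box_zero[OF g _ efD[OF False]]) (rule z)
      qed simp
      finally show "(LINT x:box c d|lborel. indicator (box a b) x * g' x) = 0" .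
    qed
    then have "AE x in lebesgue. indicator (box a b) x * g' x = 0" by (rule AE_completion)
    moreover have "AE x in lebesgue. x \<notin> cbox a b - box a b"
      using negligible_frontier_interval[of a b] by (intro AE_not_in) (simp add: negligible_iff_null_sets)
    ultimately show ?thesis using AEg'
    proof eventually_elim
      case (elim x)
      then show ?case using D boxD by (auto simp: indicator_def split: if_splits)
    qed
  qed
  obtain \<D> where \<D>: "countable \<D>" "\<D> \<subseteq> Pow D" "\<And>X. X \<in> \<D> \<Longrightarrow> \<exists>a b. X = cbox a b" "\<Union>\<D> = D"
    using open_countable_Union_open_cbox[OF open_D] by metis
  have "AE x in lebesgue. \<forall>X\<in>\<D>. x \<in> X \<longrightarrow> g x = 0"
  proof (subst AE_ball_countable[OF \<D>(1)], intro ballI)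
    fix X assume "X \<in> \<D>"
    then show "AE x in lebesgue. x \<in> X \<longrightarrow> g x = 0" using \<D>(2,3) zero_box by blast
  qed
  then have "AE x in lebesgue. x \<in> D \<longrightarrow> g x = 0"
    by eventually_elim (use \<D>(4) in blast)
  then show ?thesis by (subst AE_restrict_space_iff) auto
qed

end

section \<open>Weak gradients and the space of functions vanishing on the boundary\<close>

lemma L2_component:
  assumes "F \<in> L2 D" "i \<in> Basis"
  shows "(\<lambda>x. F x \<bullet> i) \<in> L2 D" "L2_norm D (\<lambda>x. F x \<bullet> i) \<le> L2_norm D F"
proof -
  have le: "(norm (F x \<bullet> i))\<^sup>2 \<le> (norm (F x))\<^sup>2" for x
    using Basis_le_norm[OF assms(2), of "F x"] by (simp add: abs_le_square_iff[symmetric])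
  show c: "(\<lambda>x. F x \<bullet> i) \<in> L2 D"
    by (rule L2I_bound[OF _ L2D(2)[OF assms(1)] le])
       (use L2D(1)[OF assms(1)] in \<open>auto intro!: borel_measurable_inner\<close>)
  show "L2_norm D (\<lambda>x. F x \<bullet> i) \<le> L2_norm D F"
    unfolding L2_norm_def
    by (intro real_sqrt_le_mono integral_mono L2D(2)[OF c] L2D(2)[OF assms(1)] le)
qed

context bounded_open begin

text \<open>
  Both gradients have the same integrals against test functions, so the fundamental lemma applies to every
  component of their difference. Consequently the arbitrary choice in \<open>weak_grad\<close> matters on a null set only, and identities between
  gradients may be computed with any representative.
\<close>

lemma weak_grad_unique:
  assumes "is_weak_grad D v G" "is_weak_grad D v H"
  shows "AE x in lebesgue_on D. G x = H x"
proof -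
  have G: "G \<in> L2 D" and H: "H \<in> L2 D" using assms by (auto simp: is_weak_grad_def)
  have "AE x in lebesgue_on D. G x \<bullet> i - H x \<bullet> i = 0" for i
  proof (rule fundamental_lemma)
    have one: "(\<lambda>x. i) \<in> L2 D"
      using finite_measure_D by (auto simp: L2_def intro: finite_measure.integrable_const)
    show "integrable (lebesgue_on D) (\<lambda>x. G x \<bullet> i - H x \<bullet> i)"
      using L2_inner_integrable[OF G one] L2_inner_integrable[OF H one] by simp
  next
    fix \<phi> assume \<phi>: "\<phi> \<in> test_functions D"
    note int = L2_scaleR_integrable[OF test_L2[OF \<phi>] G] L2_scaleR_integrable[OF test_L2[OF \<phi>] H]
    have "(LINT x|lebesgue_on D. \<phi> x *\<^sub>R G x) = (LINT x|lebesgue_on D. \<phi> x *\<^sub>R H x)"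
      using assms \<phi> by (simp add: is_weak_grad_def)
    then have "0 = (LINT x|lebesgue_on D. \<phi> x *\<^sub>R G x) \<bullet> i - (LINT x|lebesgue_on D. \<phi> x *\<^sub>R H x) \<bullet> i" by simp
    also have "\<dots> = (LINT x|lebesgue_on D. (\<phi> x *\<^sub>R G x) \<bullet> i - (\<phi> x *\<^sub>R H x) \<bullet> i)"
      using int by (simp add: integrable_inner_left del: inner_scaleR_left)
    also have "\<dots> = (LINT x|lebesgue_on D. \<phi> x * (G x \<bullet> i - H x \<bullet> i))" by (simp add: algebra_simps)
    finally show "(LINT x|lebesgue_on D. \<phi> x * (G x \<bullet> i - H x \<bullet> i)) = 0" by simp
  qed
  then have "AE x in lebesgue_on D. \<forall>i\<in>Basis. G x \<bullet> i - H x \<bullet> i = 0"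
    by (subst AE_finite_all) auto
  then show ?thesis by eventually_elim (auto intro: euclidean_eqI)
qed

lemma weak_grad_works:
  assumes "v \<in> H1 D" shows "is_weak_grad D v (weak_grad D v)"
  using assms someI_ex[of "is_weak_grad D v"] unfolding H1_def weak_grad_def by blast

lemma H10_D:
  assumes "v \<in> H10 D"
  shows "v \<in> L2 D" "weak_grad D v \<in> L2 D" "is_weak_grad D v (weak_grad D v)"
proof -
  have "v \<in> H1 D" using assms by (simp add: H10_def)
  then show "v \<in> L2 D" "is_weak_grad D v (weak_grad D v)"
    using weak_grad_works by (auto simp: H1_def)
  then show "weak_grad D v \<in> L2 D" by (simp add: is_weak_grad_def)
qed

lemma H10_approx:
  assumes "v \<in> H10 D"
  obtains \<phi> where "\<And>n. \<phi> n \<in> test_functions D"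
    "(\<lambda>n. L2_norm D (\<lambda>x. v x - \<phi> n x)) \<longlonglongrightarrow> 0"
    "(\<lambda>n. L2_norm D (\<lambda>x. weak_grad D v x - grad (\<phi> n) x)) \<longlonglongrightarrow> 0"
  using assms unfolding H10_def by auto

text \<open>
  A limit of test functions, in \<open>L\<^sup>2\<close> together with the gradients, lies in \<open>H\<^sup>1\<^sub>0(D)\<close>, and the limit of the
  gradients is its weak gradient: integration by parts passes to the limit. Linearity and completeness of
  \<open>H\<^sup>1\<^sub>0(D)\<close> both reduce to this.
\<close>

lemma H10_limit:
  assumes v: "v \<in> L2 D" and G: "G \<in> L2 D" and \<phi>: "\<And>n. \<phi> n \<in> test_functions D"
    and lim: "(\<lambda>n. L2_norm D (\<lambda>x. v x - \<phi> n x)) \<longlonglongrightarrow> 0"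
      "(\<lambda>n. L2_norm D (\<lambda>x. G x - grad (\<phi> n) x)) \<longlonglongrightarrow> 0"
  shows "v \<in> H10 D" "AE x in lebesgue_on D. weak_grad D v x = G x"
proof -
  have w: "is_weak_grad D v G"
    unfolding is_weak_grad_def
  proof (intro conjI G ballI, rule euclidean_eqI)
    fix \<eta> and i :: 'a assume \<eta>: "\<eta> \<in> test_functions D" and i: "i \<in> Basis"
    have gi: "(\<lambda>x. grad \<eta> x \<bullet> i) \<in> L2 D"
      by (rule L2_component(1)[OF grad_test_L2[OF \<eta>] i])
    have \<eta>i: "(\<lambda>x. \<eta> x *\<^sub>R i) \<in> L2 D"
      by (rule L2I_bound[OF _ L2D(2)[OF test_L2[OF \<eta>]]])
         (use L2D(1)[OF test_L2[OF \<eta>]] i in \<open>auto intro!: borel_measurable_scaleR\<close>)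
    have l1: "(\<lambda>n. LINT x|lebesgue_on D. \<phi> n x \<bullet> (grad \<eta> x \<bullet> i)) \<longlonglongrightarrow> (LINT x|lebesgue_on D. v x \<bullet> (grad \<eta> x \<bullet> i))"
      by (rule L2_tendsto_inner[OF v test_L2[OF \<phi>] gi lim(1)])
    have l2: "(\<lambda>n. LINT x|lebesgue_on D. grad (\<phi> n) x \<bullet> (\<eta> x *\<^sub>R i)) \<longlonglongrightarrow> (LINT x|lebesgue_on D. G x \<bullet> (\<eta> x *\<^sub>R i))"
      by (rule L2_tendsto_inner[OF G grad_test_L2[OF \<phi>] \<eta>i lim(2)])
    have A: "(LINT x|lebesgue_on D. w x *\<^sub>R grad \<eta> x) \<bullet> i = (LINT x|lebesgue_on D. w x \<bullet> (grad \<eta> x \<bullet> i))"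
      if "w \<in> L2 D" for w :: "'a \<Rightarrow> real"
      by (subst integral_inner_left[symmetric])
         (use L2_scaleR_integrable[OF that grad_test_L2[OF \<eta>]] in auto)
    have B: "(LINT x|lebesgue_on D. \<eta> x *\<^sub>R F x) \<bullet> i = (LINT x|lebesgue_on D. F x \<bullet> (\<eta> x *\<^sub>R i))"
      if "F \<in> L2 D" for F :: "'a \<Rightarrow> 'a"
      by (subst integral_inner_left[symmetric])
         (use L2_scaleR_integrable[OF test_L2[OF \<eta>] that] in auto)
    have "(LINT x|lebesgue_on D. \<phi> n x \<bullet> (grad \<eta> x \<bullet> i)) = - (LINT x|lebesgue_on D. grad (\<phi> n) x \<bullet> (\<eta> x *\<^sub>R i))" for n
      unfolding A[OF test_L2[OF \<phi>], symmetric] B[OF grad_test_L2[OF \<phi>], symmetric]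
      using integral_by_parts[OF \<phi> \<eta>, of n] by simp
    then have "(LINT x|lebesgue_on D. v x \<bullet> (grad \<eta> x \<bullet> i)) = - (LINT x|lebesgue_on D. G x \<bullet> (\<eta> x *\<^sub>R i))"
      using LIMSEQ_unique[OF l1] tendsto_minus[OF l2] by simp
    then show "(LINT x|lebesgue_on D. v x *\<^sub>R grad \<eta> x) \<bullet> i = - (LINT x|lebesgue_on D. \<eta> x *\<^sub>R G x) \<bullet> i"
      unfolding A[OF v, symmetric] B[OF G, symmetric] by simp
  qed
  then have H1: "v \<in> H1 D" using v by (auto simp: H1_def)
  show ae: "AE x in lebesgue_on D. weak_grad D v x = G x"
    by (rule weak_grad_unique[OF weak_grad_works[OF H1] w])
  have wL: "weak_grad D v \<in> L2 D" using weak_grad_works[OF H1] by (simp add: is_weak_grad_def)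
  have "L2_norm D (\<lambda>x. weak_grad D v x - grad (\<phi> n) x) = L2_norm D (\<lambda>x. G x - grad (\<phi> n) x)" for n
    by (intro L2_norm_cong_AE L2_diff wL G grad_test_L2 \<phi>) (use ae in eventually_elim, simp)
  then show "v \<in> H10 D" unfolding H10_def using H1 \<phi> lim
    by (intro CollectI conjI exI[of _ \<phi>]) simp_all
qed

lemma H10_lincomb:
  assumes v: "v \<in> H10 D" and w: "w \<in> H10 D"
  shows "(\<lambda>x. c * v x + d * w x) \<in> H10 D"
    "AE x in lebesgue_on D. weak_grad D (\<lambda>x. c * v x + d * w x) x = c *\<^sub>R weak_grad D v x + d *\<^sub>R weak_grad D w x"
proof -
  obtain \<phi> where \<phi>: "\<And>n. \<phi> n \<in> test_functions D" "(\<lambda>n. L2_norm D (\<lambda>x. v x - \<phi> n x)) \<longlonglongrightarrow> 0"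
    "(\<lambda>n. L2_norm D (\<lambda>x. weak_grad D v x - grad (\<phi> n) x)) \<longlonglongrightarrow> 0" by (rule H10_approx[OF v]) blast
  obtain \<eta> where \<eta>: "\<And>n. \<eta> n \<in> test_functions D" "(\<lambda>n. L2_norm D (\<lambda>x. w x - \<eta> n x)) \<longlonglongrightarrow> 0"
    "(\<lambda>n. L2_norm D (\<lambda>x. weak_grad D w x - grad (\<eta> n) x)) \<longlonglongrightarrow> 0" by (rule H10_approx[OF w]) blast
  note L = H10_D[OF v] H10_D[OF w]
  have comb: "(\<lambda>n. L2_norm D (\<lambda>x. (c *\<^sub>R p x + d *\<^sub>R q x) - (c *\<^sub>R P n x + d *\<^sub>R Q n x))) \<longlonglongrightarrow> 0"
    if "p \<in> L2 D" "q \<in> L2 D" "\<And>n. P n \<in> L2 D" "\<And>n. Q n \<in> L2 D"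
      and l: "(\<lambda>n. L2_norm D (\<lambda>x. p x - P n x)) \<longlonglongrightarrow> 0" "(\<lambda>n. L2_norm D (\<lambda>x. q x - Q n x)) \<longlonglongrightarrow> 0"
    for p q :: "'a \<Rightarrow> 'b::euclidean_space" and P Q
  proof (rule tendsto_sandwich[where f = "\<lambda>n. 0"])
    show "(\<lambda>n. \<bar>c\<bar> * L2_norm D (\<lambda>x. p x - P n x) + \<bar>d\<bar> * L2_norm D (\<lambda>x. q x - Q n x)) \<longlonglongrightarrow> 0"
      using tendsto_add[OF tendsto_mult_left[OF l(1), of "\<bar>c\<bar>"] tendsto_mult_left[OF l(2), of "\<bar>d\<bar>"]] by simp
    show "\<forall>\<^sub>F n in sequentially. L2_norm D (\<lambda>x. (c *\<^sub>R p x + d *\<^sub>R q x) - (c *\<^sub>R P n x + d *\<^sub>R Q n x))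
       \<le> \<bar>c\<bar> * L2_norm D (\<lambda>x. p x - P n x) + \<bar>d\<bar> * L2_norm D (\<lambda>x. q x - Q n x)"
    proof (intro always_eventually allI)
      fix n
      have "L2_norm D (\<lambda>x. (c *\<^sub>R p x + d *\<^sub>R q x) - (c *\<^sub>R P n x + d *\<^sub>R Q n x)) =
          L2_norm D (\<lambda>x. c *\<^sub>R (p x - P n x) + d *\<^sub>R (q x - Q n x))" by (simp add: algebra_simps)
      also have "\<dots> \<le> L2_norm D (\<lambda>x. c *\<^sub>R (p x - P n x)) + L2_norm D (\<lambda>x. d *\<^sub>R (q x - Q n x))"
        by (intro L2_norm_triangle L2_scaleR L2_diff that)
      finally show "L2_norm D (\<lambda>x. (c *\<^sub>R p x + d *\<^sub>R q x) - (c *\<^sub>R P n x + d *\<^sub>R Q n x))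
         \<le> \<bar>c\<bar> * L2_norm D (\<lambda>x. p x - P n x) + \<bar>d\<bar> * L2_norm D (\<lambda>x. q x - Q n x)"
        by (simp add: L2_norm_scaleR)
    qed
  qed auto
  have t: "(\<lambda>x. c * \<phi> n x + d * \<eta> n x) \<in> test_functions D" for n
    by (intro test_functions_add test_functions_cmult \<phi>(1) \<eta>(1))
  have g: "grad (\<lambda>x. c * \<phi> n x + d * \<eta> n x) = (\<lambda>x. c *\<^sub>R grad (\<phi> n) x + d *\<^sub>R grad (\<eta> n) x)" for n
    by (rule ext) (simp add: grad_add_test[OF test_functions_cmult[OF \<phi>(1)] test_functions_cmult[OF \<eta>(1)]]
        grad_cmult_test[OF \<phi>(1)] grad_cmult_test[OF \<eta>(1)])
  have L1: "(\<lambda>x. c * v x + d * w x) \<in> L2 D"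
    using L2_add[OF L2_scaleR[OF L(1), of c] L2_scaleR[OF L(4), of d]] by simp
  have L2: "(\<lambda>x. c *\<^sub>R weak_grad D v x + d *\<^sub>R weak_grad D w x) \<in> L2 D"
    by (intro L2_add L2_scaleR L)
  have c1: "(\<lambda>n. L2_norm D (\<lambda>x. (c * v x + d * w x) - (c * \<phi> n x + d * \<eta> n x))) \<longlonglongrightarrow> 0"
    using comb[OF L(1) L(4) test_L2[OF \<phi>(1)] test_L2[OF \<eta>(1)] \<phi>(2) \<eta>(2)] by simp
  have c2: "(\<lambda>n. L2_norm D (\<lambda>x. (c *\<^sub>R weak_grad D v x + d *\<^sub>R weak_grad D w x) - grad (\<lambda>x. c * \<phi> n x + d * \<eta> n x) x)) \<longlonglongrightarrow> 0"
    unfolding g by (rule comb[OF L(2) L(5) grad_test_L2[OF \<phi>(1)] grad_test_L2[OF \<eta>(1)] \<phi>(3) \<eta>(3)])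
  show "(\<lambda>x. c * v x + d * w x) \<in> H10 D"
    "AE x in lebesgue_on D. weak_grad D (\<lambda>x. c * v x + d * w x) x = c *\<^sub>R weak_grad D v x + d *\<^sub>R weak_grad D w x"
    using H10_limit[OF L1 L2 t c1 c2] by blast+
qed

lemma H10_diff:
  assumes "v \<in> H10 D" "w \<in> H10 D"
  shows "(\<lambda>x. v x - w x) \<in> H10 D"
    "AE x in lebesgue_on D. weak_grad D (\<lambda>x. v x - w x) x = weak_grad D v x - weak_grad D w x"
  using H10_lincomb[OF assms, of 1 "-1"] by simp_all

lemma test_H10:
  assumes "\<phi> \<in> test_functions D"
  shows "\<phi> \<in> H10 D" "AE x in lebesgue_on D. weak_grad D \<phi> x = grad \<phi> x"
  using H10_limit[OF test_L2[OF assms] grad_test_L2[OF assms] assms] by (simp_all add: L2_norm_def)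

lemma zero_H10: "(\<lambda>x. 0) \<in> H10 D"
  by (rule test_H10(1)[OF test_functions_zero])

lemma V_norm_nonneg [simp]: "0 \<le> V_norm D v"
  by (simp add: V_norm_def)

lemma V_norm_diff_eq:
  assumes "v \<in> H10 D" "w \<in> H10 D"
  shows "V_norm D (\<lambda>x. v x - w x) = L2_norm D (\<lambda>x. weak_grad D v x - weak_grad D w x)"
  unfolding V_norm_def
  by (intro L2_norm_cong_AE H10_D H10_diff L2_diff assms)

lemma V_norm_triangle_diff:
  assumes "u \<in> H10 D" "v \<in> H10 D" "w \<in> H10 D"
  shows "V_norm D (\<lambda>x. u x - w x) \<le> V_norm D (\<lambda>x. u x - v x) + V_norm D (\<lambda>x. v x - w x)"
  using assms by (simp add: V_norm_diff_eq L2_norm_triangle_diff H10_D)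

text \<open>
  The divergence of \<open>\<phi>\<^sup>2 (x \<bullet> i) i\<close> integrates to zero. Expanding it expresses \<open>\<integral> \<phi>\<^sup>2\<close> through
  \<open>\<integral> \<phi> (x \<bullet> i) (grad \<phi> \<bullet> i)\<close>, and \<open>x \<bullet> i\<close> is bounded on \<open>D\<close>.
\<close>

lemma Poincare_test:
  assumes R: "\<And>x. x \<in> D \<Longrightarrow> norm x \<le> R" and \<phi>: "\<phi> \<in> test_functions D"
  shows "L2_norm D \<phi> \<le> 2 * max R 0 * L2_norm D (grad \<phi>)"
proof -
  obtain i :: 'a where i: "i \<in> Basis" using nonempty_Basis by blast
  let ?R = "max R 0"
  have t: "(\<lambda>x. \<phi> x * (\<phi> x * (x \<bullet> i))) \<in> test_functions D"
    by (rule test_functions_mult[OF \<phi>]) (intro Ck_mult Ck_inner_const test_functionsD[OF \<phi>])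
  let ?\<psi> = "\<lambda>x. \<phi> x * (\<phi> x * (x \<bullet> i))"
  have lin: "((\<lambda>x. x \<bullet> i) has_derivative (\<lambda>h. i \<bullet> h)) (at x)" for x :: 'a
    by (auto intro!: derivative_eq_intros simp: inner_commute)
  have gr: "grad ?\<psi> x = \<phi> x *\<^sub>R (\<phi> x *\<^sub>R i + (x \<bullet> i) *\<^sub>R grad \<phi> x) + (\<phi> x * (x \<bullet> i)) *\<^sub>R grad \<phi> x" for x
    by (rule grad_eqI, rule has_derivative_mult_grad[OF grad_test(1)[OF \<phi>] has_derivative_mult_grad[OF grad_test(1)[OF \<phi>] lin]])
  have gL: "(\<lambda>x. (x \<bullet> i) * (grad \<phi> x \<bullet> i)) \<in> L2 D"
    and gn: "L2_norm D (\<lambda>x. (x \<bullet> i) * (grad \<phi> x \<bullet> i)) \<le> ?R * L2_norm D (grad \<phi>)"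
  proof -
    have m: "(\<lambda>x::'a. x \<bullet> i) \<in> borel_measurable (lebesgue_on D)"
      by (intro measurable_restrict_space1 measurable_completion) simp
    have b: "\<bar>x \<bullet> i\<bar> \<le> ?R" if "x \<in> D" for x
      using Basis_le_norm[OF i, of x] R[OF that] by simp
    note c = L2_component[OF grad_test_L2[OF \<phi>] i]
    show "(\<lambda>x. (x \<bullet> i) * (grad \<phi> x \<bullet> i)) \<in> L2 D"
      using L2_bounded_mult[OF c(1) m b] by simp
    have "L2_norm D (\<lambda>x. (x \<bullet> i) * (grad \<phi> x \<bullet> i)) \<le> ?R * L2_norm D (\<lambda>x. grad \<phi> x \<bullet> i)"
      using L2_norm_bounded_mult[OF c(1) m b] by simp
    also have "\<dots> \<le> ?R * L2_norm D (grad \<phi>)" by (intro mult_left_mono c(2)) auto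
    finally show "L2_norm D (\<lambda>x. (x \<bullet> i) * (grad \<phi> x \<bullet> i)) \<le> ?R * L2_norm D (grad \<phi>)" .
  qed
  have "0 = (LINT x|lebesgue_on D. grad ?\<psi> x \<bullet> i)" by (rule integral_grad_test[OF t, symmetric])
  also have "(\<lambda>x. grad ?\<psi> x \<bullet> i) = (\<lambda>x. (norm (\<phi> x))\<^sup>2 + 2 * (\<phi> x * ((x \<bullet> i) * (grad \<phi> x \<bullet> i))))"
    using i by (simp add: gr inner_add_left power2_eq_square algebra_simps)
  also have "(LINT x|lebesgue_on D. \<dots> x) = (L2_norm D \<phi>)\<^sup>2 + 2 * (LINT x|lebesgue_on D. \<phi> x * ((x \<bullet> i) * (grad \<phi> x \<bullet> i)))"
    using L2D(2)[OF test_L2[OF \<phi>]] L2_mult_integrable[OF test_L2[OF \<phi>] gL] by (simp add: L2_norm_sq)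
  finally have "(L2_norm D \<phi>)\<^sup>2 = - 2 * (LINT x|lebesgue_on D. \<phi> x * ((x \<bullet> i) * (grad \<phi> x \<bullet> i)))" by simp
  also have "\<dots> \<le> 2 * (L2_norm D \<phi> * L2_norm D (\<lambda>x. (x \<bullet> i) * (grad \<phi> x \<bullet> i)))"
    using L2_Cauchy_Schwarz[OF test_L2[OF \<phi>] gL] by simp
  also have "\<dots> \<le> 2 * (L2_norm D \<phi> * (?R * L2_norm D (grad \<phi>)))"
    by (intro mult_left_mono gn) auto
  finally have "L2_norm D \<phi> * L2_norm D \<phi> \<le> L2_norm D \<phi> * (2 * ?R * L2_norm D (grad \<phi>))"
    by (simp add: power2_eq_square algebra_simps)
  then show ?thesis
    by (cases "L2_norm D \<phi> = 0") (auto simp: mult_le_cancel_left less_le)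
qed

definition poincare :: real where
  "poincare = (SOME C. 0 < C \<and> (\<forall>v\<in>H10 D. L2_norm D v \<le> C * V_norm D v))"

lemma Poincare:
  shows "0 < poincare" "v \<in> H10 D \<Longrightarrow> L2_norm D v \<le> poincare * V_norm D v"
proof -
  obtain R where R: "\<And>x. x \<in> D \<Longrightarrow> norm x \<le> R" using bounded_D unfolding bounded_iff by blast
  let ?C = "2 * max R 0 + 1"
  have "L2_norm D v \<le> ?C * V_norm D v" if v: "v \<in> H10 D" for v
  proof -
    obtain \<phi> where \<phi>: "\<And>n. \<phi> n \<in> test_functions D" "(\<lambda>n. L2_norm D (\<lambda>x. v x - \<phi> n x)) \<longlonglongrightarrow> 0"
      "(\<lambda>n. L2_norm D (\<lambda>x. weak_grad D v x - grad (\<phi> n) x)) \<longlonglongrightarrow> 0" by (rule H10_approx[OF v]) blast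
    have le: "L2_norm D (\<phi> n) \<le> ?C * L2_norm D (grad (\<phi> n))" for n
      using Poincare_test[OF R \<phi>(1), of n] L2_norm_nonneg[of D "grad (\<phi> n)"]
      unfolding distrib_right mult_1 by linarith
    have l1: "(\<lambda>n. L2_norm D (\<phi> n)) \<longlonglongrightarrow> L2_norm D v"
      by (rule L2_tendsto_norm[OF H10_D(1)[OF v] test_L2[OF \<phi>(1)] \<phi>(2)])
    have l2: "(\<lambda>n. ?C * L2_norm D (grad (\<phi> n))) \<longlonglongrightarrow> ?C * V_norm D v"
      unfolding V_norm_def
      by (intro tendsto_mult tendsto_const L2_tendsto_norm[OF H10_D(2)[OF v] grad_test_L2[OF \<phi>(1)] \<phi>(3)])
    show ?thesis by (rule LIMSEQ_le[OF l1 l2]) (use le in blast)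
  qed
  then have "0 < ?C \<and> (\<forall>v\<in>H10 D. L2_norm D v \<le> ?C * V_norm D v)" by auto
  then have "0 < poincare \<and> (\<forall>v\<in>H10 D. L2_norm D v \<le> poincare * V_norm D v)"
    unfolding poincare_def by (rule someI)
  then show "0 < poincare" "v \<in> H10 D \<Longrightarrow> L2_norm D v \<le> poincare * V_norm D v" by auto
qed

end

section \<open>Galerkin solutions\<close>

lemma L2_pointwise_le:
  assumes F: "F \<in> L2 D" and w: "w \<in> borel_measurable (lebesgue_on D)" and K: "0 \<le> K"
    and le: "\<And>x. x \<in> D \<Longrightarrow> norm (w x) \<le> K * norm (F x)"
  shows "w \<in> L2 D" "L2_norm D w \<le> K * L2_norm D F"
proof -
  have le2: "(norm (w x))\<^sup>2 \<le> K\<^sup>2 * (norm (F x))\<^sup>2" if "x \<in> D" for x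
    using power_mono[OF le[OF that], of 2] by (simp add: power_mult_distrib)
  show L: "w \<in> L2 D"
    by (rule L2I_bound[OF w _ le2]) (use L2D(2)[OF F] in auto)
  show "L2_norm D w \<le> K * L2_norm D F"
  proof (rule power2_le_imp_le)
    have "(L2_norm D w)\<^sup>2 \<le> (LINT x|lebesgue_on D. K\<^sup>2 * (norm (F x))\<^sup>2)"
      unfolding L2_norm_sq
      by (rule integral_mono) (use L2D(2)[OF L] L2D(2)[OF F] le2 in \<open>auto simp: space_restrict_space\<close>)
    then show "(L2_norm D w)\<^sup>2 \<le> (K * L2_norm D F)\<^sup>2" by (simp add: L2_norm_sq power_mult_distrib)
  qed (use K in simp)
qed

text \<open>
  The polynomial has no constant term, so it is nonnegative near \<open>0\<close> only if its linear term vanishes.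
\<close>

lemma quadratic_nonneg_imp_zero:
  fixes b c :: real
  assumes "\<And>s. 0 \<le> 2 * s * b + s\<^sup>2 * c" "0 \<le> c"
  shows "b = 0"
proof (rule ccontr)
  assume "b \<noteq> 0"
  then have "0 < b\<^sup>2 * (c + 2) / (c + 1)\<^sup>2" using assms(2) by (intro divide_pos_pos mult_pos_pos) auto
  moreover have "2 * (- b / (c + 1)) * b + (- b / (c + 1))\<^sup>2 * c = - (b\<^sup>2 * (c + 2) / (c + 1)\<^sup>2)"
    using assms(2) by (simp add: power2_eq_square divide_simps) algebra
  ultimately show False using assms(1)[of "- b / (c + 1)"] by linarith
qed

locale elliptic_coefficient = bounded_open +
  fixes a :: "'a \<Rightarrow> real" and lo hi :: real
  assumes a_meas: "a \<in> borel_measurable (lebesgue_on D)"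
    and lo_pos: "0 < lo" and a_ge: "\<And>x. x \<in> D \<Longrightarrow> lo \<le> a x" and a_le: "\<And>x. x \<in> D \<Longrightarrow> a x \<le> hi"
begin

lemma a_abs: "x \<in> D \<Longrightarrow> \<bar>a x\<bar> \<le> \<bar>hi\<bar>"
  using a_ge[of x] a_le[of x] lo_pos by simp

lemma weighted_L2: "F \<in> L2 D \<Longrightarrow> (\<lambda>x. a x *\<^sub>R F x) \<in> L2 D"
  by (rule L2_bounded_mult[OF _ a_meas a_abs])

lemma weighted_integrable:
  "F \<in> L2 D \<Longrightarrow> G \<in> L2 D \<Longrightarrow> integrable (lebesgue_on D) (\<lambda>x. a x * (F x \<bullet> G x))"
  using L2_inner_integrable[OF weighted_L2] by fastforce

lemma weighted_bound:
  assumes "F \<in> L2 D" "G \<in> L2 D"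
  shows "\<bar>LINT x|lebesgue_on D. a x * (F x \<bullet> G x)\<bar> \<le> \<bar>hi\<bar> * L2_norm D F * L2_norm D G"
proof -
  have "\<bar>LINT x|lebesgue_on D. a x * (F x \<bullet> G x)\<bar> \<le> L2_norm D (\<lambda>x. a x *\<^sub>R F x) * L2_norm D G"
    using L2_Cauchy_Schwarz[OF weighted_L2[OF assms(1)] assms(2)] by simp
  also have "\<dots> \<le> (\<bar>hi\<bar> * L2_norm D F) * L2_norm D G"
    by (intro mult_right_mono L2_norm_bounded_mult[OF assms(1) a_meas a_abs]) auto
  finally show ?thesis .
qed

lemma weighted_coercive:
  assumes "F \<in> L2 D"
  shows "lo * (L2_norm D F)\<^sup>2 \<le> (LINT x|lebesgue_on D. a x * (F x \<bullet> F x))"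
proof -
  have "lo * (L2_norm D F)\<^sup>2 = (LINT x|lebesgue_on D. lo * (F x \<bullet> F x))"
    by (simp add: L2_norm_sq power2_norm_eq_inner)
  also have "\<dots> \<le> (LINT x|lebesgue_on D. a x * (F x \<bullet> F x))"
    by (rule integral_mono)
       (use weighted_integrable[OF assms assms] L2_inner_integrable[OF assms assms] a_ge
         in \<open>auto simp: space_restrict_space intro!: mult_right_mono\<close>)
  finally show ?thesis .
qed

lemma weighted_diff:
  assumes "F \<in> L2 D" "G \<in> L2 D" "H \<in> L2 D" "K \<in> L2 D" "AE x in lebesgue_on D. K x = F x - G x"
  shows "(LINT x|lebesgue_on D. a x * (K x \<bullet> H x)) =
     (LINT x|lebesgue_on D. a x * (F x \<bullet> H x)) - (LINT x|lebesgue_on D. a x * (G x \<bullet> H x))"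
proof -
  have "(LINT x|lebesgue_on D. a x * (K x \<bullet> H x)) =
      (LINT x|lebesgue_on D. a x * (F x \<bullet> H x) - a x * (G x \<bullet> H x))"
    by (rule integral_cong_AE)
       (use assms(5) borel_measurable_integrable[OF weighted_integrable[OF assms(4,3)]]
         borel_measurable_integrable[OF weighted_integrable[OF assms(1,3)]]
         borel_measurable_integrable[OF weighted_integrable[OF assms(2,3)]]
        in \<open>auto elim!: eventually_mono simp: inner_diff_left right_diff_distrib intro!: borel_measurable_diff\<close>)
  then show ?thesis using weighted_integrable[OF assms(1,3)] weighted_integrable[OF assms(2,3)] by simp
qed

lemma weighted_cong:
  assumes "F \<in> L2 D" "G \<in> L2 D" "H \<in> L2 D" "AE x in lebesgue_on D. F x = G x"
  shows "(LINT x|lebesgue_on D. a x * (F x \<bullet> H x)) = (LINT x|lebesgue_on D. a x * (G x \<bullet> H x))"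
  by (rule integral_cong_AE)
     (use assms(4) borel_measurable_integrable[OF weighted_integrable[OF assms(1,3)]]
         borel_measurable_integrable[OF weighted_integrable[OF assms(2,3)]]
       in \<open>auto elim!: eventually_mono\<close>)

text \<open>
  Test with \<open>u\<close> itself: the left-hand side is at least \<open>lo\<close> times the square of the norm, and the load is
  estimated by the Poincare inequality.
\<close>

lemma galerkin_apriori:
  assumes S: "S \<subseteq> H10 D" and f: "f \<in> L2 D" and u: "galerkin_solution D S a f u"
  shows "lo * V_norm D u \<le> poincare * L2_norm D f"
proof -
  have uS: "u \<in> H10 D" using u S by (auto simp: galerkin_solution_def)
  have "lo * (V_norm D u)\<^sup>2 \<le> (LINT x|lebesgue_on D. f x * u x)"
    using weighted_coercive[OF H10_D(2)[OF uS]] u by (simp add: galerkin_solution_def V_norm_def)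
  also have "\<dots> \<le> L2_norm D f * L2_norm D u"
    using L2_Cauchy_Schwarz[OF f H10_D(1)[OF uS]] by simp
  also have "\<dots> \<le> L2_norm D f * (poincare * V_norm D u)"
    by (intro mult_left_mono Poincare uS) auto
  finally have "(lo * V_norm D u) * V_norm D u \<le> (poincare * L2_norm D f) * V_norm D u"
    by (simp add: power2_eq_square algebra_simps)
  then show ?thesis
    using Poincare(1) by (cases "V_norm D u = 0") (auto simp: mult_le_cancel_right less_le)
qed

text \<open>
  The difference of the solutions lies in \<open>S\<close> and satisfies the equation with the coefficient \<open>a\<close> and
  right-hand side \<open>\<integral> (a' - a) grad u' \<bullet> grad v\<close>; test with the difference.
\<close>

lemma galerkin_stability:
  assumes S: "S \<subseteq> H10 D" "\<And>v w. v \<in> S \<Longrightarrow> w \<in> S \<Longrightarrow> (\<lambda>x. v x - w x) \<in> S"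
    and u: "galerkin_solution D S a f u"
    and a': "elliptic_coefficient D a' lo' hi'" and u': "galerkin_solution D S a' f u'"
    and e: "0 \<le> e" "\<And>x. x \<in> D \<Longrightarrow> \<bar>a' x - a x\<bar> \<le> e"
  shows "lo * V_norm D (\<lambda>x. u x - u' x) \<le> e * V_norm D u'"
proof -
  interpret a': elliptic_coefficient D a' lo' hi' by (rule a')
  let ?w = "\<lambda>x. u x - u' x"
  have uS: "u \<in> S" "u' \<in> S" using u u' by (auto simp: galerkin_solution_def)
  then have H: "u \<in> H10 D" "u' \<in> H10 D" and wS: "?w \<in> S" using S by auto
  have wH: "?w \<in> H10 D" using wS S by auto
  note L = H10_D(2)[OF H(1)] H10_D(2)[OF H(2)] H10_D(2)[OF wH]
  have "lo * (V_norm D ?w)\<^sup>2 \<le> (LINT x|lebesgue_on D. a x * (weak_grad D ?w x \<bullet> weak_grad D ?w x))"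
    using weighted_coercive[OF L(3)] by (simp add: V_norm_def)
  also have "\<dots> = (LINT x|lebesgue_on D. a x * (weak_grad D u x \<bullet> weak_grad D ?w x)) -
      (LINT x|lebesgue_on D. a x * (weak_grad D u' x \<bullet> weak_grad D ?w x))"
    by (rule weighted_diff[OF L(1,2,3,3) H10_diff(2)[OF H]])
  also have "\<dots> = (LINT x|lebesgue_on D. a' x * (weak_grad D u' x \<bullet> weak_grad D ?w x)) -
      (LINT x|lebesgue_on D. a x * (weak_grad D u' x \<bullet> weak_grad D ?w x))"
    using u u' wS by (simp add: galerkin_solution_def)
  also have "\<dots> = (LINT x|lebesgue_on D. ((a' x - a x) *\<^sub>R weak_grad D u' x) \<bullet> weak_grad D ?w x)"
    using weighted_integrable[OF L(2,3)] a'.weighted_integrable[OF L(2,3)] by (simp add: left_diff_distrib)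
  also have "\<dots> \<le> L2_norm D (\<lambda>x. (a' x - a x) *\<^sub>R weak_grad D u' x) * V_norm D ?w"
    using L2_Cauchy_Schwarz[OF L2_bounded_mult[OF L(2) borel_measurable_diff[OF a'.a_meas a_meas] e(2)] L(3)]
    by (simp add: V_norm_def)
  also have "\<dots> \<le> (e * V_norm D u') * V_norm D ?w"
    using L2_norm_bounded_mult[OF L(2) borel_measurable_diff[OF a'.a_meas a_meas] e(2,1)]
    by (intro mult_right_mono) (auto simp: V_norm_def)
  finally have "(lo * V_norm D ?w) * V_norm D ?w \<le> (e * V_norm D u') * V_norm D ?w"
    by (simp add: power2_eq_square algebra_simps)
  then show ?thesis
    using e(1) by (cases "V_norm D ?w = 0") (auto simp: mult_le_cancel_right less_le)
qed

text \<open>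
  Galerkin orthogonality: the error is orthogonal to \<open>us - v\<close> with respect to the energy inner product,
  so one of its two copies in the energy may be replaced by \<open>u - v\<close>.
\<close>

lemma Cea:
  assumes S: "S \<subseteq> H10 D" "\<And>v w. v \<in> S \<Longrightarrow> w \<in> S \<Longrightarrow> (\<lambda>x. v x - w x) \<in> S"
    and u: "galerkin_solution D (H10 D) a f u" and us: "galerkin_solution D S a f us" and v: "v \<in> S"
  shows "lo * V_norm D (\<lambda>x. u x - us x) \<le> \<bar>hi\<bar> * V_norm D (\<lambda>x. u x - v x)"
proof -
  let ?e = "\<lambda>x. u x - us x" and ?w = "\<lambda>x. us x - v x" and ?d = "\<lambda>x. u x - v x"
  have H: "u \<in> H10 D" "us \<in> H10 D" "v \<in> H10 D" and wS: "?w \<in> S"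
    using u us v S by (auto simp: galerkin_solution_def)
  have wH: "?w \<in> H10 D" using wS S by auto
  have eH: "?e \<in> H10 D" and dH: "?d \<in> H10 D" using H10_diff(1) H by auto
  note L = H10_D(2)[OF H(1)] H10_D(2)[OF H(2)] H10_D(2)[OF eH] H10_D(2)[OF wH] H10_D(2)[OF dH]
  have "(LINT x|lebesgue_on D. a x * (weak_grad D ?e x \<bullet> weak_grad D ?w x)) = 0"
    using weighted_diff[OF L(1,2,4,3) H10_diff(2)[OF H(1,2)]] u us wS wH
    by (simp add: galerkin_solution_def)
  moreover have "(\<lambda>x. a x * (weak_grad D ?e x \<bullet> weak_grad D ?w x)) = (\<lambda>x. a x * (weak_grad D ?w x \<bullet> weak_grad D ?e x))"
    by (simp add: inner_commute)
  ultimately have orth: "(LINT x|lebesgue_on D. a x * (weak_grad D ?w x \<bullet> weak_grad D ?e x)) = 0" by simp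
  have "AE x in lebesgue_on D. weak_grad D ?e x = weak_grad D ?d x - weak_grad D ?w x"
    using H10_diff(2)[OF H(1,2)] H10_diff(2)[OF H(1,3)] H10_diff(2)[OF H(2,3)]
    by eventually_elim simp
  from weighted_diff[OF L(5,4,3,3) this] orth
  have "lo * (V_norm D ?e)\<^sup>2 \<le> (LINT x|lebesgue_on D. a x * (weak_grad D ?d x \<bullet> weak_grad D ?e x))"
    using weighted_coercive[OF L(3)] by (simp add: V_norm_def)
  also have "\<dots> \<le> \<bar>hi\<bar> * V_norm D ?d * V_norm D ?e"
    using weighted_bound[OF L(5,3)] by (simp add: V_norm_def)
  finally have "(lo * V_norm D ?e) * V_norm D ?e \<le> (\<bar>hi\<bar> * V_norm D ?d) * V_norm D ?e"
    by (simp add: power2_eq_square algebra_simps)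
  then show ?thesis
    by (cases "V_norm D ?e = 0") (auto simp: mult_le_cancel_right less_le)
qed

text \<open>
  Twice the usual Dirichlet energy. It is only ever evaluated at test functions, whose gradients are
  classical.
\<close>

definition energy :: "('a \<Rightarrow> real) \<Rightarrow> ('a \<Rightarrow> real) \<Rightarrow> real" where
  "energy f \<phi> = (LINT x|lebesgue_on D. a x * (grad \<phi> x \<bullet> grad \<phi> x)) - 2 * (LINT x|lebesgue_on D. f x * \<phi> x)"

lemma energy_expand:
  assumes f: "f \<in> L2 D" and \<phi>: "\<phi> \<in> test_functions D" and \<eta>: "\<eta> \<in> test_functions D"
  shows "energy f (\<lambda>x. \<phi> x + s * \<eta> x) = energy f \<phi> +
     2 * s * ((LINT x|lebesgue_on D. a x * (grad \<phi> x \<bullet> grad \<eta> x)) - (LINT x|lebesgue_on D. f x * \<eta> x)) +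
     s\<^sup>2 * (LINT x|lebesgue_on D. a x * (grad \<eta> x \<bullet> grad \<eta> x))"
proof -
  note g = grad_test_L2[OF \<phi>] grad_test_L2[OF \<eta>]
  note i = weighted_integrable[OF g(1,1)] weighted_integrable[OF g(1,2)] weighted_integrable[OF g(2,2)]
    L2_mult_integrable[OF f test_L2[OF \<phi>]] L2_mult_integrable[OF f test_L2[OF \<eta>]]
  have gr: "grad (\<lambda>x. \<phi> x + s * \<eta> x) x = grad \<phi> x + s *\<^sub>R grad \<eta> x" for x
    by (simp add: grad_add_test[OF \<phi> test_functions_cmult[OF \<eta>]] grad_cmult_test[OF \<eta>])
  have 1: "(\<lambda>x. a x * (grad (\<lambda>x. \<phi> x + s * \<eta> x) x \<bullet> grad (\<lambda>x. \<phi> x + s * \<eta> x) x)) =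
      (\<lambda>x. a x * (grad \<phi> x \<bullet> grad \<phi> x) + 2 * s * (a x * (grad \<phi> x \<bullet> grad \<eta> x)) + s\<^sup>2 * (a x * (grad \<eta> x \<bullet> grad \<eta> x)))"
    by (simp add: gr fun_eq_iff inner_add_left inner_add_right inner_commute power2_eq_square algebra_simps)
  have 2: "(\<lambda>x. f x * (\<phi> x + s * \<eta> x)) = (\<lambda>x. f x * \<phi> x + s * (f x * \<eta> x))"
    by (simp add: fun_eq_iff algebra_simps)
  have A: "(LINT x|lebesgue_on D. a x * (grad \<phi> x \<bullet> grad \<phi> x) + 2 * s * (a x * (grad \<phi> x \<bullet> grad \<eta> x)) + s\<^sup>2 * (a x * (grad \<eta> x \<bullet> grad \<eta> x))) =
      (LINT x|lebesgue_on D. a x * (grad \<phi> x \<bullet> grad \<phi> x)) + 2 * s * (LINT x|lebesgue_on D. a x * (grad \<phi> x \<bullet> grad \<eta> x))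
      + s\<^sup>2 * (LINT x|lebesgue_on D. a x * (grad \<eta> x \<bullet> grad \<eta> x))"
    using i by simp
  have B: "(LINT x|lebesgue_on D. f x * \<phi> x + s * (f x * \<eta> x)) =
      (LINT x|lebesgue_on D. f x * \<phi> x) + s * (LINT x|lebesgue_on D. f x * \<eta> x)"
    using i by simp
  show ?thesis unfolding energy_def 1 2 A B by (simp add: right_diff_distrib)
qed

lemma energy_bounded_below:
  assumes f: "f \<in> L2 D" and \<phi>: "\<phi> \<in> test_functions D"
  shows "- (poincare * L2_norm D f)\<^sup>2 / lo \<le> energy f \<phi>"
proof -
  let ?g = "L2_norm D (grad \<phi>)" and ?c = "poincare * L2_norm D f"
  have V: "V_norm D \<phi> = ?g"
    unfolding V_norm_def by (intro L2_norm_cong_AE H10_D test_H10 grad_test_L2 \<phi>)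
  have "(LINT x|lebesgue_on D. f x * \<phi> x) \<le> L2_norm D f * L2_norm D \<phi>"
    using L2_Cauchy_Schwarz[OF f test_L2[OF \<phi>]] by simp
  also have "\<dots> \<le> L2_norm D f * (poincare * ?g)"
    using Poincare(2)[OF test_H10(1)[OF \<phi>]] V by (intro mult_left_mono) auto
  finally have "energy f \<phi> \<ge> lo * ?g\<^sup>2 - 2 * ?c * ?g"
    using weighted_coercive[OF grad_test_L2[OF \<phi>]] unfolding energy_def by (simp add: algebra_simps)
  moreover have "0 \<le> (lo * ?g - ?c)\<^sup>2 / lo" using lo_pos by simp
  moreover have "(lo * ?g - ?c)\<^sup>2 / lo = lo * ?g\<^sup>2 - 2 * ?c * ?g + ?c\<^sup>2 / lo"
    using lo_pos by (simp add: power2_eq_square field_simps)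
  ultimately show ?thesis by simp
qed

text \<open>
  The direct approach of the calculus of variations, with a minimising sequence of test functions. By the
  parallelogram identity the gradients of such a sequence form a Cauchy sequence, and by the Poincare
  inequality so do the functions. The first variation at the limit vanishes on test functions, hence by
  density on \<open>H\<^sup>1\<^sub>0(D)\<close>.
\<close>

lemma galerkin_exists:
  assumes f: "f \<in> L2 D"
  shows "\<exists>u. galerkin_solution D (H10 D) a f u"
proof -
  define J where "J = energy f"
  define I where "I = (INF \<phi>\<in>test_functions D. J \<phi>)"
  have bdd: "bdd_below (J ` test_functions D)"
    using energy_bounded_below[OF f] unfolding J_def by (auto intro!: bdd_belowI)
  have I_le: "I \<le> J \<phi>" if "\<phi> \<in> test_functions D" for \<phi>
    unfolding I_def by (rule cINF_lower[OF bdd that])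
  define r where "r n = 1 / real (Suc n)" for n
  have "\<exists>\<phi>\<in>test_functions D. J \<phi> < I + r n" for n
  proof -
    have "I < I + r n" by (simp add: r_def)
    then show ?thesis unfolding I_def
      using cINF_less_iff[OF _ bdd] test_functions_zero by (metis empty_iff)
  qed
  then obtain \<phi> where \<phi>: "\<And>n. \<phi> n \<in> test_functions D" and J\<phi>: "\<And>n. J (\<phi> n) < I + r n"
    by metis
  define Q where "Q F G = (LINT x|lebesgue_on D. a x * (F x \<bullet> G x))" for F G :: "'a \<Rightarrow> 'a"
  have d: "(\<lambda>x. \<phi> m x - \<phi> n x) \<in> test_functions D" for m n
    using test_functions_add[OF \<phi>[of m] test_functions_cmult[OF \<phi>[of n], of "-1"]] by simp
  have gd: "grad (\<lambda>x. \<phi> m x - \<phi> n x) x = grad (\<phi> m) x - grad (\<phi> n) x" for m n x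
    using grad_add_test[OF \<phi>[of m] test_functions_cmult[OF \<phi>[of n], of "-1"], of x]
      grad_cmult_test[OF \<phi>[of n], of "-1" x] by simp
  have par: "lo * (L2_norm D (\<lambda>x. grad (\<phi> m) x - grad (\<phi> n) x))\<^sup>2 \<le> 2 * (r m + r n)" for m n
  proof -
    let ?d = "\<lambda>x. \<phi> m x - \<phi> n x"
    have E: "J (\<lambda>x. \<phi> n x + s * ?d x) = J (\<phi> n) + 2 * s * (Q (grad (\<phi> n)) (grad ?d) - (LINT x|lebesgue_on D. f x * ?d x))
        + s\<^sup>2 * Q (grad ?d) (grad ?d)" for s
      unfolding J_def Q_def by (rule energy_expand[OF f \<phi> d])
    (* Parallelogram identity: the expansion at s = 1/2 and at s = 1 eliminates the linear term. *)
    have "I \<le> J (\<lambda>x. \<phi> n x + (1/2) * ?d x)"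
      by (intro I_le test_functions_add \<phi> test_functions_cmult d)
    moreover have "J (\<phi> m) = J (\<lambda>x. \<phi> n x + 1 * ?d x)" by simp
    ultimately have "Q (grad ?d) (grad ?d) \<le> 2 * (J (\<phi> m) + J (\<phi> n) - 2 * I)"
      unfolding E by (simp add: power2_eq_square field_simps)
    also have "\<dots> \<le> 2 * (r m + r n)" using add_strict_mono[OF J\<phi>[of m] J\<phi>[of n]] by (simp add: algebra_simps)
    finally show ?thesis
      using weighted_coercive[OF grad_test_L2[OF d[of m n]]] by (simp add: gd[abs_def] Q_def)
  qed
  have CauchyG: "\<exists>N. \<forall>m\<ge>N. \<forall>n\<ge>N. L2_norm D (\<lambda>x. grad (\<phi> m) x - grad (\<phi> n) x) < e" if e: "e > 0" for e
  proof -
    obtain N where N: "4 / (lo * e\<^sup>2) < real (Suc N)"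
      using reals_Archimedean2 by (metis less_Suc_eq of_nat_less_iff order.strict_trans)
    have pos: "0 < lo * e\<^sup>2" using lo_pos e by simp
    have "L2_norm D (\<lambda>x. grad (\<phi> m) x - grad (\<phi> n) x) < e" if mn: "m \<ge> N" "n \<ge> N" for m n
    proof (rule power2_less_imp_less)
      have "r m \<le> r N" "r n \<le> r N"
        using mn unfolding r_def by (auto intro!: divide_left_mono)
      then have "lo * (L2_norm D (\<lambda>x. grad (\<phi> m) x - grad (\<phi> n) x))\<^sup>2 \<le> 4 * r N"
        by (intro order_trans[OF par]) simp
      also have "\<dots> < lo * e\<^sup>2" using N pos by (simp add: r_def field_simps)
      finally show "(L2_norm D (\<lambda>x. grad (\<phi> m) x - grad (\<phi> n) x))\<^sup>2 < e\<^sup>2" using lo_pos by simp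
    qed (use e in simp)
    then show ?thesis by blast
  qed
  have Cauchy: "\<exists>N. \<forall>m\<ge>N. \<forall>n\<ge>N. L2_norm D (\<lambda>x. \<phi> m x - \<phi> n x) < e" if "e > 0" for e
  proof -
    have P: "L2_norm D (\<lambda>x. \<phi> m x - \<phi> n x) \<le> poincare * L2_norm D (\<lambda>x. grad (\<phi> m) x - grad (\<phi> n) x)" for m n
    proof -
      have "V_norm D (\<lambda>x. \<phi> m x - \<phi> n x) = L2_norm D (grad (\<lambda>x. \<phi> m x - \<phi> n x))"
        unfolding V_norm_def by (intro L2_norm_cong_AE H10_D test_H10 grad_test_L2 d)
      then show ?thesis using Poincare(2)[OF test_H10(1)[OF d[of m n]]] by (simp add: gd[abs_def])
    qed
    have "0 < e / poincare" using that Poincare(1) by simp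
    from CauchyG[OF this] obtain N where
      "\<And>m n. m \<ge> N \<Longrightarrow> n \<ge> N \<Longrightarrow> L2_norm D (\<lambda>x. grad (\<phi> m) x - grad (\<phi> n) x) < e / poincare" by blast
    then have "poincare * L2_norm D (\<lambda>x. grad (\<phi> m) x - grad (\<phi> n) x) < e" if "m \<ge> N" "n \<ge> N" for m n
      using that Poincare(1) by (simp add: pos_less_divide_eq mult.commute)
    then show ?thesis using P by (meson le_less_trans)
  qed
  obtain u where u: "u \<in> L2 D" "(\<lambda>n. L2_norm D (\<lambda>x. u x - \<phi> n x)) \<longlonglongrightarrow> 0"
    using L2_complete[OF finite_D lebesgue_D test_L2[OF \<phi>] Cauchy] by blast
  obtain G where G: "G \<in> L2 D" "(\<lambda>n. L2_norm D (\<lambda>x. G x - grad (\<phi> n) x)) \<longlonglongrightarrow> 0"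
    using L2_complete[OF finite_D lebesgue_D grad_test_L2[OF \<phi>] CauchyG] by blast
  note uH = H10_limit[OF u(1) G(1) \<phi> u(2) G(2)]
  have limJ: "(\<lambda>n. J (\<phi> n)) \<longlonglongrightarrow> I"
  proof (rule tendsto_sandwich)
    show "\<forall>\<^sub>F n in sequentially. I \<le> J (\<phi> n)" using I_le[OF \<phi>] by simp
    show "\<forall>\<^sub>F n in sequentially. J (\<phi> n) \<le> I + inverse (real (Suc n))"
      using J\<phi> by (auto simp: r_def inverse_eq_divide intro!: always_eventually less_imp_le)
    show "(\<lambda>n. I + inverse (real (Suc n))) \<longlonglongrightarrow> I"
      using tendsto_add[OF tendsto_const LIMSEQ_inverse_real_of_nat, of I] by simp
  qed auto
  have test: "Q G (grad \<eta>) = (LINT x|lebesgue_on D. f x * \<eta> x)" if \<eta>: "\<eta> \<in> test_functions D" for \<eta>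
  proof -
    have limQ: "(\<lambda>n. Q (grad (\<phi> n)) (grad \<eta>)) \<longlonglongrightarrow> Q G (grad \<eta>)"
      using L2_tendsto_inner[OF G(1) grad_test_L2[OF \<phi>] weighted_L2[OF grad_test_L2[OF \<eta>]] G(2)]
      by (simp add: Q_def)
    have "0 \<le> 2 * s * (Q G (grad \<eta>) - (LINT x|lebesgue_on D. f x * \<eta> x)) + s\<^sup>2 * Q (grad \<eta>) (grad \<eta>)" for s
    proof -
      have "I \<le> J (\<phi> n) + 2 * s * (Q (grad (\<phi> n)) (grad \<eta>) - (LINT x|lebesgue_on D. f x * \<eta> x)) + s\<^sup>2 * Q (grad \<eta>) (grad \<eta>)" for n
        using I_le[OF test_functions_add[OF \<phi>[of n] test_functions_cmult[OF \<eta>, of s]]] energy_expand[OF f \<phi> \<eta>, of n s]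
        by (simp add: J_def Q_def)
      moreover have "(\<lambda>n. J (\<phi> n) + 2 * s * (Q (grad (\<phi> n)) (grad \<eta>) - (LINT x|lebesgue_on D. f x * \<eta> x)) + s\<^sup>2 * Q (grad \<eta>) (grad \<eta>))
         \<longlonglongrightarrow> I + 2 * s * (Q G (grad \<eta>) - (LINT x|lebesgue_on D. f x * \<eta> x)) + s\<^sup>2 * Q (grad \<eta>) (grad \<eta>)"
        by (intro tendsto_intros limJ limQ)
      ultimately have "I \<le> I + 2 * s * (Q G (grad \<eta>) - (LINT x|lebesgue_on D. f x * \<eta> x)) + s\<^sup>2 * Q (grad \<eta>) (grad \<eta>)"
        by (intro LIMSEQ_le_const) auto
      then show ?thesis by simp
    qed
    moreover have "0 \<le> Q (grad \<eta>) (grad \<eta>)"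
      using weighted_coercive[OF grad_test_L2[OF \<eta>]] lo_pos
      by (auto simp: Q_def intro: order_trans[rotated])
    ultimately have "Q G (grad \<eta>) - (LINT x|lebesgue_on D. f x * \<eta> x) = 0" by (rule quadratic_nonneg_imp_zero)
    then show ?thesis by simp
  qed
  have "(LINT x|lebesgue_on D. a x * (weak_grad D u x \<bullet> weak_grad D w x)) = (LINT x|lebesgue_on D. f x * w x)"
    if w: "w \<in> H10 D" for w
  proof -
    obtain \<eta> where \<eta>: "\<And>n. \<eta> n \<in> test_functions D" "(\<lambda>n. L2_norm D (\<lambda>x. w x - \<eta> n x)) \<longlonglongrightarrow> 0"
      "(\<lambda>n. L2_norm D (\<lambda>x. weak_grad D w x - grad (\<eta> n) x)) \<longlonglongrightarrow> 0" by (rule H10_approx[OF w]) blast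
    have "(\<lambda>n. LINT x|lebesgue_on D. grad (\<eta> n) x \<bullet> (a x *\<^sub>R G x)) \<longlonglongrightarrow> (LINT x|lebesgue_on D. weak_grad D w x \<bullet> (a x *\<^sub>R G x))"
      by (rule L2_tendsto_inner[OF H10_D(2)[OF w] grad_test_L2[OF \<eta>(1)] weighted_L2[OF G(1)] \<eta>(3)])
    then have l1: "(\<lambda>n. Q G (grad (\<eta> n))) \<longlonglongrightarrow> Q G (weak_grad D w)" by (simp add: Q_def inner_commute)
    have "(\<lambda>n. LINT x|lebesgue_on D. \<eta> n x \<bullet> f x) \<longlonglongrightarrow> (LINT x|lebesgue_on D. w x \<bullet> f x)"
      by (rule L2_tendsto_inner[OF H10_D(1)[OF w] test_L2[OF \<eta>(1)] f \<eta>(2)])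
    then have l2: "(\<lambda>n. Q G (grad (\<eta> n))) \<longlonglongrightarrow> (LINT x|lebesgue_on D. f x * w x)"
      by (simp add: test[OF \<eta>(1)] mult.commute)
    have "(LINT x|lebesgue_on D. a x * (weak_grad D u x \<bullet> weak_grad D w x)) = Q G (weak_grad D w)"
      unfolding Q_def by (rule weighted_cong[OF H10_D(2)[OF uH(1)] G(1) H10_D(2)[OF w] uH(2)])
    then show ?thesis using LIMSEQ_unique[OF l1 l2] by simp
  qed
  then show ?thesis using uH(1) by (auto simp: galerkin_solution_def)
qed

end

context bounded_open begin

lemma weak_laplacian_norm:
  assumes "u \<in> H10 D" "is_weak_laplacian D u g"
  shows "u \<in> W_space D" "W_norm D u = L2_norm D g"
proof -
  show "u \<in> W_space D" using assms by (auto simp: W_space_def)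
  have l: "is_weak_laplacian D u (weak_laplacian D u)"
    unfolding weak_laplacian_def using assms(2) by (rule someI[of "is_weak_laplacian D u"])
  have L: "g \<in> L2 D" "weak_laplacian D u \<in> L2 D" using assms(2) l by (auto simp: is_weak_laplacian_def)
  have "AE x in lebesgue_on D. weak_laplacian D u x - g x = 0"
  proof (rule fundamental_lemma)
    have one: "(\<lambda>x. 1::real) \<in> L2 D"
      using finite_measure_D by (auto simp: L2_def intro: finite_measure.integrable_const)
    show "integrable (lebesgue_on D) (\<lambda>x. weak_laplacian D u x - g x)"
      using L2_mult_integrable[OF L2_diff[OF L(2,1)] one] by simp
    fix \<phi> assume \<phi>: "\<phi> \<in> test_functions D"
    have "(LINT x|lebesgue_on D. weak_laplacian D u x * \<phi> x) = (LINT x|lebesgue_on D. g x * \<phi> x)"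
      using assms(2) l \<phi> by (simp add: is_weak_laplacian_def)
    then show "(LINT x|lebesgue_on D. \<phi> x * (weak_laplacian D u x - g x)) = 0"
      using L2_mult_integrable[OF L(1) test_L2[OF \<phi>]] L2_mult_integrable[OF L(2) test_L2[OF \<phi>]]
      by (simp add: right_diff_distrib mult.commute)
  qed
  then show "W_norm D u = L2_norm D g"
    unfolding W_norm_def by (intro L2_norm_cong_AE L) (auto elim: eventually_mono)
qed

text \<open>
  For a test function \<open>\<phi>\<close>, the function \<open>\<phi> exp (- \<beta>)\<close> is again a test function because \<open>\<beta>\<close> is smooth.
  Inserting it into the weak formulation cancels the coefficient and gives
  \<open>- \<Delta> u = exp (- \<beta>) f + grad \<beta> \<bullet> grad u\<close>, whose right-hand side is square integrable.
\<close>

lemma smooth_coefficient_regularity: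
  assumes \<beta>: "\<And>k. Ck k \<beta>" "\<And>x. x \<in> D \<Longrightarrow> \<bar>\<beta> x\<bar> \<le> B" "\<And>x. x \<in> D \<Longrightarrow> norm (grad \<beta> x) \<le> K" "0 \<le> K"
    and f: "f \<in> L2 D" and u: "galerkin_solution D (H10 D) (\<lambda>x. exp (\<beta> x)) f u"
  shows "u \<in> W_space D" "W_norm D u \<le> exp B * L2_norm D f + K * V_norm D u"
proof -
  have uH: "u \<in> H10 D" using u by (simp add: galerkin_solution_def)
  note gL = H10_D(2)[OF uH]
  have cont: "continuous_on UNIV \<beta>" "continuous_on UNIV (grad \<beta>)"
    using Ck_continuous[OF \<beta>(1)[of 0]] Ck_grad_continuous[OF \<beta>(1)[of "Suc 0"]] by auto
  have m: "\<beta> \<in> borel_measurable (lebesgue_on D)" "grad \<beta> \<in> borel_measurable (lebesgue_on D)"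
    using cont by (auto intro!: measurable_restrict_space1 measurable_completion borel_measurable_continuous_onI)
  define p where "p x = exp (- \<beta> x) * f x" for x
  define q where "q x = grad \<beta> x \<bullet> weak_grad D u x" for x
  have p: "p \<in> L2 D" "L2_norm D p \<le> exp B * L2_norm D f"
  proof -
    note [measurable] = m L2D(1)[OF f]
    have "p \<in> borel_measurable (lebesgue_on D)" unfolding p_def by measurable
    moreover have "norm (p x) \<le> exp B * norm (f x)" if "x \<in> D" for x
      using \<beta>(2)[OF that] by (auto simp: p_def abs_mult intro!: mult_right_mono)
    ultimately show "p \<in> L2 D" "L2_norm D p \<le> exp B * L2_norm D f"
      using L2_pointwise_le[OF f, of p "exp B"] by auto
  qed
  have q: "q \<in> L2 D" "L2_norm D q \<le> K * V_norm D u"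
  proof -
    have "q \<in> borel_measurable (lebesgue_on D)" unfolding q_def
      by (intro borel_measurable_inner m L2D(1)[OF gL])
    moreover have "norm (q x) \<le> K * norm (weak_grad D u x)" if "x \<in> D" for x
      using order_trans[OF Cauchy_Schwarz_ineq2[of "grad \<beta> x" "weak_grad D u x"]
          mult_right_mono[OF \<beta>(3)[OF that] norm_ge_zero]] by (simp add: q_def)
    ultimately show "q \<in> L2 D" "L2_norm D q \<le> K * V_norm D u"
      using L2_pointwise_le[OF gL, of q K] \<beta>(4) by (auto simp: V_norm_def)
  qed
  have pq: "(\<lambda>x. - (p x + q x)) \<in> L2 D"
    using L2_scaleR[OF L2_add[OF p(1) q(1)], of "-1"] by simp
  have lap: "is_weak_laplacian D u (\<lambda>x. - (p x + q x))"
    unfolding is_weak_laplacian_def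
  proof (intro conjI pq ballI)
    fix \<phi> assume \<phi>: "\<phi> \<in> test_functions D"
    have Ce: "Ck k (\<lambda>x. exp (- \<beta> x))" for k
      using Ck_exp[OF Ck_cmult[OF \<beta>(1), of k "-1"]] by simp
    let ?\<eta> = "\<lambda>x. \<phi> x * exp (- \<beta> x)"
    have \<eta>: "?\<eta> \<in> test_functions D" by (rule test_functions_mult[OF \<phi> Ce])
    have de: "((\<lambda>x. exp (- \<beta> x)) has_derivative (\<lambda>h. (- exp (- \<beta> x) *\<^sub>R grad \<beta> x) \<bullet> h)) (at x)" for x
    proof -
      have "(\<beta> has_derivative (\<lambda>h. grad \<beta> x \<bullet> h)) (at x)" by (rule Ck_SucD_derivative[OF \<beta>(1)])
      from has_derivative_exp[OF has_derivative_minus[OF this]] show ?thesis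
        by (rule has_derivative_eq_rhs) (simp add: fun_eq_iff)
    qed
    have g\<eta>: "grad ?\<eta> x = exp (- \<beta> x) *\<^sub>R (grad \<phi> x - \<phi> x *\<^sub>R grad \<beta> x)" for x
      using grad_eqI[OF has_derivative_mult_grad[OF grad_test(1)[OF \<phi>] de]] by (simp add: algebra_simps)
    note i = L2_inner_integrable[OF gL grad_test_L2[OF \<phi>]] L2_mult_integrable[OF q(1) test_L2[OF \<phi>]]
      L2_mult_integrable[OF p(1) test_L2[OF \<phi>]]
    have "(LINT x|lebesgue_on D. p x * \<phi> x) = (LINT x|lebesgue_on D. f x * ?\<eta> x)"
      by (simp add: p_def algebra_simps)
    also have "\<dots> = (LINT x|lebesgue_on D. exp (\<beta> x) * (weak_grad D u x \<bullet> weak_grad D ?\<eta> x))"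
      using u test_H10(1)[OF \<eta>] by (simp add: galerkin_solution_def)
    also have "\<dots> = (LINT x|lebesgue_on D. weak_grad D u x \<bullet> grad \<phi> x - q x * \<phi> x)"
    proof (rule integral_cong_AE)
      show "AE x in lebesgue_on D. exp (\<beta> x) * (weak_grad D u x \<bullet> weak_grad D ?\<eta> x) =
          weak_grad D u x \<bullet> grad \<phi> x - q x * \<phi> x"
        using test_H10(2)[OF \<eta>]
      proof eventually_elim
        case (elim x)
        have "exp (\<beta> x) * (weak_grad D u x \<bullet> weak_grad D ?\<eta> x) =
            (exp (\<beta> x) * exp (- \<beta> x)) * (weak_grad D u x \<bullet> (grad \<phi> x - \<phi> x *\<^sub>R grad \<beta> x))"
          by (simp add: elim g\<eta>)
        also have "exp (\<beta> x) * exp (- \<beta> x) = 1" by (simp add: exp_minus)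
        finally show ?case by (simp add: q_def inner_diff_right inner_commute mult.commute)
      qed
      show "(\<lambda>x. exp (\<beta> x) * (weak_grad D u x \<bullet> weak_grad D ?\<eta> x)) \<in> borel_measurable (lebesgue_on D)"
      proof -
        note [measurable] = m L2D(1)[OF gL] L2D(1)[OF H10_D(2)[OF test_H10(1)[OF \<eta>]]]
        show ?thesis by measurable
      qed
      show "(\<lambda>x. weak_grad D u x \<bullet> grad \<phi> x - q x * \<phi> x) \<in> borel_measurable (lebesgue_on D)"
        using i by (intro borel_measurable_diff) auto
    qed
    also have "\<dots> = (LINT x|lebesgue_on D. weak_grad D u x \<bullet> grad \<phi> x) - (LINT x|lebesgue_on D. q x * \<phi> x)"
      using i by simp
    finally show "(LINT x|lebesgue_on D. weak_grad D u x \<bullet> grad \<phi> x) = - (LINT x|lebesgue_on D. - (p x + q x) * \<phi> x)"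
      using i by (simp add: distrib_right left_diff_distrib)
  qed
  show "u \<in> W_space D" by (rule weak_laplacian_norm(1)[OF uH lap])
  have "W_norm D u = L2_norm D (\<lambda>x. - (p x + q x))" by (rule weak_laplacian_norm(2)[OF uH lap])
  also have "\<dots> = L2_norm D (\<lambda>x. p x + q x)" unfolding L2_norm_def norm_minus_cancel ..
  also have "\<dots> \<le> L2_norm D p + L2_norm D q" by (rule L2_norm_triangle[OF p(1) q(1)])
  finally show "W_norm D u \<le> exp B * L2_norm D f + K * V_norm D u" using p(2) q(2) by linarith
qed

end

section \<open>Mollification of Hoelder continuous functions\<close>

text \<open>
  Write \<open>(s + t) powr \<alpha>\<close> as \<open>(s + t) (s + t) powr (\<alpha> - 1)\<close> and use that the second factor decreases in its
  base.
\<close>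

lemma powr_subadditive:
  fixes s t \<alpha> :: real
  assumes "0 \<le> s" "0 \<le> t" "0 < \<alpha>" "\<alpha> \<le> 1"
  shows "(s + t) powr \<alpha> \<le> s powr \<alpha> + t powr \<alpha>"
proof (cases "s = 0 \<or> t = 0")
  case False
  then have pos: "0 < s" "0 < t" using assms by auto
  have "(s + t) powr \<alpha> = (s + t) * (s + t) powr (\<alpha> - 1)"
    using pos by (simp add: powr_mult_base)
  also have "\<dots> = s * (s + t) powr (\<alpha> - 1) + t * (s + t) powr (\<alpha> - 1)" by (simp add: distrib_right)
  also have "\<dots> \<le> s * s powr (\<alpha> - 1) + t * t powr (\<alpha> - 1)"
    using pos assms by (intro add_mono mult_left_mono powr_mono2') auto
  also have "\<dots> = s powr \<alpha> + t powr \<alpha>" using pos by (simp add: powr_mult_base)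
  finally show ?thesis .
qed auto

lemma norm_powr_triangle:
  fixes x y z :: "'a::real_normed_vector"
  assumes "0 < \<alpha>" "\<alpha> \<le> 1"
  shows "norm (x - z) powr \<alpha> \<le> norm (x - y) powr \<alpha> + norm (y - z) powr \<alpha>"
proof -
  have "norm (x - z) powr \<alpha> \<le> (norm (x - y) + norm (y - z)) powr \<alpha>"
    using norm_triangle_ineq[of "x - y" "y - z"] assms by (intro powr_mono2) auto
  also have "\<dots> \<le> norm (x - y) powr \<alpha> + norm (y - z) powr \<alpha>"
    using assms by (intro powr_subadditive) auto
  finally show ?thesis .
qed

lemma holder_continuous_on:
  fixes g :: "'a::real_normed_vector \<Rightarrow> real"
  assumes "0 < \<alpha>" and le: "\<And>x y. x \<in> S \<Longrightarrow> y \<in> S \<Longrightarrow> \<bar>g x - g y\<bar> \<le> L * norm (x - y) powr \<alpha>"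
  shows "continuous_on S g"
  unfolding continuous_on_def
proof
  fix x assume x: "x \<in> S"
  have "((\<lambda>y. L * norm (y - x) powr \<alpha>) \<longlongrightarrow> L * norm (x - x) powr \<alpha>) (at x within S)"
    using assms(1) by (intro tendsto_intros tendsto_powr2) auto
  then have "((\<lambda>y. L * norm (y - x) powr \<alpha>) \<longlongrightarrow> 0) (at x within S)" by simp
  then show "(g \<longlongrightarrow> g x) (at x within S)"
  proof (rule Lim_transform_bound[where g = "\<lambda>y. L * norm (y - x) powr \<alpha>", THEN LIM_zero_cancel, rotated])
    show "\<forall>\<^sub>F y in at x within S. norm (g y - g x) \<le> norm (L * norm (y - x) powr \<alpha>)"
      using le[OF _ x] by (auto simp: eventually_at_filter intro!: always_eventually intro: order_trans[OF _ abs_ge_self])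
  qed
qed

text \<open>
  McShane's extension, the infimum of the Hoelder cones with vertices on the graph of \<open>g\<close>. That
  \<open>norm (x - y) powr \<alpha>\<close> is again a metric makes the infimum finite and Hoelder continuous with the same
  constant.
\<close>

lemma holder_extension:
  fixes g :: "'a::real_normed_vector \<Rightarrow> real"
  assumes a: "0 < \<alpha>" "\<alpha> \<le> 1" and L: "0 \<le> L" and ne: "S \<noteq> {}"
    and le: "\<And>x y. x \<in> S \<Longrightarrow> y \<in> S \<Longrightarrow> \<bar>g x - g y\<bar> \<le> L * norm (x - y) powr \<alpha>"
  obtains g' where "\<And>x. x \<in> S \<Longrightarrow> g' x = g x" "\<And>x y. \<bar>g' x - g' y\<bar> \<le> L * norm (x - y) powr \<alpha>"
proof
  define F where "F x z = g z + L * norm (x - z) powr \<alpha>" for x z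
  define g' where "g' x = (INF z\<in>S. F x z)" for x
  have low: "g z0 - L * norm (x - z0) powr \<alpha> \<le> F x z" if "z \<in> S" "z0 \<in> S" for x z z0
  proof -
    have "g z0 - g z \<le> L * norm (z0 - z) powr \<alpha>" using le[OF that(2,1)] by simp
    also have "\<dots> \<le> L * (norm (z0 - x) powr \<alpha> + norm (x - z) powr \<alpha>)"
      by (intro mult_left_mono norm_powr_triangle a L)
    finally show ?thesis by (simp add: F_def algebra_simps norm_minus_commute)
  qed
  have bdd: "bdd_below (F x ` S)" for x
    using low[of _ "SOME z. z \<in> S" x] ne by (auto intro!: bdd_belowI simp: some_in_eq)
  show "g' x = g x" if x: "x \<in> S" for x
  proof (rule antisym)
    show "g' x \<le> g x" unfolding g'_def
      by (rule cINF_lower2[OF bdd x]) (simp add: F_def)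
    show "g x \<le> g' x" unfolding g'_def
      by (rule cINF_greatest[OF ne]) (use low[OF _ x, of _ x] in simp)
  qed
  have one: "g' x - L * norm (x - y) powr \<alpha> \<le> g' y" for x y
    unfolding g'_def[of y]
  proof (rule cINF_greatest[OF ne])
    fix z assume z: "z \<in> S"
    have "g' x \<le> F x z" unfolding g'_def by (rule cINF_lower[OF bdd z])
    also have "F x z \<le> g z + L * (norm (x - y) powr \<alpha> + norm (y - z) powr \<alpha>)"
      unfolding F_def by (intro add_left_mono mult_left_mono norm_powr_triangle a L)
    finally show "g' x - L * norm (x - y) powr \<alpha> \<le> F y z" by (simp add: F_def algebra_simps)
  qed
  show "\<bar>g' x - g' y\<bar> \<le> L * norm (x - y) powr \<alpha>" for x y
    using one[of x y] one[of y x] by (simp add: abs_le_iff norm_minus_commute)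
qed

text \<open>
  Not normalised; the normalising constant is divided out when it is used.
\<close>

definition mollifier :: "real \<Rightarrow> 'a::euclidean_space \<Rightarrow> real" where
  "mollifier \<delta> x = flat_exp 0 (1 - (x \<bullet> x) / \<delta>\<^sup>2)"

lemma Ck_mollifier: "Ck k (mollifier \<delta> :: 'a::euclidean_space \<Rightarrow> real)"
proof -
  have "Ck k (\<lambda>x::'a. 1 - (\<Sum>i\<in>Basis. (1 / \<delta>\<^sup>2) * ((x \<bullet> i) * (x \<bullet> i))))"
    by (intro Ck_diff Ck_const Ck_sum Ck_cmult Ck_mult Ck_inner_const finite_Basis)
  moreover have "1 - (\<Sum>i\<in>Basis. (1 / \<delta>\<^sup>2) * ((x \<bullet> i) * (x \<bullet> i))) = 1 - (x \<bullet> x) / \<delta>\<^sup>2" for x :: 'a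
    by (simp add: euclidean_inner[of x x] sum_divide_distrib)
  ultimately show ?thesis unfolding mollifier_def[abs_def] by (simp add: Ck_flat_exp)
qed

lemma grad_mollifier:
  "grad (mollifier \<delta>) (x :: 'a::euclidean_space) = (flat_exp 2 (1 - (x \<bullet> x) / \<delta>\<^sup>2) * (- 2 / \<delta>\<^sup>2)) *\<^sub>R x"
proof (rule grad_eqI)
  have d: "((\<lambda>x::'a. 1 - (x \<bullet> x) / \<delta>\<^sup>2) has_derivative (\<lambda>h. (- 2 / \<delta>\<^sup>2) * (x \<bullet> h))) (at x)"
  proof -
    have "((\<lambda>x::'a. 1 - inverse (\<delta>\<^sup>2) * (x \<bullet> x)) has_derivative (\<lambda>h. 0 - inverse (\<delta>\<^sup>2) * (x \<bullet> h + h \<bullet> x))) (at x)"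
      by (intro derivative_intros)
    then have "((\<lambda>x::'a. 1 - inverse (\<delta>\<^sup>2) * (x \<bullet> x)) has_derivative (\<lambda>h. (- 2 / \<delta>\<^sup>2) * (x \<bullet> h))) (at x)"
      by (rule has_derivative_eq_rhs) (simp add: fun_eq_iff inner_commute divide_inverse)
    then show ?thesis by (simp add: divide_inverse mult.commute)
  qed
  have "(flat_exp 0 has_derivative (*) (flat_exp 2 (1 - (x \<bullet> x) / \<delta>\<^sup>2))) (at (1 - (x \<bullet> x) / \<delta>\<^sup>2))"
    using flat_exp_has_derivative[of 0 "1 - (x \<bullet> x) / \<delta>\<^sup>2"] by (simp add: has_field_derivative_def numeral_2_eq_2)
  from has_derivative_compose[OF d this]
  show "(mollifier \<delta> has_derivative (\<bullet>) ((flat_exp 2 (1 - (x \<bullet> x) / \<delta>\<^sup>2) * (- 2 / \<delta>\<^sup>2)) *\<^sub>R x)) (at x)"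
    unfolding mollifier_def[abs_def] by (rule has_derivative_eq_rhs) (simp add: fun_eq_iff)
qed

lemma mollifier_nonneg: "0 \<le> mollifier \<delta> x"
  by (simp add: mollifier_def flat_exp_nonneg)

lemma mollifier_support:
  assumes "0 < \<delta>" "\<delta> \<le> norm x" shows "mollifier \<delta> x = 0" "grad (mollifier \<delta>) x = 0"
proof -
  have "1 - (x \<bullet> x) / \<delta>\<^sup>2 \<le> 0"
    using assms by (simp add: power2_norm_eq_inner[symmetric] divide_simps power_mono)
  then show "mollifier \<delta> x = 0" "grad (mollifier \<delta>) x = 0"
    by (simp_all add: mollifier_def grad_mollifier flat_exp_eq_0)
qed

lemma mollifier_lower:
  assumes "0 < \<delta>" "norm x \<le> \<delta> / 2" shows "flat_exp 0 (3/4) \<le> mollifier \<delta> x"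
  unfolding mollifier_def
proof (rule flat_exp_mono_0)
  have "(norm x)\<^sup>2 \<le> (\<delta> / 2)\<^sup>2" using assms by (intro power_mono) auto
  then show "3 / 4 \<le> 1 - (x \<bullet> x) / \<delta>\<^sup>2"
    using assms by (simp add: power2_norm_eq_inner[symmetric] power_divide field_simps)
qed

lemma norm_grad_mollifier:
  assumes "0 < \<delta>" shows "norm (grad (mollifier \<delta>) x) \<le> 12 / \<delta>"
proof (cases "norm x \<le> \<delta>")
  case True
  let ?t = "1 - (x \<bullet> x) / \<delta>\<^sup>2"
  have "(norm x)\<^sup>2 \<le> \<delta>\<^sup>2" using True by (intro power_mono) auto
  then have t: "0 \<le> ?t" "?t \<le> 1" using assms by (simp_all add: power2_norm_eq_inner)
  have "fact (Suc 2) = (6::real)" by (simp add: fact_numeral eval_nat_numeral)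
  then have f: "\<bar>flat_exp 2 ?t\<bar> \<le> 6"
  proof -
    have "\<bar>flat_exp 2 ?t\<bar> \<le> 6 * \<bar>?t\<bar>" using flat_exp_le[of 2 ?t] \<open>fact (Suc 2) = (6::real)\<close> by (simp only:)
    moreover have "a \<le> 6 * \<bar>s\<bar> \<Longrightarrow> 0 \<le> s \<Longrightarrow> s \<le> 1 \<Longrightarrow> a \<le> 6" for a s :: real by simp
    ultimately show ?thesis using t by blast
  qed
  have "norm (grad (mollifier \<delta>) x) = \<bar>flat_exp 2 ?t\<bar> * (2 / \<delta>\<^sup>2 * norm x)"
    by (simp add: grad_mollifier abs_mult)
  also have "\<dots> \<le> 6 * (2 / \<delta>\<^sup>2 * \<delta>)"
    using True assms by (intro mult_mono f) auto
  also have "\<dots> = 12 / \<delta>" using assms by (simp add: power2_eq_square)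
  finally show ?thesis .
next
  case False then show ?thesis using mollifier_support[of \<delta> x] assms by simp
qed

lemma integral_mollifier_translate:
  fixes x :: "'a::euclidean_space"
  assumes \<delta>: "0 < \<delta>" and Q: "cball x \<delta> \<subseteq> cbox c d"
  shows "integral (cbox c d) (\<lambda>w. mollifier \<delta> (x - w)) = (LINT w|lborel. mollifier \<delta> (w::'a))"
proof -
  have c: "continuous_on UNIV (mollifier \<delta> :: 'a \<Rightarrow> real)" by (rule Ck_continuous[OF Ck_mollifier[of 0]])
  have z: "mollifier \<delta> (x - w) = 0" if "w \<notin> cball x \<delta>" for w
    using that mollifier_support(1)[OF \<delta>, of "x - w"] by (simp add: dist_norm)
  have i: "integrable lborel (\<lambda>w. mollifier \<delta> (x - w))"
    by (rule integrable_compact_support[OF _ compact_cball z])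
       (auto intro!: continuous_on_compose2[OF c] continuous_intros)
  have "integral (cbox c d) (\<lambda>w. mollifier \<delta> (x - w)) =
      integral UNIV (\<lambda>w. if w \<in> cbox c d then mollifier \<delta> (x - w) else 0)"
    by (rule integral_restrict_UNIV[symmetric])
  also have "(\<lambda>w. if w \<in> cbox c d then mollifier \<delta> (x - w) else 0) = (\<lambda>w. mollifier \<delta> (x - w))"
    using z Q by (intro ext) (metis subsetD)
  also have "integral UNIV (\<lambda>w. mollifier \<delta> (x - w)) = (LINT w|lborel. mollifier \<delta> (x - w))"
    by (rule integral_lborel[OF i])
  also have "\<dots> = (LINT w|lborel. mollifier \<delta> (- x + w))"
    by (simp add: mollifier_def inner_diff inner_add inner_commute algebra_simps)
  also have "(LINT w|lborel. mollifier \<delta> (- x + w)) = (LINT w|lborel. mollifier \<delta> (w::'a))"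
    by (rule lborel_integral_translate) (rule borel_measurable_continuous_onI[OF c])
  finally show ?thesis .
qed

lemma integral_const_on_ball:
  fixes x :: "'a::euclidean_space"
  assumes "cball x r \<subseteq> cbox c d" "0 < r"
  shows "(\<lambda>w. if w \<in> cball x r then k else 0::real) integrable_on cbox c d"
    "integral (cbox c d) (\<lambda>w. if w \<in> cball x r then k else 0::real) = k * (r ^ DIM('a) * measure lborel (ball (0::'a) 1))"
proof -
  have i: "(\<lambda>w. k) integrable_on cball x r" by (rule integrable_on_const) simp
  have "(\<lambda>w. if w \<in> cball x r then k else 0::real) integrable_on UNIV"
    using i by (simp only: integrable_restrict_UNIV)
  then show "(\<lambda>w. if w \<in> cball x r then k else 0::real) integrable_on cbox c d"
    by (rule integrable_on_subcbox) simp
  have "integral (cbox c d) (\<lambda>w. if w \<in> cball x r then k else 0) = integral (cball x r) (\<lambda>w. k * 1)"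
    using integral_restrict_Int[of "cbox c d" "cball x r" "\<lambda>w. k"] assms(1) by (simp add: Int_absorb2 del: mem_cball)
  also have "\<dots> = k * integral (cball x r) (\<lambda>w. 1)" by (rule integral_mult_right)
  also have "integral (cball x r) (\<lambda>w. 1) = measure lborel (cball x r)"
    using lmeasure_integral[of "cball x r"] by (simp add: measure_completion)
  also have "measure lborel (cball x r) = r ^ DIM('a) * measure lborel (ball (0::'a) 1)"
    using assms(2) content_ball_conv_unit_ball[of r x] by (simp add: content_cball_conv_ball)
  finally show "integral (cbox c d) (\<lambda>w. if w \<in> cball x r then k else 0::real) = k * (r ^ DIM('a) * measure lborel (ball (0::'a) 1))" .
qed

text \<open>
  Together with the bound \<open>12 / \<delta>\<close> for its gradient, this keeps the gradient of the normalised mollifier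
  of order \<open>1 / \<delta>\<close> in \<open>L\<^sup>1\<close>: both bounds are volumes of balls of radius proportional to \<open>\<delta>\<close>.
\<close>

lemma integral_mollifier_lower:
  assumes "0 < \<delta>"
  shows "flat_exp 0 (3/4) * ((\<delta> / 2) ^ DIM('a) * measure lborel (ball (0::'a) 1)) \<le> (LINT w|lborel. mollifier \<delta> (w :: 'a::euclidean_space))"
proof -
  obtain a where a: "cball (0::'a) \<delta> \<subseteq> cbox (-a) a"
    using bounded_subset_cbox_symmetric[OF bounded_cball] by blast
  have c: "continuous_on UNIV (mollifier \<delta> :: 'a \<Rightarrow> real)" by (rule Ck_continuous[OF Ck_mollifier[of 0]])
  have a2: "cball (0::'a) (\<delta> / 2) \<subseteq> cbox (-a) a" using a assms by (auto intro: subset_trans[OF subset_cball])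
  have "integral (cbox (-a) a) (\<lambda>w. if w \<in> cball 0 (\<delta>/2) then flat_exp 0 (3/4) else 0) \<le> integral (cbox (-a) a) (\<lambda>w. mollifier \<delta> (0 - w))"
  proof (rule integral_le)
    show "(\<lambda>w. mollifier \<delta> (0 - w)) integrable_on cbox (-a) a"
      by (intro integrable_continuous continuous_on_compose2[OF c] continuous_intros) auto
    show "(if w \<in> cball 0 (\<delta>/2) then flat_exp 0 (3/4) else 0) \<le> mollifier \<delta> (0 - w)" for w
      using mollifier_lower[OF assms, of "0 - w"] by (auto simp: mollifier_nonneg)
  qed (use integral_const_on_ball(1)[OF a2] assms in auto)
  then show ?thesis
    unfolding integral_const_on_ball(2)[OF a2 half_gt_zero[OF assms]] integral_mollifier_translate[OF assms a] .
qed

text \<open>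
  Extend \<open>g\<close> to the whole space and average it over balls of radius \<open>\<delta>\<close>. The average differs from \<open>g\<close> by
  the oscillation of \<open>g\<close> on such balls. The kernel of its gradient has integral zero, so \<open>g x\<close> may be
  subtracted before the gradient is estimated, which again leaves the oscillation, now times \<open>1 / \<delta>\<close>. The
  constant \<open>K\<close> depends on the dimension only.
\<close>

lemma (in bounded_open) mollification:
  "\<exists>K>0. \<forall>\<alpha> L g \<delta>. 0 < \<alpha> \<longrightarrow> \<alpha> \<le> 1 \<longrightarrow> 0 \<le> L \<longrightarrow>
     (\<forall>x\<in>D. \<forall>y\<in>D. \<bar>g x - g y\<bar> \<le> L * norm (x - y) powr \<alpha>) \<longrightarrow> 0 < \<delta> \<longrightarrow> \<delta> \<le> 1 \<longrightarrow>
     (\<exists>\<beta>. (\<forall>k. Ck k \<beta>) \<and> (\<forall>x\<in>D. \<bar>\<beta> x - g x\<bar> \<le> L * \<delta> powr \<alpha> \<and>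
        norm (grad \<beta> x) \<le> K * L * \<delta> powr (\<alpha> - 1)))"
proof -
  define vol where "vol = measure lborel (ball (0::'a) 1)"
  have vol: "0 < vol" unfolding vol_def by (simp add: content_ball_pos)
  have fl: "0 < flat_exp 0 (3/4)" by (simp add: flat_exp_pos)
  (* The factor 2 ^ DIM is the ratio of the volumes of balls of radius \<delta> and \<delta> / 2. *)
  define K where "K = 12 * 2 ^ DIM('a) / flat_exp 0 (3/4)"
  have "K > 0" using fl by (simp add: K_def)
  moreover have "\<exists>\<beta>. (\<forall>k. Ck k \<beta>) \<and> (\<forall>x\<in>D. \<bar>\<beta> x - g x\<bar> \<le> L * \<delta> powr \<alpha> \<and>
        norm (grad \<beta> x) \<le> K * L * \<delta> powr (\<alpha> - 1))"
    if a: "0 < \<alpha>" "\<alpha> \<le> 1" and L: "0 \<le> L"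
      and h: "\<And>x y. x \<in> D \<Longrightarrow> y \<in> D \<Longrightarrow> \<bar>g x - g y\<bar> \<le> L * norm (x - y) powr \<alpha>"
      and \<delta>: "0 < \<delta>" "\<delta> \<le> 1" for \<alpha> L g \<delta>
  proof (cases "D = {}")
    case True then show ?thesis by (intro exI[of _ "\<lambda>x. 0"]) (auto simp: Ck_const)
  next
    case False
    obtain g' where g': "\<And>x. x \<in> D \<Longrightarrow> g' x = g x" "\<And>x y. \<bar>g' x - g' y\<bar> \<le> L * norm (x - y) powr \<alpha>"
      using holder_extension[OF a L False h] by blast
    have cg: "continuous_on S g'" for S
      by (rule holder_continuous_on[OF a(1) g'(2)])
    obtain R where R: "\<And>x. x \<in> D \<Longrightarrow> norm x \<le> R" using bounded_D unfolding bounded_iff by blast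
    obtain q where q: "cball (0::'a) (R + 1) \<subseteq> cbox (-q) q"
      using bounded_subset_cbox_symmetric[OF bounded_cball] by blast
    have QD: "cball x \<delta> \<subseteq> cbox (-q) q" if "x \<in> D" for x
    proof -
      have "cball x \<delta> \<subseteq> cball 0 (R + 1)"
        using R[OF that] \<delta> by (auto simp: dist_norm) (smt (verit) norm_minus_commute norm_triangle_sub)
      then show ?thesis using q by blast
    qed
    define c where "c = (LINT w|lborel. mollifier \<delta> (w::'a))"
    have clow: "flat_exp 0 (3/4) * ((\<delta> / 2) ^ DIM('a) * vol) \<le> c"
      unfolding c_def vol_def by (rule integral_mollifier_lower[OF \<delta>(1)])
    moreover have "0 < flat_exp 0 (3/4) * ((\<delta> / 2) ^ DIM('a) * vol)" using fl vol \<delta> by simp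
    ultimately have cpos: "0 < c" by linarith
    define B where "B h x = integral (cbox (-q) q) (\<lambda>w. h w * mollifier \<delta> (x - w))" for h and x :: 'a
    define G where "G h x = integral (cbox (-q) q) (\<lambda>w. h w *\<^sub>R grad (mollifier \<delta>) (x - w))" for h and x :: 'a
    have cm: "continuous_on UNIV (mollifier \<delta> :: 'a \<Rightarrow> real)" by (rule Ck_continuous[OF Ck_mollifier[of 0]])
    have cgm: "continuous_on UNIV (grad (mollifier \<delta>) :: 'a \<Rightarrow> 'a)" by (rule Ck_grad_continuous[OF Ck_mollifier[of "Suc 0"]])
    have iB: "(\<lambda>w. h w * mollifier \<delta> (x - w)) integrable_on cbox (-q) q" if "continuous_on (cbox (-q) q) h" for h x
      by (intro integrable_continuous continuous_intros that continuous_on_compose2[OF cm]) auto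
    have iG: "(\<lambda>w. h w *\<^sub>R grad (mollifier \<delta>) (x - w)) integrable_on cbox (-q) q" if "continuous_on (cbox (-q) q) h" for h x
      by (intro integrable_continuous continuous_intros that continuous_on_compose2[OF cgm]) auto
    (* B and G are the convolutions of h with the mollifier and with its gradient. *)
    have dB: "(B h has_derivative (\<lambda>v. G h x \<bullet> v)) (at x)" if "continuous_on (cbox (-q) q) h" for h x
      unfolding B_def[abs_def] G_def by (rule has_derivative_convolution[OF that Ck_mollifier])
    have B1: "B (\<lambda>w. 1) x = c" if "x \<in> D" for x
      using integral_mollifier_translate[OF \<delta>(1) QD[OF that]] by (simp add: B_def c_def)
    (* The convolution of 1 is the constant c on the open set D, so its gradient vanishes there. *)
    have G1: "G (\<lambda>w. 1) x = 0" if x: "x \<in> D" for x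
    proof -
      have "(B (\<lambda>w. 1) has_derivative (\<lambda>v. 0)) (at x)"
        by (rule has_derivative_transform_within_open[OF has_derivative_const open_D x, of c]) (simp add: B1)
      then have "grad (B (\<lambda>w. 1)) x = 0" by (intro grad_eqI) (rule has_derivative_eq_rhs, auto)
      moreover have "grad (B (\<lambda>w. 1)) x = G (\<lambda>w. 1) x" by (rule grad_eqI[OF dB]) auto
      ultimately show ?thesis by simp
    qed
    have osc: "\<bar>g' w - g' x\<bar> \<le> L * \<delta> powr \<alpha>" if "norm (x - w) \<le> \<delta>" for w x
    proof -
      have "L * norm (w - x) powr \<alpha> \<le> L * \<delta> powr \<alpha>"
        using that a L by (intro mult_left_mono powr_mono2) (auto simp: norm_minus_commute)
      then show ?thesis using g'(2)[of w x] by linarith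
    qed
    define \<beta> where "\<beta> x = (1 / c) * B g' x" for x
    have "Ck k \<beta>" for k
      unfolding \<beta>_def[abs_def] B_def by (intro Ck_cmult Ck_convolution cg Ck_mollifier)
    moreover have "\<bar>\<beta> x - g x\<bar> \<le> L * \<delta> powr \<alpha>" if x: "x \<in> D" for x
    proof -
      have cgx: "continuous_on (cbox (-q) q) (\<lambda>w. g' w - g' x)" by (intro continuous_intros cg)
      have "B g' x - g' x * B (\<lambda>w. 1) x = B (\<lambda>w. g' w - g' x) x"
      proof -
        have "B (\<lambda>w. g' w - g' x) x = integral (cbox (-q) q) (\<lambda>w. g' w * mollifier \<delta> (x - w) - g' x * (1 * mollifier \<delta> (x - w)))"
          unfolding B_def by (simp add: left_diff_distrib)
        also have "\<dots> = B g' x - integral (cbox (-q) q) (\<lambda>w. g' x * (1 * mollifier \<delta> (x - w)))"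
          unfolding B_def by (intro integral_diff iB cg integrable_on_mult_right) auto
        also have "integral (cbox (-q) q) (\<lambda>w. g' x * (1 * mollifier \<delta> (x - w))) = g' x * B (\<lambda>w. 1) x"
          unfolding B_def by (rule integral_mult_right)
        finally show ?thesis by simp
      qed
      moreover have "norm (B (\<lambda>w. g' w - g' x) x) \<le> integral (cbox (-q) q) (\<lambda>w. (L * \<delta> powr \<alpha>) * mollifier \<delta> (x - w))"
        unfolding B_def
      proof (rule Henstock_Kurzweil_Integration.integral_norm_bound_integral[OF iB[OF cgx] iB])
        show "norm ((g' w - g' x) * mollifier \<delta> (x - w)) \<le> L * \<delta> powr \<alpha> * mollifier \<delta> (x - w)" for w
        proof (cases "norm (x - w) \<le> \<delta>")
          case True then show ?thesis using osc mollifier_nonneg[of \<delta> "x - w"]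
            by (auto simp: abs_mult intro!: mult_right_mono)
        qed (use mollifier_support(1)[OF \<delta>(1), of "x - w"] in simp)
      qed auto
      moreover have "integral (cbox (-q) q) (\<lambda>w. mollifier \<delta> (x - w)) = c"
        using B1[OF x] by (simp add: B_def)
      ultimately have "\<bar>B g' x - g' x * c\<bar> \<le> L * \<delta> powr \<alpha> * c" using B1[OF x] by simp
      moreover have "\<beta> x - g x = (B g' x - g' x * c) / c" using cpos g'(1)[OF x] by (simp add: \<beta>_def field_simps)
      ultimately show ?thesis using cpos by (simp add: divide_le_eq)
    qed
    moreover have "norm (grad \<beta> x) \<le> K * L * \<delta> powr (\<alpha> - 1)" if x: "x \<in> D" for x
    proof -
      have cgx: "continuous_on (cbox (-q) q) (\<lambda>w. g' w - g' x)" by (intro continuous_intros cg)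
      have "grad \<beta> x = (1 / c) *\<^sub>R G g' x"
        unfolding \<beta>_def[abs_def]
        by (rule grad_eqI, rule has_derivative_eq_rhs[OF has_derivative_mult_right[OF dB[OF cg]]]) (simp add: fun_eq_iff)
      also have "G g' x = G (\<lambda>w. g' w - g' x) x"
      proof -
        have "G (\<lambda>w. g' w - g' x) x = integral (cbox (-q) q) (\<lambda>w. g' w *\<^sub>R grad (mollifier \<delta>) (x - w) - g' x *\<^sub>R (1 *\<^sub>R grad (mollifier \<delta>) (x - w)))"
          unfolding G_def by (simp add: scaleR_left_diff_distrib)
        also have "\<dots> = G g' x - integral (cbox (-q) q) (\<lambda>w. g' x *\<^sub>R (1 *\<^sub>R grad (mollifier \<delta>) (x - w)))"
          unfolding G_def by (intro integral_diff iG cg integrable_cmul) auto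
        also have "integral (cbox (-q) q) (\<lambda>w. g' x *\<^sub>R (1 *\<^sub>R grad (mollifier \<delta>) (x - w))) = g' x *\<^sub>R G (\<lambda>w. 1) x"
          unfolding G_def by (rule integral_cmul)
        finally show ?thesis using G1[OF x] by simp
      qed
      finally have e: "norm (grad \<beta> x) = (1 / c) * norm (G (\<lambda>w. g' w - g' x) x)" using cpos by simp
      have "norm (G (\<lambda>w. g' w - g' x) x) \<le> integral (cbox (-q) q) (\<lambda>w. if w \<in> cball x \<delta> then L * \<delta> powr \<alpha> * (12 / \<delta>) else 0)"
        unfolding G_def
      proof (rule Henstock_Kurzweil_Integration.integral_norm_bound_integral[OF iG[OF cgx] integral_const_on_ball(1)[OF QD[OF x] \<delta>(1)]])
        show "norm ((g' w - g' x) *\<^sub>R grad (mollifier \<delta>) (x - w)) \<le> (if w \<in> cball x \<delta> then L * \<delta> powr \<alpha> * (12 / \<delta>) else 0)" for w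
        proof (cases "norm (x - w) \<le> \<delta>")
          case True
          have "\<bar>g' w - g' x\<bar> * norm (grad (mollifier \<delta>) (x - w)) \<le> L * \<delta> powr \<alpha> * (12 / \<delta>)"
            using L by (intro mult_mono osc True norm_grad_mollifier \<delta>) auto
          then show ?thesis using True by (simp add: dist_norm)
        qed (use mollifier_support(2)[OF \<delta>(1), of "x - w"] in \<open>simp add: dist_norm\<close>)
      qed
      also have "\<dots> = L * \<delta> powr \<alpha> * (12 / \<delta>) * (\<delta> ^ DIM('a) * vol)"
        unfolding vol_def by (rule integral_const_on_ball(2)[OF QD[OF x] \<delta>(1)])
      also have "\<dots> = L * \<delta> powr (\<alpha> - 1) * K * (flat_exp 0 (3/4) * ((\<delta> / 2) ^ DIM('a) * vol))"
        using \<delta> fl by (simp add: K_def powr_diff power_divide field_simps)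
      also have "\<dots> \<le> L * \<delta> powr (\<alpha> - 1) * K * c"
        using L \<open>K > 0\<close> by (intro mult_left_mono clow) auto
      finally show ?thesis unfolding e using cpos by (simp add: divide_le_eq algebra_simps)
    qed
    ultimately show ?thesis by blast
  qed
  ultimately show ?thesis by (intro exI[of _ K]) auto
qed

section \<open>The Galerkin error for a fixed Hoelder continuous exponent\<close>

lemma abs_exp_diff_le:
  fixes x y B :: real
  assumes "\<bar>x\<bar> \<le> B" "\<bar>y\<bar> \<le> B"
  shows "\<bar>exp x - exp y\<bar> \<le> exp B * \<bar>x - y\<bar>"
proof -
  have *: "exp t - exp s \<le> exp B * (t - s)" if "s \<le> t" "t \<le> B" for s t :: real
  proof -
    have "exp t - exp s = exp t * (1 - exp (s - t))" by (simp add: exp_diff algebra_simps)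
    also have "\<dots> \<le> exp t * (t - s)"
    proof (rule mult_left_mono)
      show "1 - exp (s - t) \<le> t - s" using exp_ge_add_one_self[of "s - t"] by linarith
    qed simp
    also have "\<dots> \<le> exp B * (t - s)" using that by (intro mult_right_mono) auto
    finally show ?thesis .
  qed
  show ?thesis
  proof (cases "x \<le> y")
    case True then show ?thesis using *[of x y] assms by auto
  next
    case False then show ?thesis using *[of y x] assms by auto
  qed
qed

context bounded_open begin

lemma exp_elliptic:
  assumes "g \<in> borel_measurable (lebesgue_on D)" "\<And>x. x \<in> D \<Longrightarrow> \<bar>g x\<bar> \<le> B"
  shows "elliptic_coefficient D (\<lambda>x. exp (g x)) (exp (- B)) (exp B)"
proof
  show "(\<lambda>x. exp (g x)) \<in> borel_measurable (lebesgue_on D)" using assms(1) by measurable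
qed (use assms(2) in \<open>auto simp: abs_le_iff minus_le_iff\<close>)

lemma continuous_measurable_D:
  fixes g :: "'a \<Rightarrow> real"
  assumes "continuous_on D g" shows "g \<in> borel_measurable (lebesgue_on D)"
  by (rule continuous_imp_measurable_on_sets_lebesgue[OF assms lebesgue_D])

text \<open>
  The error for one fixed coefficient \<open>exp g\<close>. The solution \<open>u\<close> is compared with the solution \<open>u2\<close> for a
  mollified exponent \<open>\<beta>\<close>. By stability \<open>u - u2\<close> is of order \<open>\<delta> powr \<alpha>\<close>. The Laplacian of \<open>u2\<close> is of
  order \<open>\<delta> powr (\<alpha> - 1)\<close>, and the approximation property of \<open>S\<close> contributes one factor \<open>\<delta>\<close>. So mollifying at
  the scale of the approximation error balances the two contributions. The factor \<open>exp (8 * B)\<close>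
  collects the ellipticity ratios of the two coefficients and absorbs the factors \<open>B\<close>; its exponent is not
  optimal.
\<close>

lemma galerkin_holder_error:
  assumes f: "f \<in> L2 D" and \<alpha>: "0 < \<alpha>" "\<alpha> \<le> 1" and C0: "0 \<le> C0"
  obtains K where "0 < K"
    and "\<And>g B S \<delta> u us. \<lbrakk>0 \<le> B; \<And>x. x \<in> D \<Longrightarrow> \<bar>g x\<bar> \<le> B;
      \<forall>x\<in>D. \<forall>y\<in>D. \<bar>g x - g y\<bar> \<le> B * norm (x - y) powr \<alpha>;
      S \<subseteq> H10 D; \<And>v w. v \<in> S \<Longrightarrow> w \<in> S \<Longrightarrow> (\<lambda>x. v x - w x) \<in> S;
      galerkin_solution D (H10 D) (\<lambda>x. exp (g x)) f u; galerkin_solution D S (\<lambda>x. exp (g x)) f us;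
      0 < \<delta>; \<delta> \<le> 1;
      \<And>v. v \<in> W_space D \<Longrightarrow> (INF s\<in>S. V_norm D (\<lambda>x. v x - s x)) \<le> C0 * \<delta> * W_norm D v\<rbrakk>
      \<Longrightarrow> V_norm D (\<lambda>x. u x - us x) \<le> K * exp (8 * B) * \<delta> powr \<alpha>"
proof -
  obtain K0 where K0: "0 < K0" "\<And>L g \<delta>. 0 \<le> L \<Longrightarrow>
     (\<forall>x\<in>D. \<forall>y\<in>D. \<bar>g x - g y\<bar> \<le> L * norm (x - y) powr \<alpha>) \<Longrightarrow> 0 < \<delta> \<Longrightarrow> \<delta> \<le> 1 \<Longrightarrow>
     \<exists>\<beta>. (\<forall>k. Ck k \<beta>) \<and> (\<forall>x\<in>D. \<bar>\<beta> x - g x\<bar> \<le> L * \<delta> powr \<alpha> \<and> norm (grad \<beta> x) \<le> K0 * L * \<delta> powr (\<alpha> - 1))"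
    using mollification \<alpha> by metis
  define P where "P = poincare * L2_norm D f"
  have P: "0 \<le> P" using Poincare(1) by (simp add: P_def)
  define K where "K = P + C0 * (L2_norm D f + K0 * P) + 1"
  have K: "0 < K" using P C0 K0(1) by (auto simp: K_def intro!: add_nonneg_pos add_nonneg_nonneg mult_nonneg_nonneg)
  have main: "V_norm D (\<lambda>x. u x - us x) \<le> K * exp (8 * B) * \<delta> powr \<alpha>"
    if B: "0 \<le> B" "\<And>x. x \<in> D \<Longrightarrow> \<bar>g x\<bar> \<le> B" and h: "\<forall>x\<in>D. \<forall>y\<in>D. \<bar>g x - g y\<bar> \<le> B * norm (x - y) powr \<alpha>"
      and S: "S \<subseteq> H10 D" "\<And>v w. v \<in> S \<Longrightarrow> w \<in> S \<Longrightarrow> (\<lambda>x. v x - w x) \<in> S"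
      and u: "galerkin_solution D (H10 D) (\<lambda>x. exp (g x)) f u" and us: "galerkin_solution D S (\<lambda>x. exp (g x)) f us"
      and \<delta>: "0 < \<delta>" "\<delta> \<le> 1"
      and app: "\<And>v. v \<in> W_space D \<Longrightarrow> (INF s\<in>S. V_norm D (\<lambda>x. v x - s x)) \<le> C0 * \<delta> * W_norm D v"
    for g B S \<delta> u us
  proof -
    obtain \<beta> where \<beta>: "\<And>k. Ck k \<beta>" "\<And>x. x \<in> D \<Longrightarrow> \<bar>\<beta> x - g x\<bar> \<le> B * \<delta> powr \<alpha>"
      "\<And>x. x \<in> D \<Longrightarrow> norm (grad \<beta> x) \<le> K0 * B * \<delta> powr (\<alpha> - 1)"
      using K0(2)[OF B(1) h \<delta>] by blast
    let ?d = "\<delta> powr \<alpha>"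
    have d: "0 \<le> ?d" "?d \<le> 1" "\<delta> \<le> ?d"
      using \<delta> \<alpha> powr_mono'[of \<alpha> 1 \<delta>] by (auto intro: powr_le1)
    have \<beta>B: "\<bar>\<beta> x\<bar> \<le> 2 * B" if "x \<in> D" for x
    proof -
      have "B * ?d \<le> B * 1" by (intro mult_left_mono d B)
      then show ?thesis using \<beta>(2)[OF that] B(2)[OF that] by linarith
    qed
    have gB2: "\<bar>g x\<bar> \<le> 2 * B" if "x \<in> D" for x using B(2)[OF that] B(1) by linarith
    have gm: "g \<in> borel_measurable (lebesgue_on D)"
      by (intro continuous_measurable_D holder_continuous_on[OF \<alpha>(1)]) (use h in blast)
    have \<beta>m: "\<beta> \<in> borel_measurable (lebesgue_on D)"
      by (intro continuous_measurable_D continuous_on_subset[OF Ck_continuous[OF \<beta>(1)[of 0]]]) auto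
    interpret g: elliptic_coefficient D "\<lambda>x. exp (g x)" "exp (- B)" "exp B" by (rule exp_elliptic[OF gm B(2)])
    interpret \<beta>: elliptic_coefficient D "\<lambda>x. exp (\<beta> x)" "exp (- (2 * B))" "exp (2 * B)" by (rule exp_elliptic[OF \<beta>m \<beta>B])
    obtain u2 where u2: "galerkin_solution D (H10 D) (\<lambda>x. exp (\<beta> x)) f u2" using \<beta>.galerkin_exists[OF f] by blast
    have H: "u \<in> H10 D" "us \<in> H10 D" "u2 \<in> H10 D" using u us u2 S by (auto simp: galerkin_solution_def)
    have V2: "V_norm D u2 \<le> exp (2 * B) * P"
      using \<beta>.galerkin_apriori[OF order_refl f u2] by (simp add: P_def exp_minus field_simps)
    have "exp (- B) * V_norm D (\<lambda>x. u x - u2 x) \<le> (exp (2 * B) * (B * ?d)) * V_norm D u2"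
    proof (rule g.galerkin_stability[OF order_refl H10_diff(1) u \<beta>.elliptic_coefficient_axioms u2])
      show "0 \<le> exp (2 * B) * (B * ?d)" using B d by simp
      show "\<bar>exp (\<beta> x) - exp (g x)\<bar> \<le> exp (2 * B) * (B * ?d)" if "x \<in> D" for x
        using abs_exp_diff_le[OF \<beta>B[OF that] gB2[OF that]] \<beta>(2)[OF that]
        by (auto elim!: order_trans intro!: mult_left_mono)
    qed
    also have "\<dots> \<le> (exp (2 * B) * (B * ?d)) * (exp (2 * B) * P)"
      using B d by (intro mult_left_mono V2) auto
    also have "\<dots> = exp (4 * B) * B * P * ?d" 
    proof -
      have "exp (4 * B) = exp (2 * B) * exp (2 * B)" by (simp add: exp_add[symmetric])
      then show ?thesis by (simp add: algebra_simps)
    qed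
    finally have "exp (- B) * V_norm D (\<lambda>x. u x - u2 x) \<le> exp (4 * B) * B * P * ?d" .
    then have "exp B * (exp (- B) * V_norm D (\<lambda>x. u x - u2 x)) \<le> exp B * (exp (4 * B) * B * P * ?d)"
      by (rule mult_left_mono) simp
    moreover have "exp (5 * B) = exp B * exp (4 * B)" by (simp add: exp_add[symmetric])
    ultimately have V3: "V_norm D (\<lambda>x. u x - u2 x) \<le> exp (5 * B) * B * P * ?d"
      by (simp only: exp_minus mult.assoc[symmetric]) simp
    have Kg: "0 \<le> K0 * B * \<delta> powr (\<alpha> - 1)" using K0(1) B by simp
    note reg = smooth_coefficient_regularity[OF \<beta>(1) \<beta>B \<beta>(3) Kg f u2]
    have dd: "\<delta> * \<delta> powr (\<alpha> - 1) = ?d" using \<delta> by (simp add: powr_mult_base)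
    have "\<delta> * W_norm D u2 \<le> \<delta> * (exp (2 * B) * L2_norm D f + K0 * B * \<delta> powr (\<alpha> - 1) * (exp (2 * B) * P))"
      using \<delta> Kg by (intro mult_left_mono order_trans[OF reg(2)] add_left_mono V2) auto
    also have "\<dots> = exp (2 * B) * (L2_norm D f * \<delta> + K0 * B * P * (\<delta> * \<delta> powr (\<alpha> - 1)))" by (simp add: algebra_simps)
    also have "\<dots> \<le> exp (2 * B) * (L2_norm D f * ?d + K0 * B * P * ?d)"
      unfolding dd by (intro mult_left_mono add_right_mono d) auto
    finally have W: "\<delta> * W_norm D u2 \<le> exp (2 * B) * (L2_norm D f * ?d + K0 * B * P * ?d)" .
    have "exp (- (2 * B)) * V_norm D (\<lambda>x. u x - us x) - V_norm D (\<lambda>x. u x - u2 x) \<le> (INF s\<in>S. V_norm D (\<lambda>x. u2 x - s x))"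
    proof (rule cINF_greatest)
      show "S \<noteq> {}" using us by (auto simp: galerkin_solution_def)
      fix s assume s: "s \<in> S"
      have "exp (- B) * (exp (- B) * V_norm D (\<lambda>x. u x - us x)) \<le> exp (- B) * (exp B * V_norm D (\<lambda>x. u x - s x))"
      proof (rule mult_left_mono)
        show "exp (- B) * V_norm D (\<lambda>x. u x - us x) \<le> exp B * V_norm D (\<lambda>x. u x - s x)"
          using g.Cea[OF S u us s] unfolding abs_exp_cancel .
      qed simp
      moreover have "exp (- (2 * B)) = exp (- B) * exp (- B)" by (simp add: exp_add[symmetric])
      ultimately have "exp (- (2 * B)) * V_norm D (\<lambda>x. u x - us x) \<le> V_norm D (\<lambda>x. u x - s x)"
        by (simp only: mult.assoc[symmetric] exp_minus) simp
      also have "\<dots> \<le> V_norm D (\<lambda>x. u x - u2 x) + V_norm D (\<lambda>x. u2 x - s x)"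
        using S s by (intro V_norm_triangle_diff H) auto
      finally show "exp (- (2 * B)) * V_norm D (\<lambda>x. u x - us x) - V_norm D (\<lambda>x. u x - u2 x) \<le> V_norm D (\<lambda>x. u2 x - s x)" by simp
    qed
    also have "\<dots> \<le> C0 * (\<delta> * W_norm D u2)" using app[OF reg(1)] by (simp add: mult.assoc)
    also have "\<dots> \<le> C0 * (exp (2 * B) * (L2_norm D f * ?d + K0 * B * P * ?d))"
      by (intro mult_left_mono W C0)
    finally have "exp (- (2 * B)) * V_norm D (\<lambda>x. u x - us x) \<le>
        exp (5 * B) * B * P * ?d + C0 * (exp (2 * B) * (L2_norm D f * ?d + K0 * B * P * ?d))" using V3 by linarith
    also have "\<dots> \<le> exp (5 * B) * exp B * P * ?d + C0 * (exp (5 * B) * (L2_norm D f * exp B * ?d + K0 * exp B * P * ?d))"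
    proof -
      have "1 + B \<le> exp B" by (rule exp_ge_add_one_self)
      then have e: "B \<le> exp B" "1 \<le> exp B" using B(1) by linarith+
      have i1: "exp (5 * B) * B * P * ?d \<le> exp (5 * B) * exp B * P * ?d"
        using d P e by (intro mult_right_mono mult_left_mono) auto
      have i2: "L2_norm D f * ?d \<le> L2_norm D f * exp B * ?d"
        using mult_left_mono[OF e(2), of "L2_norm D f"] d by (intro mult_right_mono) auto
      have i3: "K0 * B * P * ?d \<le> K0 * exp B * P * ?d"
        using d P e K0(1) by (intro mult_right_mono mult_left_mono) auto
      have i4: "0 \<le> L2_norm D f * ?d + K0 * B * P * ?d" using d P B K0(1) by simp
      have "exp (2 * B) * (L2_norm D f * ?d + K0 * B * P * ?d) \<le>
          exp (5 * B) * (L2_norm D f * exp B * ?d + K0 * exp B * P * ?d)"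
        by (rule mult_mono[OF _ add_mono[OF i2 i3] _ i4]) (use B(1) in auto)
      then show ?thesis by (rule add_mono[OF i1 mult_left_mono[OF _ C0]])
    qed
    also have "\<dots> = exp (6 * B) * ?d * (K - 1)"
    proof -
      have "exp (6 * B) = exp (5 * B) * exp B" by (simp add: exp_add[symmetric])
      then show ?thesis by (simp add: K_def algebra_simps)
    qed
    also have "\<dots> \<le> exp (6 * B) * ?d * K" using d by (intro mult_left_mono) auto
    finally have F: "exp (- (2 * B)) * V_norm D (\<lambda>x. u x - us x) \<le> exp (6 * B) * ?d * K" .
    have "V_norm D (\<lambda>x. u x - us x) = exp (2 * B) * (exp (- (2 * B)) * V_norm D (\<lambda>x. u x - us x))"
      by (simp add: exp_minus)
    also have "\<dots> \<le> exp (2 * B) * (exp (6 * B) * ?d * K)" by (rule mult_left_mono[OF F]) simp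
    also have "\<dots> = K * exp (8 * B) * ?d"
    proof -
      have "exp (8 * B) = exp (2 * B) * exp (6 * B)" by (simp add: exp_add[symmetric])
      then show ?thesis by simp
    qed
    finally show ?thesis .
  qed
  show thesis by (rule that[OF K]) (rule main)
qed

end

section \<open>Exponential moments from rotation invariance\<close>

lemma sqrt2_power_ge: "real k + 1 \<le> sqrt 2 ^ k" if "6 \<le> k"
  using that
proof (induction k rule: dec_induct)
  case base
  have "sqrt 2 ^ 6 = ((sqrt 2)\<^sup>2) ^ 3" by (simp only: power_mult[symmetric]) simp
  then show ?case by simp
next
  case (step n)
  have s: "7 / 5 \<le> sqrt 2" by (rule real_le_rsqrt) (simp add: power2_eq_square)
  have "real (Suc n) + 1 \<le> (7 / 5) * (real n + 1)" using step(1) by simp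
  also have "\<dots> \<le> sqrt 2 * sqrt 2 ^ n" using step s by (intro mult_mono) auto
  finally show ?case by simp
qed

text \<open>
  For \<open>k \<ge> 6\<close> the factor \<open>sqrt 2 ^ k - 2\<close> is at least \<open>k - 1\<close>, the number of terms on the right, so a
  geometric bound propagates; \<open>A\<close> is chosen to cover the first few indices.
\<close>

lemma convolution_recursion_bound:
  fixes q :: "nat \<Rightarrow> real"
  assumes q0: "q 0 = 1" and nonneg: "\<And>k. 0 \<le> q k"
    and rec: "\<And>k. 0 < k \<Longrightarrow> q k * (sqrt 2 ^ k - 2) \<le> (\<Sum>j\<in>{1..<k}. q j * q (k - j))"
  obtains A where "1 \<le> A" "\<And>k. q k \<le> A ^ k"
proof
  define A where "A = 1 + (\<Sum>j\<in>{1..5}. q j)"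
  show A1: "1 \<le> A" using nonneg by (simp add: A_def sum_nonneg)
  show "q k \<le> A ^ k" for k
  proof (induction k rule: less_induct)
    case (less k)
    consider "k = 0" | "1 \<le> k" "k \<le> 5" | "6 \<le> k" by linarith
    then show ?case
    proof cases
      case 2
      then have "q k \<le> (\<Sum>j\<in>{1..5}. q j)" using nonneg by (intro member_le_sum) auto
      also have "\<dots> \<le> A ^ 1" by (simp add: A_def)
      also have "\<dots> \<le> A ^ k" using A1 2 by (intro power_increasing) auto
      finally show ?thesis .
    next
      case 3
      have "q k * (real k - 1) \<le> q k * (sqrt 2 ^ k - 2)"
        using sqrt2_power_ge[OF 3] nonneg by (intro mult_left_mono) auto
      also have "\<dots> \<le> (\<Sum>j\<in>{1..<k}. q j * q (k - j))" using rec 3 by simp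
      also have "\<dots> \<le> (\<Sum>j\<in>{1..<k}. A ^ j * A ^ (k - j))"
        using less nonneg A1 by (intro sum_mono mult_mono) auto
      also have "\<dots> = (\<Sum>j\<in>{1..<k}. A ^ k)" by (intro sum.cong) (auto simp: power_add[symmetric])
      also have "\<dots> = A ^ k * (real k - 1)" using 3 by simp
      finally show ?thesis using 3 by (simp add: mult_le_cancel_right)
    qed (use q0 in simp)
  qed
qed

text \<open>
  \<open>r\<close> stands for the norm of a Gaussian random vector and \<open>R\<close> for the rotation of a pair of independent
  copies by 45 degrees (followed by a reflection). The assumption \<open>split\<close> is what remains of homogeneity
  and the triangle inequality.
\<close>

locale rotation_seminorm = prob_space M for M :: "'a measure" +
  fixes r :: "'a \<Rightarrow> real" and R :: "'a \<times> 'a \<Rightarrow> 'a \<times> 'a"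
  assumes r_meas [measurable]: "r \<in> borel_measurable M" and r_nonneg: "\<And>y. 0 \<le> r y"
    and R_meas [measurable]: "R \<in> measurable (M \<Otimes>\<^sub>M M) (M \<Otimes>\<^sub>M M)"
    and R_distr: "distr (M \<Otimes>\<^sub>M M) (M \<Otimes>\<^sub>M M) R = M \<Otimes>\<^sub>M M"
    and split: "AE p in M \<Otimes>\<^sub>M M. r (fst p) \<le> (r (fst (R p)) + r (snd (R p))) / sqrt 2"
begin

lemma nn_integral_prod_mult:
  assumes [measurable]: "f \<in> borel_measurable M" "g \<in> borel_measurable M"
  shows "(\<integral>\<^sup>+p. f (fst p) * g (snd p) \<partial>(M \<Otimes>\<^sub>M M)) = (\<integral>\<^sup>+y. f y \<partial>M) * (\<integral>\<^sup>+y. g y \<partial>M)"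
proof -
  have "(\<integral>\<^sup>+p. f (fst p) * g (snd p) \<partial>(M \<Otimes>\<^sub>M M)) = (\<integral>\<^sup>+x. \<integral>\<^sup>+y. f x * g y \<partial>M \<partial>M)"
    by (subst nn_integral_fst[symmetric]) simp_all
  also have "\<dots> = (\<integral>\<^sup>+y. f y \<partial>M) * (\<integral>\<^sup>+y. g y \<partial>M)"
    by (simp add: nn_integral_cmult nn_integral_multc)
  finally show ?thesis .
qed

text \<open>
  A copy of \<open>r\<close> is dominated by the scaled sum of the two rotated copies, and the rotated pair has the law
  of the original pair.
\<close>

lemma nn_integral_split:
  assumes F: "mono F" "\<And>x. 0 \<le> F x" and [measurable]: "F \<in> borel_measurable borel"
  shows "(\<integral>\<^sup>+y. ennreal (F (r y)) \<partial>M) \<le> (\<integral>\<^sup>+p. ennreal (F ((r (fst p) + r (snd p)) / sqrt 2)) \<partial>(M \<Otimes>\<^sub>M M))"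
proof -
  have "(\<integral>\<^sup>+y. ennreal (F (r y)) \<partial>M) = (\<integral>\<^sup>+p. ennreal (F (r (fst p))) * 1 \<partial>(M \<Otimes>\<^sub>M M))"
    by (subst nn_integral_prod_mult) (simp_all add: emeasure_space_1)
  also have "\<dots> \<le> (\<integral>\<^sup>+p. ennreal (F ((r (fst (R p)) + r (snd (R p))) / sqrt 2)) \<partial>(M \<Otimes>\<^sub>M M))"
    by (intro nn_integral_mono_AE, use split in eventually_elim) (auto intro!: ennreal_leI monoD[OF F(1)])
  also have "\<dots> = (\<integral>\<^sup>+p. ennreal (F ((r (fst p) + r (snd p)) / sqrt 2)) \<partial>distr (M \<Otimes>\<^sub>M M) (M \<Otimes>\<^sub>M M) R)"
    by (subst nn_integral_distr) simp_all
  finally show ?thesis unfolding R_distr .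
qed

definition moment :: "nat \<Rightarrow> ennreal" where "moment k = (\<integral>\<^sup>+y. ennreal (r y ^ k) \<partial>M)"

text \<open>
  The preceding estimate for the \<open>k\<close>-th power, expanded by the binomial theorem; independence factors the
  mixed moments.
\<close>

lemma moment_split: "moment k \<le> ennreal ((1 / sqrt 2) ^ k) * (\<Sum>j\<le>k. of_nat (k choose j) * (moment j * moment (k - j)))"
proof -
  (* The power is monotone only on the nonnegative reals, hence the truncation. *)
  have mono: "mono (\<lambda>x::real. (max x 0) ^ k)" by (intro monoI power_mono) auto
  have "moment k = (\<integral>\<^sup>+y. ennreal ((max (r y) 0) ^ k) \<partial>M)" by (simp add: moment_def r_nonneg max_absorb1)
  also have "\<dots> \<le> (\<integral>\<^sup>+p. ennreal ((max ((r (fst p) + r (snd p)) / sqrt 2) 0) ^ k) \<partial>(M \<Otimes>\<^sub>M M))"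
    by (rule nn_integral_split[OF mono]) auto
  also have "\<dots> = (\<integral>\<^sup>+p. (\<Sum>j\<le>k. ennreal ((1 / sqrt 2) ^ k * real (k choose j)) * (ennreal (r (fst p) ^ j) * ennreal (r (snd p) ^ (k - j)))) \<partial>(M \<Otimes>\<^sub>M M))"
  proof (rule nn_integral_cong)
    fix p
    let ?a = "r (fst p)" and ?b = "r (snd p)"
    have "(max ((?a + ?b) / sqrt 2) 0) ^ k = (1 / sqrt 2) ^ k * (?a + ?b) ^ k"
      using r_nonneg[of "fst p"] r_nonneg[of "snd p"] by (simp add: max_absorb1 power_divide)
    also have "\<dots> = (\<Sum>j\<le>k. ((1 / sqrt 2) ^ k * real (k choose j)) * (?a ^ j * ?b ^ (k - j)))"
      by (simp add: binomial_ring sum_distrib_left mult.assoc)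
    also have "ennreal \<dots> = (\<Sum>j\<le>k. ennreal ((1 / sqrt 2) ^ k * real (k choose j)) * (ennreal (?a ^ j) * ennreal (?b ^ (k - j))))"
      by (subst sum_ennreal[symmetric]) (auto simp: ennreal_mult r_nonneg)
    finally show "ennreal ((max ((?a + ?b) / sqrt 2) 0) ^ k) =
       (\<Sum>j\<le>k. ennreal ((1 / sqrt 2) ^ k * real (k choose j)) * (ennreal (?a ^ j) * ennreal (?b ^ (k - j))))" .
  qed
  also have "\<dots> = (\<Sum>j\<le>k. ennreal ((1 / sqrt 2) ^ k * real (k choose j)) * (moment j * moment (k - j)))"
    unfolding moment_def
    by (subst nn_integral_sum) (simp_all add: nn_integral_cmult nn_integral_prod_mult[symmetric])
  also have "\<dots> = ennreal ((1 / sqrt 2) ^ k) * (\<Sum>j\<le>k. of_nat (k choose j) * (moment j * moment (k - j)))"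
    by (simp add: sum_distrib_left ennreal_mult ennreal_of_nat_eq_real_of_nat mult.assoc)
  finally show ?thesis .
qed

lemma exp_split: "0 \<le> c \<Longrightarrow> (\<integral>\<^sup>+y. ennreal (exp (c * r y)) \<partial>M) \<le> (\<integral>\<^sup>+y. ennreal (exp (c / sqrt 2 * r y)) \<partial>M)\<^sup>2"
proof -
  assume c: "0 \<le> c"
  have "mono (\<lambda>x. exp (c * x))" using c by (intro monoI) (simp add: mult_left_mono)
  then have "(\<integral>\<^sup>+y. ennreal (exp (c * r y)) \<partial>M) \<le> (\<integral>\<^sup>+p. ennreal (exp (c * ((r (fst p) + r (snd p)) / sqrt 2))) \<partial>(M \<Otimes>\<^sub>M M))"
    by (rule nn_integral_split) auto
  also have "\<dots> = (\<integral>\<^sup>+p. ennreal (exp (c / sqrt 2 * r (fst p))) * ennreal (exp (c / sqrt 2 * r (snd p))) \<partial>(M \<Otimes>\<^sub>M M))"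
    by (intro nn_integral_cong) (simp add: ennreal_mult[symmetric] exp_add[symmetric] add_divide_distrib distrib_left)
  also have "\<dots> = (\<integral>\<^sup>+y. ennreal (exp (c / sqrt 2 * r y)) \<partial>M)\<^sup>2"
    by (subst nn_integral_prod_mult) (simp_all add: power2_eq_square)
  finally show ?thesis .
qed

text \<open>
  The moments enter on the right of \<open>moment_split\<close> with the factor \<open>(1 / sqrt 2) ^ k\<close>, and its two extreme
  terms are \<open>moment k\<close> itself. Once all moments are known to be finite, these can be absorbed on the left;
  the remaining recursion bounds \<open>moment k / k!\<close> geometrically. This makes one exponential moment finite, and
  \<open>exp_split\<close> enlarges the exponent by the factor \<open>sqrt 2\<close> as often as needed.
\<close>

lemma exp_moment_finite:
  assumes fin: "\<And>k. moment k < \<infinity>"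
  shows "(\<integral>\<^sup>+y. ennreal (exp (c * r y)) \<partial>M) < \<infinity>"
proof -
  define m where "m k = enn2real (moment k)" for k
  have mm: "moment k = ennreal (m k)" for k using fin[of k] by (simp add: m_def)
  have m0: "m 0 = 1" by (simp add: m_def moment_def emeasure_space_1)
  have m_nonneg: "0 \<le> m k" for k by (simp add: m_def)
  have m_rec: "m k \<le> (1 / sqrt 2) ^ k * (\<Sum>j\<le>k. real (k choose j) * (m j * m (k - j)))" for k
  proof -
    have "ennreal (m k) \<le> ennreal ((1 / sqrt 2) ^ k) * (\<Sum>j\<le>k. of_nat (k choose j) * (ennreal (m j) * ennreal (m (k - j))))"
      using moment_split[of k] unfolding mm .
    also have "(\<Sum>j\<le>k. of_nat (k choose j) * (ennreal (m j) * ennreal (m (k - j)))) =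
        (\<Sum>j\<le>k. ennreal (real (k choose j) * (m j * m (k - j))))"
      by (intro sum.cong refl) (simp add: ennreal_mult m_nonneg ennreal_of_nat_eq_real_of_nat)
    also have "\<dots> = ennreal (\<Sum>j\<le>k. real (k choose j) * (m j * m (k - j)))"
      by (rule sum_ennreal) (simp add: m_nonneg)
    also have "ennreal ((1 / sqrt 2) ^ k) * \<dots> = ennreal ((1 / sqrt 2) ^ k * (\<Sum>j\<le>k. real (k choose j) * (m j * m (k - j))))"
      by (rule ennreal_mult[symmetric]) (auto intro!: sum_nonneg mult_nonneg_nonneg m_nonneg)
    finally have "ennreal (m k) \<le> ennreal ((1 / sqrt 2) ^ k * (\<Sum>j\<le>k. real (k choose j) * (m j * m (k - j))))" .
    moreover have "0 \<le> (1 / sqrt 2) ^ k * (\<Sum>j\<le>k. real (k choose j) * (m j * m (k - j)))"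
      by (intro mult_nonneg_nonneg sum_nonneg m_nonneg) auto
    ultimately show ?thesis using ennreal_le_iff by blast
  qed
  define q where "q k = m k / fact k" for k
  have q_rec: "q k * (sqrt 2 ^ k - 2) \<le> (\<Sum>j\<in>{1..<k}. q j * q (k - j))" if k: "0 < k" for k
  proof -
    have "sqrt 2 ^ k * m k \<le> sqrt 2 ^ k * ((1 / sqrt 2) ^ k * (\<Sum>j\<le>k. real (k choose j) * (m j * m (k - j))))"
      by (intro mult_left_mono m_rec) auto
    then have "sqrt 2 ^ k * m k \<le> (\<Sum>j\<le>k. real (k choose j) * (m j * m (k - j)))"
      by (simp add: power_one_over)
    then have "sqrt 2 ^ k * m k / fact k \<le> (\<Sum>j\<le>k. real (k choose j) * (m j * m (k - j))) / fact k"
      by (rule divide_right_mono) simp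
    also have "\<dots> = (\<Sum>j\<le>k. q j * q (k - j))"
      unfolding sum_divide_distrib
      by (intro sum.cong) (auto simp: q_def binomial_fact field_simps)
    also have "{..k} = insert 0 (insert k {1..<k})" using k by auto
    also have "(\<Sum>j\<in>insert 0 (insert k {1..<k}). q j * q (k - j)) = 2 * q k + (\<Sum>j\<in>{1..<k}. q j * q (k - j))"
      using k by (simp add: q_def m0)
    finally show ?thesis by (simp add: q_def algebra_simps)
  qed
  have q0: "q 0 = 1" and q_nonneg: "\<And>k. 0 \<le> q k" by (simp_all add: q_def m0 m_nonneg)
  obtain A where A: "1 \<le> A" "\<And>k. q k \<le> A ^ k"
    using convolution_recursion_bound[of q, OF q0 q_nonneg q_rec] by blast
  have small: "(\<integral>\<^sup>+y. ennreal (exp (1 / (2 * A) * r y)) \<partial>M) < \<infinity>"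
  proof -
    have "(\<integral>\<^sup>+y. ennreal (exp (1 / (2 * A) * r y)) \<partial>M) = (\<integral>\<^sup>+y. (\<Sum>k. ennreal ((1 / (2 * A)) ^ k / fact k) * ennreal (r y ^ k)) \<partial>M)"
    proof (rule nn_integral_cong)
      fix y
      have "(l * x) ^ k /\<^sub>R fact k = l ^ k / fact k * x ^ k" for l x :: real and k
        by (simp only: power_mult_distrib real_scaleR_def divide_inverse mult_ac)
      then have "(\<lambda>k. (1 / (2 * A)) ^ k / fact k * r y ^ k) sums exp (1 / (2 * A) * r y)"
        using exp_converges[of "1 / (2 * A) * r y"] by (simp only:)
      then have "ennreal (exp (1 / (2 * A) * r y)) = (\<Sum>k. ennreal ((1 / (2 * A)) ^ k / fact k * r y ^ k))"
        using A(1) r_nonneg[of y] by (intro suminf_ennreal_eq[symmetric]) auto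
      moreover have "ennreal ((1 / (2 * A)) ^ k / fact k * r y ^ k) = ennreal ((1 / (2 * A)) ^ k / fact k) * ennreal (r y ^ k)" for k
        using A(1) r_nonneg[of y] by (intro ennreal_mult) auto
      ultimately show "ennreal (exp (1 / (2 * A) * r y)) = (\<Sum>k. ennreal ((1 / (2 * A)) ^ k / fact k) * ennreal (r y ^ k))"
        by (simp only:)
    qed
    also have "\<dots> = (\<Sum>k. ennreal ((1 / (2 * A)) ^ k / fact k) * moment k)"
      by (subst nn_integral_suminf) (simp_all add: nn_integral_cmult moment_def)
    also have "\<dots> \<le> (\<Sum>k. ennreal ((1 / 2) ^ k))"
    proof (intro suminf_le summableI)
      fix k
      have "(1 / (2 * A)) ^ k / fact k * m k = (1 / (2 * A)) ^ k * q k" by (simp add: q_def)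
      also have "\<dots> \<le> (1 / (2 * A)) ^ k * A ^ k" using A by (intro mult_left_mono) auto
      also have "\<dots> = (1 / 2) ^ k" using A(1) by (simp add: power_mult_distrib[symmetric])
      finally show "ennreal ((1 / (2 * A)) ^ k / fact k) * moment k \<le> ennreal ((1 / 2) ^ k)"
        using A(1) m_nonneg[of k] unfolding mm by (subst ennreal_mult[symmetric]) (auto intro: ennreal_leI)
    qed
    also have "\<dots> = ennreal (\<Sum>k. (1 / 2) ^ k)" by (intro suminf_ennreal2 summable_geometric) auto
    also have "\<dots> < \<infinity>" by simp
    finally show ?thesis .
  qed
  have big: "(\<integral>\<^sup>+y. ennreal (exp (sqrt 2 ^ n / (2 * A) * r y)) \<partial>M) < \<infinity>" for n
  proof (induction n)
    case 0 then show ?case using small by simp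
  next
    case (Suc n)
    have "(\<integral>\<^sup>+y. ennreal (exp (sqrt 2 ^ Suc n / (2 * A) * r y)) \<partial>M) \<le> (\<integral>\<^sup>+y. ennreal (exp (sqrt 2 ^ Suc n / (2 * A) / sqrt 2 * r y)) \<partial>M)\<^sup>2"
      using A(1) by (intro exp_split) auto
    also have "sqrt 2 ^ Suc n / (2 * A) / sqrt 2 = sqrt 2 ^ n / (2 * A)" by simp
    also have "(\<integral>\<^sup>+y. ennreal (exp (sqrt 2 ^ n / (2 * A) * r y)) \<partial>M)\<^sup>2 < \<infinity>"
      using Suc by (simp add: power2_eq_square ennreal_mult_less_top)
    finally show ?case .
  qed
  obtain n where n: "2 * A * c < sqrt 2 ^ n"
    using real_arch_pow[of "sqrt 2" "2 * A * c"] by auto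
  have "(\<integral>\<^sup>+y. ennreal (exp (c * r y)) \<partial>M) \<le> (\<integral>\<^sup>+y. ennreal (exp (sqrt 2 ^ n / (2 * A) * r y)) \<partial>M)"
  proof (intro nn_integral_mono ennreal_leI)
    fix y
    have "c \<le> sqrt 2 ^ n / (2 * A)" using n A(1) by (simp add: pos_le_divide_eq mult.commute)
    then show "exp (c * r y) \<le> exp (sqrt 2 ^ n / (2 * A) * r y)"
      unfolding exp_le_cancel_iff by (rule mult_right_mono[OF _ r_nonneg])
  qed
  then show ?thesis using big[of n] by (rule le_less_trans)
qed

end

section \<open>Rotations of the Gaussian product measure\<close>

abbreviation std_normal :: "real measure" where
  "std_normal \<equiv> density lborel std_normal_density"

lemma prob_space_std_normal: "prob_space std_normal"
  by (rule prob_space_normal_density) simp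

text \<open>
  The orthogonal involution of the plane by which a pair of independent Gaussians is mixed.
\<close>

definition rot :: "real \<times> real \<Rightarrow> real \<times> real" where
  "rot p = ((fst p + snd p) / sqrt 2, (fst p - snd p) / sqrt 2)"

lemma rot_measurable [measurable]: "rot \<in> borel_measurable (borel \<Otimes>\<^sub>M borel)"
  unfolding rot_def[abs_def] borel_prod[symmetric] by measurable

lemma nn_integral_std_normal_pair:
  assumes [measurable]: "h \<in> borel_measurable (borel \<Otimes>\<^sub>M borel)"
  shows "(\<integral>\<^sup>+p. h p \<partial>(std_normal \<Otimes>\<^sub>M std_normal)) =
     (\<integral>\<^sup>+x. \<integral>\<^sup>+y. ennreal (std_normal_density x * std_normal_density y) * h (x, y) \<partial>lborel \<partial>lborel)"
proof -
  interpret N: prob_space std_normal by (rule prob_space_std_normal)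
  have s: "sets (std_normal \<Otimes>\<^sub>M std_normal) = sets (borel \<Otimes>\<^sub>M borel)"
    by (intro sets_pair_measure_cong) auto
  have m: "h \<in> borel_measurable (std_normal \<Otimes>\<^sub>M std_normal)"
    using assms measurable_cong_sets[OF s refl] by blast
  have "(\<integral>\<^sup>+p. h p \<partial>(std_normal \<Otimes>\<^sub>M std_normal)) = (\<integral>\<^sup>+x. \<integral>\<^sup>+y. h (x, y) \<partial>std_normal \<partial>std_normal)"
    by (rule N.nn_integral_fst[OF m, symmetric])
  also have "\<dots> = (\<integral>\<^sup>+x. \<integral>\<^sup>+y. ennreal (std_normal_density y) * h (x, y) \<partial>lborel \<partial>std_normal)"
    by (intro nn_integral_cong nn_integral_density) auto
  also have "\<dots> = (\<integral>\<^sup>+x. ennreal (std_normal_density x) * (\<integral>\<^sup>+y. ennreal (std_normal_density y) * h (x, y) \<partial>lborel) \<partial>lborel)"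
    by (subst nn_integral_density) (auto intro!: lborel.borel_measurable_nn_integral)
  also have "\<dots> = (\<integral>\<^sup>+x. \<integral>\<^sup>+y. ennreal (std_normal_density x * std_normal_density y) * h (x, y) \<partial>lborel \<partial>lborel)"
    by (intro nn_integral_cong) (simp add: nn_integral_cmult[symmetric] ennreal_mult mult.assoc)
  finally show ?thesis .
qed

lemma std_normal_density_rot:
  "std_normal_density ((u + v) / sqrt 2) * std_normal_density ((u - v) / sqrt 2) =
     std_normal_density u * std_normal_density v"
proof -
  have "- ((u + v) / sqrt 2)\<^sup>2 / 2 + - ((u - v) / sqrt 2)\<^sup>2 / 2 = - u\<^sup>2 / 2 + - v\<^sup>2 / 2"
    by (simp add: power_divide power2_sum power2_diff field_simps)
  then have "exp (- ((u + v) / sqrt 2)\<^sup>2 / 2) * exp (- ((u - v) / sqrt 2)\<^sup>2 / 2) = exp (- u\<^sup>2 / 2) * exp (- v\<^sup>2 / 2)"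
    by (simp only: exp_add[symmetric])
  then show ?thesis by (simp add: normal_density_def)
qed

text \<open>
  Two linear substitutions in one variable each, with an exchange of the order of integration in between.
  Their Jacobians \<open>sqrt 2\<close> and \<open>1 / sqrt 2\<close> cancel, and the product of the densities depends on the Euclidean
  norm only.
\<close>

lemma nn_integral_std_normal_rot:
  assumes [measurable]: "h \<in> borel_measurable (borel \<Otimes>\<^sub>M borel)"
  shows "(\<integral>\<^sup>+p. h (rot p) \<partial>(std_normal \<Otimes>\<^sub>M std_normal)) = (\<integral>\<^sup>+p. h p \<partial>(std_normal \<Otimes>\<^sub>M std_normal))"
proof -
  have [measurable]: "rot \<in> (borel \<Otimes>\<^sub>M borel) \<rightarrow>\<^sub>M (borel \<Otimes>\<^sub>M borel)" using rot_measurable by (simp add: borel_prod)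
  define G where "G x y = ennreal (std_normal_density x * std_normal_density y) * h (rot (x, y))" for x y
  have [measurable]: "(\<lambda>(x, y). G x y) \<in> borel_measurable (borel \<Otimes>\<^sub>M borel)" unfolding G_def by measurable
  have "(\<integral>\<^sup>+p. h (rot p) \<partial>(std_normal \<Otimes>\<^sub>M std_normal)) = (\<integral>\<^sup>+x. \<integral>\<^sup>+y. G x y \<partial>lborel \<partial>lborel)"
    unfolding G_def by (rule nn_integral_std_normal_pair) measurable
  also have "\<dots> = (\<integral>\<^sup>+x. \<integral>\<^sup>+u. ennreal (sqrt 2) * G x (- x + sqrt 2 * u) \<partial>lborel \<partial>lborel)"
  proof (rule nn_integral_cong)
    fix x
    have "(\<integral>\<^sup>+y. G x y \<partial>lborel) = ennreal \<bar>sqrt 2\<bar> * (\<integral>\<^sup>+u. G x (- x + sqrt 2 * u) \<partial>lborel)"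
      by (rule nn_integral_real_affine) auto
    then show "(\<integral>\<^sup>+y. G x y \<partial>lborel) = (\<integral>\<^sup>+u. ennreal (sqrt 2) * G x (- x + sqrt 2 * u) \<partial>lborel)"
      by (simp add: nn_integral_cmult)
  qed
  also have "\<dots> = (\<integral>\<^sup>+u. \<integral>\<^sup>+x. ennreal (sqrt 2) * G x (- x + sqrt 2 * u) \<partial>lborel \<partial>lborel)"
    by (rule lborel_pair.Fubini'[symmetric]) measurable
  also have "\<dots> = (\<integral>\<^sup>+u. \<integral>\<^sup>+v. G ((u + v) / sqrt 2) ((u - v) / sqrt 2) \<partial>lborel \<partial>lborel)"
  proof (rule nn_integral_cong)
    fix u
    have "(\<integral>\<^sup>+x. ennreal (sqrt 2) * G x (- x + sqrt 2 * u) \<partial>lborel) =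
       ennreal \<bar>1 / sqrt 2\<bar> * (\<integral>\<^sup>+v. ennreal (sqrt 2) * G (u / sqrt 2 + 1 / sqrt 2 * v) (- (u / sqrt 2 + 1 / sqrt 2 * v) + sqrt 2 * u) \<partial>lborel)"
      by (rule nn_integral_real_affine) auto
    also have "\<dots> = (\<integral>\<^sup>+v. ennreal \<bar>1 / sqrt 2\<bar> * (ennreal (sqrt 2) * G (u / sqrt 2 + 1 / sqrt 2 * v) (- (u / sqrt 2 + 1 / sqrt 2 * v) + sqrt 2 * u)) \<partial>lborel)"
      by (rule nn_integral_cmult[symmetric]) measurable
    also have "\<dots> = (\<integral>\<^sup>+v. G ((u + v) / sqrt 2) ((u - v) / sqrt 2) \<partial>lborel)"
    proof (rule nn_integral_cong)
      fix v
      have 1: "ennreal \<bar>1 / sqrt 2\<bar> * ennreal (sqrt 2) = 1" by (simp add: ennreal_mult[symmetric])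
      have "sqrt 2 * u = 2 * (u / sqrt 2)" by (simp add: real_div_sqrt field_simps)
      then have 2: "- ((u + v) / sqrt 2) + sqrt 2 * u = (u - v) / sqrt 2"
        by (simp add: add_divide_distrib diff_divide_distrib)
      have 3: "u / sqrt 2 + 1 / sqrt 2 * v = (u + v) / sqrt 2" by (simp add: add_divide_distrib)
      show "ennreal \<bar>1 / sqrt 2\<bar> * (ennreal (sqrt 2) * G (u / sqrt 2 + 1 / sqrt 2 * v) (- (u / sqrt 2 + 1 / sqrt 2 * v) + sqrt 2 * u)) =
          G ((u + v) / sqrt 2) ((u - v) / sqrt 2)"
        unfolding 3 2 mult.assoc[symmetric] 1 by simp
    qed
    finally show "(\<integral>\<^sup>+x. ennreal (sqrt 2) * G x (- x + sqrt 2 * u) \<partial>lborel) = (\<integral>\<^sup>+v. G ((u + v) / sqrt 2) ((u - v) / sqrt 2) \<partial>lborel)" .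
  qed
  also have "\<dots> = (\<integral>\<^sup>+u. \<integral>\<^sup>+v. ennreal (std_normal_density u * std_normal_density v) * h (u, v) \<partial>lborel \<partial>lborel)"
  proof (intro nn_integral_cong)
    fix u v :: real
    have "rot ((u + v) / sqrt 2, (u - v) / sqrt 2) = (u, v)"
      by (simp add: rot_def add_divide_distrib diff_divide_distrib)
    then show "G ((u + v) / sqrt 2) ((u - v) / sqrt 2) = ennreal (std_normal_density u * std_normal_density v) * h (u, v)"
      by (simp add: G_def std_normal_density_rot)
  qed
  also have "\<dots> = (\<integral>\<^sup>+p. h p \<partial>(std_normal \<Otimes>\<^sub>M std_normal))"
    by (rule nn_integral_std_normal_pair[symmetric]) measurable
  finally show ?thesis .
qed

abbreviation std_normal2 :: "(real \<times> real) measure" where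
  "std_normal2 \<equiv> std_normal \<Otimes>\<^sub>M std_normal"

lemma sets_std_normal2: "sets std_normal2 = sets (borel \<Otimes>\<^sub>M borel)"
  by (intro sets_pair_measure_cong) auto

lemma prob_space_std_normal2: "prob_space std_normal2"
  by (intro prob_space_pair prob_space_std_normal)

lemma rot_measurable2 [measurable]: "rot \<in> std_normal2 \<rightarrow>\<^sub>M std_normal2"
  using rot_measurable measurable_cong_sets[OF sets_std_normal2 sets_std_normal2] by (simp add: borel_prod)

lemma distr_rot: "distr std_normal2 std_normal2 rot = std_normal2"
proof (rule measure_eqI)
  fix A assume "A \<in> sets (distr std_normal2 std_normal2 rot)"
  then have A: "A \<in> sets std_normal2" by simp
  have "emeasure (distr std_normal2 std_normal2 rot) A = (\<integral>\<^sup>+p. indicator A p \<partial>distr std_normal2 std_normal2 rot)"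
    using A by simp
  also have "\<dots> = (\<integral>\<^sup>+p. indicator A (rot p) \<partial>std_normal2)"
    using A by (subst nn_integral_distr) auto
  also have "\<dots> = (\<integral>\<^sup>+p. indicator A p \<partial>std_normal2)"
    using A by (intro nn_integral_std_normal_rot) (simp add: sets_std_normal2)
  finally show "emeasure (distr std_normal2 std_normal2 rot) A = emeasure std_normal2 A" using A by simp
qed simp

abbreviation gauss2 :: "(nat \<Rightarrow> real \<times> real) measure" where
  "gauss2 \<equiv> PiM UNIV (\<lambda>_. std_normal2)"

interpretation gauss: product_prob_space "\<lambda>_::nat. std_normal" UNIV
  by (intro product_prob_spaceI prob_space_std_normal)

interpretation gauss2: product_prob_space "\<lambda>_::nat. std_normal2" UNIV
  by (intro product_prob_spaceI prob_space_std_normal2)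

lemma prob_space_gauss: "prob_space gauss"
  unfolding gauss_def by (rule gauss.P.prob_space_axioms)

lemma space_gauss: "space gauss = UNIV"
  by (simp add: gauss_def space_PiM)

lemma gauss_component [measurable]: "(\<lambda>y. y i) \<in> gauss \<rightarrow>\<^sub>M std_normal"
  unfolding gauss_def by (rule measurable_component_singleton) simp

lemma nn_integral_gauss_prod:
  assumes J: "finite J" and g: "\<And>j. j \<in> J \<Longrightarrow> g j \<in> borel_measurable std_normal"
  shows "(\<integral>\<^sup>+y. (\<Prod>j\<in>J. g j (y j)) \<partial>gauss) = (\<Prod>j\<in>J. \<integral>\<^sup>+t. g j t \<partial>std_normal)"
proof -
  have "(\<integral>\<^sup>+y. (\<Prod>j\<in>J. g j (y j)) \<partial>gauss) = (\<integral>\<^sup>+y. (\<Prod>j\<in>J. g j (restrict y J j)) \<partial>gauss)"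
    by (intro nn_integral_cong prod.cong) auto
  also have "\<dots> = (\<integral>\<^sup>+y. (\<Prod>j\<in>J. g j (y j)) \<partial>distr gauss (PiM J (\<lambda>_. std_normal)) (\<lambda>y. restrict y J))"
  proof -
    have r: "(\<lambda>y. restrict y J) \<in> gauss \<rightarrow>\<^sub>M PiM J (\<lambda>_. std_normal)"
      unfolding gauss_def by (rule measurable_restrict_subset) simp
    have "(\<lambda>y. \<Prod>j\<in>J. g j (y j)) \<in> borel_measurable (PiM J (\<lambda>_. std_normal))"
    proof (rule borel_measurable_prod_ennreal)
      fix j assume j: "j \<in> J"
      have "(\<lambda>y. y j) \<in> PiM J (\<lambda>_. std_normal) \<rightarrow>\<^sub>M std_normal" using j by (rule measurable_component_singleton)
      from measurable_compose[OF this g[OF j]]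
      show "(\<lambda>y. g j (y j)) \<in> borel_measurable (PiM J (\<lambda>_. std_normal))" .
    qed
    then show ?thesis by (intro nn_integral_distr[symmetric] r) simp
  qed
  also have "distr gauss (PiM J (\<lambda>_. std_normal)) (\<lambda>y. restrict y J) = PiM J (\<lambda>_. std_normal)"
    unfolding gauss_def by (rule gauss.distr_PiM_restrict_finite[OF J]) simp
  also have "(\<integral>\<^sup>+y. (\<Prod>j\<in>J. g j (y j)) \<partial>PiM J (\<lambda>_. std_normal)) = (\<Prod>j\<in>J. \<integral>\<^sup>+t. g j t \<partial>std_normal)"
    by (rule gauss.product_nn_integral_prod[OF J g])
  finally show ?thesis .
qed

text \<open>
  A pair of sequences seen as a sequence of pairs. In this form the rotation acts on each coordinate
  separately, and a product measure is invariant as soon as every factor is.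
\<close>

definition interleave :: "(nat \<Rightarrow> real) \<times> (nat \<Rightarrow> real) \<Rightarrow> nat \<Rightarrow> real \<times> real" where
  "interleave p i = (fst p i, snd p i)"

lemma interleave_measurable [measurable]: "interleave \<in> gauss \<Otimes>\<^sub>M gauss \<rightarrow>\<^sub>M gauss2"
  unfolding interleave_def[abs_def]
  by (rule measurable_PiM_single') (auto simp: space_pair_measure space_PiM intro!: measurable_Pair measurable_compose[OF _ gauss_component])

text \<open>
  On cylinder sets, Fubini's theorem and the product formula for integrals over finitely many coordinates
  reduce the claim to the definition of the product measure in the plane.
\<close>

lemma distr_interleave: "distr (gauss \<Otimes>\<^sub>M gauss) gauss2 interleave = gauss2"
proof (rule gauss2.PiM_eq)
  interpret G: prob_space gauss by (rule prob_space_gauss)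
  have sf: "sigma_finite_measure std_normal"
    by (rule prob_space_imp_sigma_finite[OF prob_space_std_normal])
  fix J :: "nat set" and F assume J: "finite J" and F: "\<And>j. j \<in> J \<Longrightarrow> F j \<in> sets std_normal2"
  let ?X = "prod_emb UNIV (\<lambda>_. std_normal2) J (Pi\<^sub>E J F)"
  have X: "?X \<in> sets gauss2" using J F by (intro sets_PiM_I) auto
  have ind: "indicator ?X (interleave p) = (\<Prod>j\<in>J. indicator (F j) (fst p j, snd p j) :: ennreal)" for p
  proof -
    have "interleave p \<in> ?X \<longleftrightarrow> (\<forall>j\<in>J. (fst p j, snd p j) \<in> F j)"
      by (auto simp: prod_emb_def interleave_def space_pair_measure PiE_iff)
    then show ?thesis using J by (auto simp: indicator_def prod_zero_iff)
  qed
  have mF: "(\<lambda>t. indicator (F j) t :: ennreal) \<in> borel_measurable std_normal2" if "j \<in> J" for j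
    using F[OF that] by simp
  have mFj: "(\<lambda>p. indicator (F j) (fst p j, snd p j) :: ennreal) \<in> borel_measurable (gauss \<Otimes>\<^sub>M gauss)" if "j \<in> J" for j
    by (rule measurable_compose[OF _ mF[OF that]]) measurable
  have "emeasure (distr (gauss \<Otimes>\<^sub>M gauss) gauss2 interleave) ?X = (\<integral>\<^sup>+p. indicator ?X p \<partial>distr (gauss \<Otimes>\<^sub>M gauss) gauss2 interleave)"
    using X by simp
  also have "\<dots> = (\<integral>\<^sup>+p. indicator ?X (interleave p) \<partial>(gauss \<Otimes>\<^sub>M gauss))"
    using X by (subst nn_integral_distr) auto
  also have "\<dots> = (\<integral>\<^sup>+y. \<integral>\<^sup>+z. (\<Prod>j\<in>J. indicator (F j) (y j, z j)) \<partial>gauss \<partial>gauss)"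
    unfolding ind by (subst G.nn_integral_fst[symmetric]) (auto intro!: borel_measurable_prod_ennreal mFj)
  also have "\<dots> = (\<integral>\<^sup>+y. (\<Prod>j\<in>J. \<integral>\<^sup>+t. indicator (F j) (y j, t) \<partial>std_normal) \<partial>gauss)"
  proof (intro nn_integral_cong nn_integral_gauss_prod J)
    fix s :: "nat \<Rightarrow> real" and j assume "j \<in> J"
    have "Pair (s j) \<in> std_normal \<rightarrow>\<^sub>M std_normal2" by (rule measurable_Pair1') simp
    from measurable_compose[OF this mF[OF \<open>j \<in> J\<close>]]
    show "(\<lambda>t. indicator (F j) (s j, t) :: ennreal) \<in> borel_measurable std_normal" .
  qed
  also have "\<dots> = (\<Prod>j\<in>J. \<integral>\<^sup>+s. \<integral>\<^sup>+t. indicator (F j) (s, t) \<partial>std_normal \<partial>std_normal)"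
    by (intro nn_integral_gauss_prod J sigma_finite_measure.borel_measurable_nn_integral[OF sf])
       (use mF in simp)
  also have "\<dots> = (\<Prod>j\<in>J. emeasure std_normal2 (F j))"
    using F mF by (intro prod.cong refl) (subst sigma_finite_measure.nn_integral_fst[OF sf], auto)
  finally show "emeasure (distr (gauss \<Otimes>\<^sub>M gauss) gauss2 interleave) ?X = (\<Prod>j\<in>J. emeasure std_normal2 (F j))" .
qed simp

lemma rot_components_measurable: "(\<lambda>\<omega> i. rot (\<omega> i)) \<in> gauss2 \<rightarrow>\<^sub>M gauss2"
proof (rule measurable_PiM_single')
  fix i :: nat
  have "(\<lambda>\<omega>. \<omega> i) \<in> gauss2 \<rightarrow>\<^sub>M std_normal2" by (rule measurable_component_singleton) simp
  from measurable_compose[OF this rot_measurable2]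
  show "(\<lambda>\<omega>. rot (\<omega> i)) \<in> gauss2 \<rightarrow>\<^sub>M std_normal2" .
qed (auto simp: space_PiM space_pair_measure)

lemma distr_gauss2_rot: "distr gauss2 gauss2 (\<lambda>\<omega> i. rot (\<omega> i)) = gauss2"
proof (rule gauss2.PiM_eq)
  note m = rot_components_measurable
  fix J :: "nat set" and F assume J: "finite J" and F: "\<And>j. j \<in> J \<Longrightarrow> F j \<in> sets std_normal2"
  let ?X = "prod_emb UNIV (\<lambda>_. std_normal2) J (Pi\<^sub>E J F)"
  let ?Y = "prod_emb UNIV (\<lambda>_. std_normal2) J (Pi\<^sub>E J (\<lambda>j. rot -` F j))"
  have X: "?X \<in> sets gauss2" using J F by (intro sets_PiM_I) auto
  have Fr: "rot -` F j \<in> sets std_normal2" if "j \<in> J" for j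
    using measurable_sets[OF rot_measurable2 F[OF that]] by (simp add: space_pair_measure)
  have "emeasure (distr gauss2 gauss2 (\<lambda>\<omega> i. rot (\<omega> i))) ?X = emeasure gauss2 ((\<lambda>\<omega> i. rot (\<omega> i)) -` ?X \<inter> space gauss2)"
    by (rule emeasure_distr[OF m X])
  also have "(\<lambda>\<omega> i. rot (\<omega> i)) -` ?X \<inter> space gauss2 = ?Y"
    by (auto simp: prod_emb_def space_PiM space_pair_measure PiE_iff)
  also have "emeasure gauss2 ?Y = (\<Prod>j\<in>J. emeasure std_normal2 (rot -` F j))"
    by (rule gauss2.emeasure_PiM_emb) (use J Fr in auto)
  also have "\<dots> = (\<Prod>j\<in>J. emeasure std_normal2 (F j))"
  proof (intro prod.cong refl)
    fix j assume "j \<in> J"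
    then show "emeasure std_normal2 (rot -` F j) = emeasure std_normal2 (F j)"
      using emeasure_distr[OF rot_measurable2 F[of j]] by (simp add: distr_rot space_pair_measure)
  qed
  finally show "emeasure (distr gauss2 gauss2 (\<lambda>\<omega> i. rot (\<omega> i))) ?X = (\<Prod>j\<in>J. emeasure std_normal2 (F j))" .
qed simp

definition rotate_pair :: "(nat \<Rightarrow> real) \<times> (nat \<Rightarrow> real) \<Rightarrow> (nat \<Rightarrow> real) \<times> (nat \<Rightarrow> real)" where
  "rotate_pair p = ((\<lambda>i. (fst p i + snd p i) / sqrt 2), (\<lambda>i. (fst p i - snd p i) / sqrt 2))"

text \<open>
  Interleave, rotate every coordinate, separate again; each step preserves the measures in question.
\<close>

lemma rotate_pair_distr:
  shows "rotate_pair \<in> gauss \<Otimes>\<^sub>M gauss \<rightarrow>\<^sub>M gauss \<Otimes>\<^sub>M gauss"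
    and "distr (gauss \<Otimes>\<^sub>M gauss) (gauss \<Otimes>\<^sub>M gauss) rotate_pair = gauss \<Otimes>\<^sub>M gauss"
proof -
  let ?G = "gauss \<Otimes>\<^sub>M gauss" and ?r = "\<lambda>(\<omega> :: nat \<Rightarrow> real \<times> real) i. rot (\<omega> i)"
  define sep where "sep \<omega> = ((\<lambda>i. fst (\<omega> i)), (\<lambda>i. snd (\<omega> i)))" for \<omega> :: "nat \<Rightarrow> real \<times> real"
  note mr = rot_components_measurable
  have comp: "(\<lambda>\<omega>. \<omega> i) \<in> gauss2 \<rightarrow>\<^sub>M std_normal2" for i :: nat
    by (rule measurable_component_singleton) simp
  have ms: "sep \<in> gauss2 \<rightarrow>\<^sub>M ?G"
    unfolding sep_def[abs_def] gauss_def
    by (intro measurable_Pair measurable_PiM_single' measurable_compose[OF comp measurable_fst]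
        measurable_compose[OF comp measurable_snd]) auto
  have e: "rotate_pair = sep \<circ> (?r \<circ> interleave)"
    by (auto simp: fun_eq_iff rotate_pair_def sep_def rot_def interleave_def)
  have mri: "?r \<circ> interleave \<in> ?G \<rightarrow>\<^sub>M gauss2" using interleave_measurable mr by (rule measurable_comp)
  show "rotate_pair \<in> ?G \<rightarrow>\<^sub>M ?G" unfolding e using mri ms by (rule measurable_comp)
  have "distr ?G ?G rotate_pair = distr (distr ?G gauss2 (?r \<circ> interleave)) ?G sep"
    unfolding e by (rule distr_distr[OF ms mri, symmetric])
  also have "distr ?G gauss2 (?r \<circ> interleave) = gauss2"
    unfolding distr_distr[OF mr interleave_measurable, symmetric] distr_interleave distr_gauss2_rot ..
  also have "distr gauss2 ?G sep = distr (distr ?G gauss2 interleave) ?G sep" by (simp only: distr_interleave)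
  also have "\<dots> = distr ?G ?G (sep \<circ> interleave)" by (rule distr_distr[OF ms interleave_measurable])
  also have "sep \<circ> interleave = (\<lambda>p. p)" by (auto simp: fun_eq_iff sep_def interleave_def)
  also have "distr ?G ?G (\<lambda>p. p) = ?G" by (rule distr_id)
  finally show "distr ?G ?G rotate_pair = ?G" .
qed

lemma AE_gauss_pair:
  assumes "AE y in gauss. P y"
  shows "AE p in gauss \<Otimes>\<^sub>M gauss. P (fst p)"
    "AE p in gauss \<Otimes>\<^sub>M gauss. P (fst (rotate_pair p))" "AE p in gauss \<Otimes>\<^sub>M gauss. P (snd (rotate_pair p))"
proof -
  interpret G: prob_space gauss by (rule prob_space_gauss)
  interpret GG: pair_prob_space gauss gauss ..
  show f: "AE p in gauss \<Otimes>\<^sub>M gauss. P (fst p)"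
    by (rule AE_distrD[OF measurable_fst]) (subst G.distr_pair_fst, rule assms)
  have "distr (gauss \<Otimes>\<^sub>M gauss) gauss snd = gauss"
  proof (rule measure_eqI)
    fix A assume A: "A \<in> sets (distr (gauss \<Otimes>\<^sub>M gauss) gauss snd)"
    then have "emeasure (distr (gauss \<Otimes>\<^sub>M gauss) gauss snd) A = emeasure (gauss \<Otimes>\<^sub>M gauss) (UNIV \<times> A)"
      by (subst emeasure_distr) (auto simp: space_pair_measure space_gauss intro!: arg_cong2[where f = emeasure])
    also have "\<dots> = emeasure gauss UNIV * emeasure gauss A"
      using A sets.top[of gauss] by (intro G.emeasure_pair_measure_Times) (auto simp: space_gauss)
    finally show "emeasure (distr (gauss \<Otimes>\<^sub>M gauss) gauss snd) A = emeasure gauss A"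
      using G.emeasure_space_1 by (simp add: space_gauss)
  qed simp
  then have s: "AE p in gauss \<Otimes>\<^sub>M gauss. P (snd p)"
    by (intro AE_distrD[OF measurable_snd]) (simp only: assms)
  show "AE p in gauss \<Otimes>\<^sub>M gauss. P (fst (rotate_pair p))"
    by (rule AE_distrD[OF rotate_pair_distr(1)]) (simp only: rotate_pair_distr(2) f)
  show "AE p in gauss \<Otimes>\<^sub>M gauss. P (snd (rotate_pair p))"
    by (rule AE_distrD[OF rotate_pair_distr(1)]) (simp only: rotate_pair_distr(2) s)
qed

section \<open>The Hoelder norm of the random field\<close>

text \<open>
  The Hoelder norm with the suprema taken over a subset \<open>X\<close> only. For a countable dense \<open>X\<close> it is
  a measurable function of the random parameter, and for continuous functions it still controls all of
  \<open>D\<close>.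
\<close>

definition holder_norm_on :: "'a::euclidean_space set \<Rightarrow> real \<Rightarrow> ('a \<Rightarrow> real) \<Rightarrow> ennreal" where
  "holder_norm_on X \<alpha> v = (SUP x\<in>X. ennreal \<bar>v x\<bar>) +
     (SUP (x1, x2)\<in>{(x1, x2). x1 \<in> X \<and> x2 \<in> X \<and> x1 \<noteq> x2}. ennreal (\<bar>v x1 - v x2\<bar> / norm (x1 - x2) powr \<alpha>))"

lemma holder_norm_onD:
  assumes fin: "holder_norm_on X \<alpha> v < \<infinity>"
  shows "\<And>x. x \<in> X \<Longrightarrow> \<bar>v x\<bar> \<le> enn2real (holder_norm_on X \<alpha> v)"
    and "\<And>x y. x \<in> X \<Longrightarrow> y \<in> X \<Longrightarrow> \<bar>v x - v y\<bar> \<le> enn2real (holder_norm_on X \<alpha> v) * norm (x - y) powr \<alpha>"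
proof -
  let ?h = "enn2real (holder_norm_on X \<alpha> v)"
  have h: "holder_norm_on X \<alpha> v = ennreal ?h" using fin by simp
  show "\<bar>v x\<bar> \<le> ?h" if "x \<in> X" for x
  proof -
    have "ennreal \<bar>v x\<bar> \<le> (SUP x\<in>X. ennreal \<bar>v x\<bar>)" by (rule SUP_upper[OF that])
    also have "\<dots> \<le> holder_norm_on X \<alpha> v" unfolding holder_norm_on_def by simp
    finally have "ennreal \<bar>v x\<bar> \<le> ennreal ?h" unfolding h[symmetric] .
    then show ?thesis by simp
  qed
  show "\<bar>v x - v y\<bar> \<le> ?h * norm (x - y) powr \<alpha>" if "x \<in> X" "y \<in> X" for x y
  proof (cases "x = y")
    case False
    let ?P = "{(x1, x2). x1 \<in> X \<and> x2 \<in> X \<and> x1 \<noteq> x2}"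
    have "ennreal (\<bar>v x - v y\<bar> / norm (x - y) powr \<alpha>) \<le> (SUP (x1, x2)\<in>?P. ennreal (\<bar>v x1 - v x2\<bar> / norm (x1 - x2) powr \<alpha>))"
      by (rule SUP_upper2[of "(x, y)"]) (use that False in auto)
    also have "\<dots> \<le> holder_norm_on X \<alpha> v" unfolding holder_norm_on_def by simp
    finally have "ennreal (\<bar>v x - v y\<bar> / norm (x - y) powr \<alpha>) \<le> ennreal ?h" unfolding h[symmetric] .
    then have "\<bar>v x - v y\<bar> / norm (x - y) powr \<alpha> \<le> ?h" by simp
    then show ?thesis using False by (simp add: pos_divide_le_eq)
  qed simp
qed

lemma holder_dense_extend:
  fixes v :: "'a::euclidean_space \<Rightarrow> real"
  assumes X: "X \<subseteq> D" "D \<subseteq> closure X" and c: "continuous_on D v" and \<alpha>: "0 < \<alpha>"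
    and b: "\<And>x. x \<in> X \<Longrightarrow> \<bar>v x\<bar> \<le> h"
    and l: "\<And>x y. x \<in> X \<Longrightarrow> y \<in> X \<Longrightarrow> \<bar>v x - v y\<bar> \<le> h * norm (x - y) powr \<alpha>"
  shows "\<And>x. x \<in> D \<Longrightarrow> \<bar>v x\<bar> \<le> h"
    and "\<And>x y. x \<in> D \<Longrightarrow> y \<in> D \<Longrightarrow> \<bar>v x - v y\<bar> \<le> h * norm (x - y) powr \<alpha>"
proof -
  have seq: "\<exists>s. (\<forall>n. s n \<in> X) \<and> s \<longlonglongrightarrow> x \<and> (\<lambda>n. v (s n)) \<longlonglongrightarrow> v x" if x: "x \<in> D" for x
  proof -
    obtain s where s: "\<forall>n. s n \<in> X" "s \<longlonglongrightarrow> x" using x X(2) closure_sequential by blast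
    have "(\<lambda>n. v (s n)) \<longlonglongrightarrow> v x"
      by (rule continuous_on_tendsto_compose[OF c s(2) x]) (use s(1) X(1) in \<open>auto intro!: always_eventually\<close>)
    then show ?thesis using s by blast
  qed
  show "\<bar>v x\<bar> \<le> h" if x: "x \<in> D" for x
  proof -
    obtain s where s: "\<And>n. s n \<in> X" "(\<lambda>n. v (s n)) \<longlonglongrightarrow> v x" using seq[OF x] by blast
    show ?thesis by (rule LIMSEQ_le_const2[OF tendsto_rabs[OF s(2)]]) (use b s(1) in blast)
  qed
  show "\<bar>v x - v y\<bar> \<le> h * norm (x - y) powr \<alpha>" if x: "x \<in> D" and y: "y \<in> D" for x y
  proof -
    obtain s where s: "\<And>n. s n \<in> X" "s \<longlonglongrightarrow> x" "(\<lambda>n. v (s n)) \<longlonglongrightarrow> v x" using seq[OF x] by blast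
    obtain t where t: "\<And>n. t n \<in> X" "t \<longlonglongrightarrow> y" "(\<lambda>n. v (t n)) \<longlonglongrightarrow> v y" using seq[OF y] by blast
    have l1: "(\<lambda>n. \<bar>v (s n) - v (t n)\<bar>) \<longlonglongrightarrow> \<bar>v x - v y\<bar>" by (intro tendsto_intros s t)
    have l2: "(\<lambda>n. h * norm (s n - t n) powr \<alpha>) \<longlonglongrightarrow> h * norm (x - y) powr \<alpha>"
      using \<alpha> by (intro tendsto_intros tendsto_powr2 s t) auto
    show ?thesis by (rule LIMSEQ_le[OF l1 l2]) (use l s(1) t(1) in blast)
  qed
qed

context bounded_open begin

text \<open>
  A continuous function exceeding its essential supremum somewhere would do so on a nonempty open set,
  which is not negligible.
\<close>

lemma continuous_le_Linf_norm:
  assumes c: "continuous_on D v" and x: "x \<in> D"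
  shows "ereal \<bar>v x\<bar> \<le> Linf_norm D v"
proof (rule ccontr)
  assume n: "\<not> ereal \<bar>v x\<bar> \<le> Linf_norm D v"
  let ?U = "{y \<in> D. ereal \<bar>v y\<bar> \<in> {Linf_norm D v <..}}"
  have "continuous_on D (\<lambda>y. ereal \<bar>v y\<bar>)" by (intro continuous_on_ereal continuous_intros c)
  then have "\<forall>B. open B \<longrightarrow> open {y \<in> D. ereal \<bar>v y\<bar> \<in> B}"
    using continuous_on_open_vimage[OF open_D, of "\<lambda>y. ereal \<bar>v y\<bar>"]
    by (auto simp: vimage_def Int_def conj_commute)
  then have op: "open ?U" using open_greaterThan by blast
  have "AE y in lebesgue_on D. ereal \<bar>v y\<bar> \<le> Linf_norm D v" unfolding Linf_norm_def by (rule esssup_AE)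
  then have "AE y in lebesgue. y \<in> D \<longrightarrow> ereal \<bar>v y\<bar> \<le> Linf_norm D v" by (subst (asm) AE_restrict_space_iff) auto
  then have "AE y in lebesgue. y \<notin> ?U" by eventually_elim auto
  moreover have "?U \<in> sets lebesgue" using op by (simp add: borel_open)
  ultimately have "?U \<in> null_sets lebesgue" by (subst AE_iff_null_sets) auto
  then have "negligible ?U" by (simp add: negligible_iff_null_sets)
  moreover have "?U \<noteq> {}" using n x by (auto simp: not_le)
  ultimately show False using open_not_negligible[OF op] by blast
qed

lemma holder_spaceD:
  assumes v: "v \<in> holder_space D \<alpha>" and \<alpha>: "0 < \<alpha>"
  shows "continuous_on D v" "v \<in> Linf D" "X \<subseteq> D \<Longrightarrow> holder_norm_on X \<alpha> v \<le> holder_norm D \<alpha> v"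
proof -
  let ?P = "{(x1, x2). x1 \<in> D \<and> x2 \<in> D \<and> x1 \<noteq> x2}"
  let ?S = "SUP (x1, x2)\<in>?P. ennreal (\<bar>v x1 - v x2\<bar> / norm (x1 - x2) powr \<alpha>)"
  have fin: "e2ennreal (Linf_norm D v) < \<infinity>" "?S < \<infinity>"
    using v by (auto simp: holder_space_def holder_norm_def)
  have "\<bar>v x - v y\<bar> \<le> enn2real ?S * norm (x - y) powr \<alpha>" if "x \<in> D" "y \<in> D" for x y
  proof (cases "x = y")
    case False
    have "ennreal (\<bar>v x - v y\<bar> / norm (x - y) powr \<alpha>) \<le> ?S"
      by (rule SUP_upper2[of "(x, y)"]) (use that False in auto)
    also have "\<dots> = ennreal (enn2real ?S)" using fin(2) by simp
    finally have "\<bar>v x - v y\<bar> / norm (x - y) powr \<alpha> \<le> enn2real ?S" by simp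
    then show ?thesis using False by (simp add: pos_divide_le_eq)
  qed simp
  then show c: "continuous_on D v" by (rule holder_continuous_on[OF \<alpha>])
  have "Linf_norm D v \<noteq> \<infinity>" using fin(1) by (auto simp: e2ennreal_infty)
  then show "v \<in> Linf D" using continuous_measurable_D[OF c] by (simp add: Linf_def less_top)
  show "holder_norm_on X \<alpha> v \<le> holder_norm D \<alpha> v" if X: "X \<subseteq> D"
    unfolding holder_norm_on_def holder_norm_def
  proof (rule add_mono, rule SUP_least)
    fix x assume "x \<in> X"
    then have "e2ennreal (ereal \<bar>v x\<bar>) \<le> e2ennreal (Linf_norm D v)"
      using continuous_le_Linf_norm[OF c] X by (intro e2ennreal_mono) auto
    then show "ennreal \<bar>v x\<bar> \<le> e2ennreal (Linf_norm D v)" by (simp add: e2ennreal_ereal)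
  qed (rule SUP_subset_mono, use X in auto)
qed

text \<open>
  \<open>r\<close> is the Hoelder norm over a countable dense set. The expansion is linear in the parameter outside a
  null set for each point of that set, hence simultaneously for all of them, so the seminorm
  inequalities hold for the rotated parameters almost surely.
\<close>

lemma gaussian_holder_exp_moments:
  assumes meas: "\<And>x. x \<in> D \<Longrightarrow> (\<lambda>y. b y x) \<in> borel_measurable gauss"
    and sums: "\<And>x. x \<in> D \<Longrightarrow> AE y in gauss. (\<lambda>j. y j * \<psi> j x) sums b y x"
    and \<alpha>: "0 < \<alpha>"
    and hol: "AE y in gauss. b y \<in> holder_space D \<alpha>"
    and moment: "\<And>k::nat. (\<integral>\<^sup>+y. holder_norm D \<alpha> (b y) ^ k \<partial>gauss) < \<infinity>"
  obtains r where "r \<in> borel_measurable gauss" "\<And>y. 0 \<le> r y"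
    "AE y in gauss. b y \<in> Linf D \<and> (\<forall>x\<in>D. \<bar>b y x\<bar> \<le> r y) \<and> (\<forall>x\<in>D. \<forall>x'\<in>D. \<bar>b y x - b y x'\<bar> \<le> r y * norm (x - x') powr \<alpha>)"
    "\<And>c. (\<integral>\<^sup>+y. ennreal (exp (c * r y)) \<partial>gauss) < \<infinity>"
proof -
  obtain X where X: "countable X" "X \<subseteq> D" "D \<subseteq> closure X" using separable[of D] by blast
  let ?P = "{(x1, x2). x1 \<in> X \<and> x2 \<in> X \<and> x1 \<noteq> x2}"
  have cP: "countable ?P" by (rule countable_subset[of _ "X \<times> X"]) (use X(1) in auto)
  define N where "N y = holder_norm_on X \<alpha> (b y)" for y
  define r where "r y = enn2real (N y)" for y
  have bm: "(\<lambda>y. b y x) \<in> borel_measurable gauss" if "x \<in> X" for x using meas X(2) that by blast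
  have Nm: "N \<in> borel_measurable gauss"
  proof -
    have 1: "(\<lambda>y. SUP x\<in>X. ennreal \<bar>b y x\<bar>) \<in> borel_measurable gauss"
      by (rule borel_measurable_SUP[OF X(1)]) (use bm in measurable)
    have 2: "(\<lambda>y. SUP p\<in>?P. ennreal (\<bar>b y (fst p) - b y (snd p)\<bar> / norm (fst p - snd p) powr \<alpha>)) \<in> borel_measurable gauss"
    proof (rule borel_measurable_SUP[OF cP])
      fix p assume "p \<in> ?P"
      then have [measurable]: "(\<lambda>y. b y (fst p)) \<in> borel_measurable gauss" "(\<lambda>y. b y (snd p)) \<in> borel_measurable gauss"
        using bm by auto
      show "(\<lambda>y. ennreal (\<bar>b y (fst p) - b y (snd p)\<bar> / norm (fst p - snd p) powr \<alpha>)) \<in> borel_measurable gauss"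
        by measurable
    qed
    show ?thesis using borel_measurable_add[OF 1 2]
      unfolding N_def[abs_def] holder_norm_on_def by (simp add: case_prod_beta)
  qed
  (* This bounds the moments of r by those of the full Hoelder norm. *)
  have Nle: "AE y in gauss. N y \<le> holder_norm D \<alpha> (b y) \<and> N y < \<infinity>"
    using hol
  proof eventually_elim
    case (elim y)
    have "N y \<le> holder_norm D \<alpha> (b y)" unfolding N_def by (rule holder_spaceD(3)[OF elim \<alpha> X(2)])
    moreover have "holder_norm D \<alpha> (b y) < \<infinity>" using elim by (simp add: holder_space_def)
    ultimately show ?case by auto
  qed
  have sumsX: "AE y in gauss. \<forall>x\<in>X. (\<lambda>j. y j * \<psi> j x) sums b y x"
    using X sums by (subst AE_ball_countable) auto
  interpret G: prob_space gauss by (rule prob_space_gauss)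
  have rm: "r \<in> borel_measurable gauss" unfolding r_def[abs_def] using Nm by measurable
  interpret rotation_seminorm gauss r rotate_pair
  proof
    show "r \<in> borel_measurable gauss" by (rule rm)
    show "0 \<le> r y" for y by (simp add: r_def)
    let ?c = "ennreal (1 / sqrt 2)"
    have key: "N (fst p) \<le> ?c * (N (fst (rotate_pair p)) + N (snd (rotate_pair p)))"
      if s: "\<forall>x\<in>X. (\<lambda>j. fst p j * \<psi> j x) sums b (fst p) x"
        and s1: "\<forall>x\<in>X. (\<lambda>j. fst (rotate_pair p) j * \<psi> j x) sums b (fst (rotate_pair p)) x"
        and s2: "\<forall>x\<in>X. (\<lambda>j. snd (rotate_pair p) j * \<psi> j x) sums b (snd (rotate_pair p)) x" for p
    proof -
      let ?y = "fst p" and ?S = "fst (rotate_pair p)" and ?T = "snd (rotate_pair p)"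
      have lin: "b ?y x = (1 / sqrt 2) * (b ?S x + b ?T x)" if "x \<in> X" for x
      proof -
        have "(\<lambda>j. (1 / sqrt 2) * (?S j * \<psi> j x + ?T j * \<psi> j x)) sums ((1 / sqrt 2) * (b ?S x + b ?T x))"
          using s1 s2 that by (intro sums_mult sums_add) auto
        moreover have "(1 / sqrt 2) * (?S j * \<psi> j x + ?T j * \<psi> j x) = ?y j * \<psi> j x" for j
        proof -
          have "?S j + ?T j = 2 * ?y j / sqrt 2" by (simp add: rotate_pair_def add_divide_distrib diff_divide_distrib)
          then have "(1 / sqrt 2) * (?S j + ?T j) = ?y j" by simp
          then show ?thesis by (simp add: distrib_right[symmetric] mult.assoc[symmetric])
        qed
        ultimately show ?thesis using s that sums_unique2 by fastforce
      qed
      have conv: "ennreal \<bar>(1 / sqrt 2) * (p + q)\<bar> \<le> ?c * (ennreal \<bar>p\<bar> + ennreal \<bar>q\<bar>)" for p q :: real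
      proof -
        have "\<bar>(1 / sqrt 2) * (p + q)\<bar> \<le> (1 / sqrt 2) * (\<bar>p\<bar> + \<bar>q\<bar>)"
          by (subst abs_mult) (auto intro!: divide_right_mono abs_triangle_ineq)
        then have "ennreal \<bar>(1 / sqrt 2) * (p + q)\<bar> \<le> ennreal ((1 / sqrt 2) * (\<bar>p\<bar> + \<bar>q\<bar>))" by (rule ennreal_leI)
        also have "\<dots> = ?c * (ennreal \<bar>p\<bar> + ennreal \<bar>q\<bar>)" by (subst ennreal_mult) auto
        finally show ?thesis .
      qed
      define A where "A y = (SUP x\<in>X. ennreal \<bar>b y x\<bar>)" for y
      define B where "B y = (SUP (x1, x2)\<in>?P. ennreal (\<bar>b y x1 - b y x2\<bar> / norm (x1 - x2) powr \<alpha>))" for y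
      have NAB: "N y = A y + B y" for y by (simp add: N_def holder_norm_on_def A_def B_def)
      have "A ?y \<le> ?c * (A ?S + A ?T)" unfolding A_def[of ?y]
      proof (rule SUP_least)
        fix x assume x: "x \<in> X"
        have "ennreal \<bar>b ?y x\<bar> \<le> ?c * (ennreal \<bar>b ?S x\<bar> + ennreal \<bar>b ?T x\<bar>)" unfolding lin[OF x] by (rule conv)
        also have "\<dots> \<le> ?c * (A ?S + A ?T)" unfolding A_def by (intro mult_left_mono add_mono SUP_upper x) auto
        finally show "ennreal \<bar>b ?y x\<bar> \<le> ?c * (A ?S + A ?T)" .
      qed
      moreover have "B ?y \<le> ?c * (B ?S + B ?T)" unfolding B_def[of ?y]
      proof (rule SUP_least)
        fix q assume q: "q \<in> ?P"
        obtain x1 x2 where x: "q = (x1, x2)" "x1 \<in> X" "x2 \<in> X" "x1 \<noteq> x2" using q by auto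
        let ?n = "norm (x1 - x2) powr \<alpha>"
        have up: "ennreal \<bar>(b y x1 - b y x2) / ?n\<bar> \<le> B y" for y
          unfolding B_def by (rule SUP_upper2[OF q]) (simp add: x(1))
        have e: "(b ?y x1 - b ?y x2) / ?n = (1 / sqrt 2) * ((b ?S x1 - b ?S x2) / ?n + (b ?T x1 - b ?T x2) / ?n)"
          unfolding lin[OF x(2)] lin[OF x(3)] by (simp add: add_divide_distrib diff_divide_distrib algebra_simps)
        have "ennreal \<bar>(b ?y x1 - b ?y x2) / ?n\<bar> \<le> ?c * (ennreal \<bar>(b ?S x1 - b ?S x2) / ?n\<bar> + ennreal \<bar>(b ?T x1 - b ?T x2) / ?n\<bar>)"
          unfolding e by (rule conv)
        also have "\<dots> \<le> ?c * (B ?S + B ?T)" by (intro mult_left_mono add_mono up) auto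
        finally show "(case q of (x1, x2) \<Rightarrow> ennreal (\<bar>b ?y x1 - b ?y x2\<bar> / norm (x1 - x2) powr \<alpha>)) \<le> ?c * (B ?S + B ?T)"
          by (simp add: x(1))
      qed
      ultimately have "N ?y \<le> ?c * (A ?S + A ?T) + ?c * (B ?S + B ?T)" unfolding NAB by (rule add_mono)
      also have "\<dots> = ?c * (N ?S + N ?T)" unfolding NAB by (simp only: distrib_left[symmetric] ac_simps)
      finally show ?thesis .
    qed
    show "AE p in gauss \<Otimes>\<^sub>M gauss. r (fst p) \<le> (r (fst (rotate_pair p)) + r (snd (rotate_pair p))) / sqrt 2"
      using AE_gauss_pair(1)[OF sumsX] AE_gauss_pair(2)[OF sumsX] AE_gauss_pair(3)[OF sumsX]
        AE_gauss_pair(1)[OF Nle] AE_gauss_pair(2)[OF Nle] AE_gauss_pair(3)[OF Nle]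
    proof eventually_elim
      case (elim p)
      have f: "N (fst p) = ennreal (r (fst p))" "N (fst (rotate_pair p)) = ennreal (r (fst (rotate_pair p)))"
        "N (snd (rotate_pair p)) = ennreal (r (snd (rotate_pair p)))"
        using elim(4,5,6) by (auto simp: r_def)
      have nn: "0 \<le> r y" for y by (simp add: r_def)
      have "ennreal (r (fst p)) \<le> ?c * (ennreal (r (fst (rotate_pair p))) + ennreal (r (snd (rotate_pair p))))"
        using key[OF elim(1,2,3)] unfolding f .
      also have "\<dots> = ennreal ((1 / sqrt 2) * (r (fst (rotate_pair p)) + r (snd (rotate_pair p))))"
        using nn by (subst ennreal_mult) auto
      finally show ?case using nn by (subst (asm) ennreal_le_iff) auto
    qed
  qed (rule rotate_pair_distr)+
  have "moment k < \<infinity>" for k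
  proof -
    have "moment k \<le> (\<integral>\<^sup>+y. holder_norm D \<alpha> (b y) ^ k \<partial>gauss)"
      unfolding moment_def
    proof (rule nn_integral_mono_AE, use Nle in eventually_elim)
      case (elim y)
      have "ennreal (r y ^ k) = N y ^ k" using elim by (simp add: r_def ennreal_power[symmetric])
      then show ?case using elim by (simp add: power_mono)
    qed
    then show ?thesis using assms(5)[of k] by (rule le_less_trans)
  qed
  then have exp: "(\<integral>\<^sup>+y. ennreal (exp (c * r y)) \<partial>gauss) < \<infinity>" for c by (rule exp_moment_finite)
  have good: "AE y in gauss. b y \<in> Linf D \<and> (\<forall>x\<in>D. \<bar>b y x\<bar> \<le> r y) \<and> (\<forall>x\<in>D. \<forall>x'\<in>D. \<bar>b y x - b y x'\<bar> \<le> r y * norm (x - x') powr \<alpha>)"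
    using hol Nle
  proof eventually_elim
    case (elim y)
    have fin: "holder_norm_on X \<alpha> (b y) < \<infinity>" using elim by (simp add: N_def)
    have r: "r y = enn2real (holder_norm_on X \<alpha> (b y))" by (simp add: r_def N_def)
    note e = holder_dense_extend[OF X(2,3) holder_spaceD(1)[OF elim(1) \<alpha>] \<alpha> holder_norm_onD[OF fin]]
    show ?case unfolding r using e holder_spaceD(2)[OF elim(1) \<alpha>] by blast
  qed
  show thesis by (rule that[OF rm _ good exp]) (simp add: r_def)
qed

end

section \<open>Strong measurability and the error in mean square\<close>

context bounded_open begin

lemma V_norm_diff_le:
  assumes "v \<in> H10 D" "w \<in> H10 D"
  shows "V_norm D (\<lambda>x. v x - w x) \<le> V_norm D v + V_norm D w"
proof -
  have "V_norm D (\<lambda>x. v x - w x) = L2_norm D (\<lambda>x. weak_grad D v x + (-1) *\<^sub>R weak_grad D w x)"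
    using V_norm_diff_eq[OF assms] by simp
  also have "\<dots> \<le> V_norm D v + L2_norm D (\<lambda>x. (-1) *\<^sub>R weak_grad D w x)"
    unfolding V_norm_def by (intro L2_norm_triangle L2_scaleR H10_D assms)
  also have "\<dots> = V_norm D v + V_norm D w" unfolding L2_norm_scaleR V_norm_def by simp
  finally show ?thesis .
qed

lemma finite_net:
  assumes "0 < \<eta>"
  shows "\<exists>F. finite F \<and> F \<subseteq> D \<and> (\<forall>x\<in>D. \<exists>z\<in>F. norm (x - z) < \<eta>)"
proof -
  have cover: "closure D \<subseteq> (\<Union>x\<in>D. ball x \<eta>)"
  proof
    fix x assume "x \<in> closure D"
    then obtain z where "z \<in> D" "dist z x < \<eta>" using assms by (auto simp: closure_approachable)
    then show "x \<in> (\<Union>x\<in>D. ball x \<eta>)" by auto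
  qed
  have "compact (closure D)" using bounded_D by (simp add: compact_closure)
  then obtain F where F: "F \<subseteq> D" "finite F" "closure D \<subseteq> (\<Union>x\<in>F. ball x \<eta>)"
    by (rule compactE_image[OF _ open_ball cover])
  have "\<exists>z\<in>F. norm (x - z) < \<eta>" if "x \<in> D" for x
    using F(3) closure_subset[of D] that by (force simp: dist_norm norm_minus_commute)
  then show ?thesis using F by blast
qed

text \<open>
  Where \<open>r \<le> n\<close>, the field is determined up to a small uniform error by its values, rounded to multiples
  of \<open>1 / n\<close>, on a sufficiently fine finite net. These finitely many codes split the parameter space into
  measurable pieces, and on each piece the approximating simple function takes the value of \<open>U\<close> at
  some representative parameter of the same piece. Continuous dependence of \<open>U\<close> on the field in the supremum norm gives
  convergence.
\<close>

lemma strongly_measurable_of_field: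
  assumes bm: "\<And>x. x \<in> D \<Longrightarrow> (\<lambda>y. b y x) \<in> borel_measurable M"
    and rm: "r \<in> borel_measurable M" and \<alpha>: "0 < \<alpha>"
    and ae: "AE y in M. good y"
    and bound: "\<And>y x. good y \<Longrightarrow> x \<in> D \<Longrightarrow> \<bar>b y x\<bar> \<le> r y"
    and holder: "\<And>y x x'. good y \<Longrightarrow> x \<in> D \<Longrightarrow> x' \<in> D \<Longrightarrow> \<bar>b y x - b y x'\<bar> \<le> r y * norm (x - x') powr \<alpha>"
    and U: "\<And>y. good y \<Longrightarrow> U y \<in> H10 D"
    and est: "\<And>y y' m e. good y \<Longrightarrow> good y' \<Longrightarrow> 0 \<le> e \<Longrightarrow> (\<And>x. x \<in> D \<Longrightarrow> \<bar>b y x\<bar> \<le> m) \<Longrightarrow> (\<And>x. x \<in> D \<Longrightarrow> \<bar>b y' x\<bar> \<le> m) \<Longrightarrow>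
       (\<And>x. x \<in> D \<Longrightarrow> \<bar>b y x - b y' x\<bar> \<le> e) \<Longrightarrow> V_norm D (\<lambda>x. U y x - U y' x) \<le> C * exp (3 * m) * e"
  shows "strongly_measurable M D U"
proof -
  obtain N where N: "N \<in> null_sets M" "{y \<in> space M. \<not> good y} \<subseteq> N"
    using ae by (auto elim!: AE_E simp: null_sets_def)
  define Gd where "Gd = space M - N"
  have Gd: "Gd \<in> sets M" "\<And>y. y \<in> Gd \<Longrightarrow> good y" "\<And>y. y \<in> Gd \<Longrightarrow> y \<in> space M" using N by (auto simp: Gd_def)
  have aeGd: "AE y in M. y \<in> Gd" using AE_not_in[OF N(1)] AE_space by eventually_elim (simp add: Gd_def)
  (* With r at most Suc n, the field then oscillates by at most 1 / Suc n over distances below \<eta> n. *)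
  define \<eta> where "\<eta> n = (1 / (real (Suc n))\<^sup>2) powr (1 / \<alpha>)" for n
  have "\<exists>F. finite F \<and> F \<subseteq> D \<and> (\<forall>x\<in>D. \<exists>z\<in>F. norm (x - z) < \<eta> n)" for n
    by (rule finite_net) (simp add: \<eta>_def)
  then obtain F where F: "\<And>n. finite (F n)" "\<And>n. F n \<subseteq> D" "\<And>n x. x \<in> D \<Longrightarrow> \<exists>z\<in>F n. norm (x - z) < \<eta> n" by metis
  define code where "code n y = (\<lambda>x. if x \<in> F n then \<lfloor>real (Suc n) * b y x\<rfloor> else 0)" for n y
  (* Gd is a measurable set of good parameters with null complement. *)
  define A where "A n = {y \<in> Gd. r y \<le> real (Suc n)}" for n
  have A: "A n \<in> sets M" for n
  proof -
    have "A n = Gd \<inter> {y \<in> space M. r y \<le> real (Suc n)}" using Gd(3) by (auto simp: A_def)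
    then show ?thesis using Gd(1) rm by simp
  qed
  define rep where "rep n c = (SOME y. y \<in> A n \<and> code n y = c)" for n c
  have rep: "rep n (code n y) \<in> A n" "code n (rep n (code n y)) = code n y" if "y \<in> A n" for n y
    using someI_ex[of "\<lambda>y'. y' \<in> A n \<and> code n y' = code n y"] that unfolding rep_def by auto
  define s where "s n y = (if y \<in> A n then U (rep n (code n y)) else (\<lambda>x. 0))" for n y
  have sf: "simple_function M (\<lambda>y. if y \<in> A n then Some (code n y) else None)" for n
    unfolding simple_function_def
  proof (intro conjI ballI)
    let ?m = "real (Suc n)"
    let ?K = "{f. \<forall>x. (x \<in> F n \<longrightarrow> f x \<in> {- \<lceil>?m * ?m\<rceil>..\<lceil>?m * ?m\<rceil>}) \<and> (x \<notin> F n \<longrightarrow> f x = 0)}"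
    have "code n y \<in> ?K" if y: "y \<in> A n" for y
    proof -
      have "- \<lceil>?m * ?m\<rceil> \<le> \<lfloor>?m * b y x\<rfloor> \<and> \<lfloor>?m * b y x\<rfloor> \<le> \<lceil>?m * ?m\<rceil>" if "x \<in> F n" for x
      proof -
        have "\<bar>b y x\<bar> \<le> ?m" using bound[OF Gd(2)] y that F(2) by (fastforce simp: A_def)
        then have "\<bar>?m * b y x\<bar> \<le> ?m * ?m" by (simp add: abs_mult)
        moreover have "- \<lceil>s\<rceil> \<le> \<lfloor>t\<rfloor> \<and> \<lfloor>t\<rfloor> \<le> \<lceil>s\<rceil>" if "\<bar>t\<bar> \<le> s" for s t :: real
          using that by linarith
        ultimately show ?thesis by blast
      qed
      then show ?thesis by (auto simp: code_def)
    qed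
    then have "(\<lambda>y. if y \<in> A n then Some (code n y) else None) ` space M \<subseteq> insert None (Some ` ?K)" by auto
    moreover have "finite ?K" by (rule finite_set_of_finite_funs[OF F(1)]) simp
    ultimately show "finite ((\<lambda>y. if y \<in> A n then Some (code n y) else None) ` space M)"
      by (meson finite.insertI finite_imageI finite_subset)
  next
    fix z assume "z \<in> (\<lambda>y. if y \<in> A n then Some (code n y) else None) ` space M"
    then obtain w where w: "w \<in> space M" "z = (if w \<in> A n then Some (code n w) else None)" by auto
    show "(\<lambda>y. if y \<in> A n then Some (code n y) else None) -` {z} \<inter> space M \<in> sets M"
    proof (cases "w \<in> A n")
      case False
      then have "(\<lambda>y. if y \<in> A n then Some (code n y) else None) -` {z} \<inter> space M = space M - A n"
        using w by (auto split: if_splits)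
      then show ?thesis using A by simp
    next
      case True
      have "(\<lambda>y. if y \<in> A n then Some (code n y) else None) -` {z} \<inter> space M =
          A n \<inter> {y \<in> space M. \<forall>x\<in>F n. \<lfloor>real (Suc n) * b y x\<rfloor> = code n w x}"
        using w True sets.sets_into_space[OF A[of n]] by (auto simp: code_def fun_eq_iff split: if_splits)
      moreover have "{y \<in> space M. \<forall>x\<in>F n. \<lfloor>real (Suc n) * b y x\<rfloor> = code n w x} \<in> sets M"
      proof (rule sets.sets_Collect_finite_All[OF _ F(1)])
        fix x assume "x \<in> F n"
        then have [measurable]: "(\<lambda>y. b y x) \<in> borel_measurable M" using bm F(2) by blast
        show "{y \<in> space M. \<lfloor>real (Suc n) * b y x\<rfloor> = code n w x} \<in> sets M" by measurable
      qed
      ultimately show ?thesis using A by simp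
    qed
  qed
  have s_simple: "simple_function M (s n)" for n
  proof -
    have "s n = (\<lambda>c. case c of None \<Rightarrow> (\<lambda>x. 0) | Some c \<Rightarrow> U (rep n c)) \<circ> (\<lambda>y. if y \<in> A n then Some (code n y) else None)"
      by (auto simp: s_def fun_eq_iff)
    then show ?thesis using simple_function_compose[OF sf] by simp
  qed
  have s_H10: "s n y \<in> H10 D" for n y
    using rep(1)[of y n] Gd(2) U zero_H10 by (auto simp: s_def A_def)
  have "AE y in M. (\<lambda>n. V_norm D (\<lambda>x. U y x - s n y x)) \<longlonglongrightarrow> 0"
    using aeGd
  proof eventually_elim
    case (elim y)
    (* Three errors of size at most 1 separate the field from that of the representative. *)
    let ?m = "r y + 3"
    have "V_norm D (\<lambda>x. U y x - s n y x) \<le> C * exp (3 * ?m) * (3 * inverse (real (Suc n)))" if n: "n \<ge> nat \<lceil>r y\<rceil>" for n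
    proof -
      let ?i = "inverse (real (Suc n))"
      have yA: "y \<in> A n" using n elim by (auto simp: A_def)
      define y' where "y' = rep n (code n y)"
      have y': "y' \<in> A n" "code n y' = code n y" using rep[OF yA] by (auto simp: y'_def)
      have g: "good y" "good y'" using yA y'(1) Gd(2) by (auto simp: A_def)
      have osc: "\<bar>b v x - b v z\<bar> \<le> ?i" if "v \<in> A n" "x \<in> D" "z \<in> D" "norm (x - z) < \<eta> n" for v x z
      proof -
        have v: "good v" "r v \<le> real (Suc n)" using that(1) Gd(2) by (auto simp: A_def)
        have "norm (x - z) powr \<alpha> \<le> \<eta> n powr \<alpha>" using that(4) \<alpha> by (intro powr_mono2) auto
        also have "\<eta> n powr \<alpha> = 1 / (real (Suc n))\<^sup>2" using \<alpha> by (simp add: \<eta>_def powr_powr)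
        finally have "real (Suc n) * norm (x - z) powr \<alpha> \<le> real (Suc n) * (1 / (real (Suc n))\<^sup>2)"
          by (rule mult_left_mono) simp
        moreover have "real (Suc n) * (1 / (real (Suc n))\<^sup>2) = ?i" by (simp add: power2_eq_square divide_inverse)
        moreover have "r v * norm (x - z) powr \<alpha> \<le> real (Suc n) * norm (x - z) powr \<alpha>" by (intro mult_right_mono v) auto
        ultimately show ?thesis using holder[OF v(1) that(2,3)] by linarith
      qed
      have diff: "\<bar>b y x - b y' x\<bar> \<le> 3 * ?i" if x: "x \<in> D" for x
      proof -
        obtain z where z: "z \<in> F n" "norm (x - z) < \<eta> n" using F(3)[OF x] by blast
        then have zD: "z \<in> D" using F(2) by blast
        have "\<lfloor>real (Suc n) * b y z\<rfloor> = \<lfloor>real (Suc n) * b y' z\<rfloor>"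
          using fun_cong[OF y'(2), of z] z(1) by (simp add: code_def)
        then have "\<bar>real (Suc n) * b y z - real (Suc n) * b y' z\<bar> \<le> 1" by linarith
        then have "real (Suc n) * \<bar>b y z - b y' z\<bar> \<le> 1" by (simp only: right_diff_distrib[symmetric] abs_mult abs_of_nat)
        then have "\<bar>b y z - b y' z\<bar> \<le> ?i" by (simp add: inverse_eq_divide pos_le_divide_eq mult.commute)
        then show ?thesis using osc[OF yA x zD z(2)] osc[OF y'(1) x zD z(2)] by linarith
      qed
      have i1: "?i \<le> 1" by (simp add: inverse_eq_divide)
      have b1: "\<bar>b y x\<bar> \<le> ?m" if "x \<in> D" for x using bound[OF g(1) that] by linarith
      have b2: "\<bar>b y' x\<bar> \<le> ?m" if "x \<in> D" for x using bound[OF g(1) that] diff[OF that] i1 by linarith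
      have "V_norm D (\<lambda>x. U y x - U y' x) \<le> C * exp (3 * ?m) * (3 * ?i)"
        by (rule est[OF g _ b1 b2 diff]) simp
      then show ?thesis using yA by (simp add: s_def y'_def)
    qed
    then have ev: "\<forall>\<^sub>F n in sequentially. V_norm D (\<lambda>x. U y x - s n y x) \<le> C * exp (3 * ?m) * (3 * inverse (real (Suc n)))"
      unfolding eventually_sequentially by blast
    have lim: "(\<lambda>n. C * exp (3 * ?m) * (3 * inverse (real (Suc n)))) \<longlonglongrightarrow> 0"
      using tendsto_mult_left[OF tendsto_mult_left[OF LIMSEQ_inverse_real_of_nat, of 3], of "C * exp (3 * ?m)"]
      by (simp only: mult_zero_right)
    have nonneg: "\<forall>\<^sub>F n in sequentially. 0 \<le> V_norm D (\<lambda>x. U y x - s n y x)" by simp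
    show ?case by (rule tendsto_sandwich[OF nonneg ev tendsto_const lim])
  qed
  moreover have "AE y in M. U y \<in> H10 D" using ae by eventually_elim (rule U)
  ultimately show ?thesis unfolding strongly_measurable_def using s_simple s_H10 by blast
qed

lemma exp_galerkin_apriori:
  assumes g: "g \<in> borel_measurable (lebesgue_on D)" "\<And>x. x \<in> D \<Longrightarrow> \<bar>g x\<bar> \<le> m"
    and f: "f \<in> L2 D" and S: "S \<subseteq> H10 D" and u: "galerkin_solution D S (\<lambda>x. exp (g x)) f u"
  shows "V_norm D u \<le> exp m * (poincare * L2_norm D f)"
proof -
  interpret elliptic_coefficient D "\<lambda>x. exp (g x)" "exp (- m)" "exp m" by (rule exp_elliptic[OF g])
  show ?thesis using galerkin_apriori[OF S f u] by (simp add: exp_minus field_simps)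
qed

lemma exp_galerkin_lipschitz:
  assumes g: "g \<in> borel_measurable (lebesgue_on D)" "\<And>x. x \<in> D \<Longrightarrow> \<bar>g x\<bar> \<le> m"
    and g': "g' \<in> borel_measurable (lebesgue_on D)" "\<And>x. x \<in> D \<Longrightarrow> \<bar>g' x\<bar> \<le> m"
    and f: "f \<in> L2 D" and S: "S \<subseteq> H10 D" "\<And>v w. v \<in> S \<Longrightarrow> w \<in> S \<Longrightarrow> (\<lambda>x. v x - w x) \<in> S"
    and u: "galerkin_solution D S (\<lambda>x. exp (g x)) f u" and u': "galerkin_solution D S (\<lambda>x. exp (g' x)) f u'"
    and e: "0 \<le> e" "\<And>x. x \<in> D \<Longrightarrow> \<bar>g x - g' x\<bar> \<le> e"
  shows "V_norm D (\<lambda>x. u x - u' x) \<le> poincare * L2_norm D f * exp (3 * m) * e"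
proof -
  interpret elliptic_coefficient D "\<lambda>x. exp (g x)" "exp (- m)" "exp m" by (rule exp_elliptic[OF g])
  have "exp (- m) * V_norm D (\<lambda>x. u x - u' x) \<le> (exp m * e) * V_norm D u'"
  proof (rule galerkin_stability[OF S u exp_elliptic[OF g'] u'])
    show "\<bar>exp (g' x) - exp (g x)\<bar> \<le> exp m * e" if "x \<in> D" for x
    proof -
      have "\<bar>exp (g' x) - exp (g x)\<bar> \<le> exp m * \<bar>g' x - g x\<bar>" by (rule abs_exp_diff_le) (use g(2) g'(2) that in auto)
      also have "\<dots> \<le> exp m * e" using e(2)[OF that] by (intro mult_left_mono) auto
      finally show ?thesis .
    qed
  qed (use e in auto)
  also have "\<dots> \<le> (exp m * e) * (exp m * (poincare * L2_norm D f))"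
    using e by (intro mult_left_mono exp_galerkin_apriori[OF g' f S(1) u']) auto
  finally have "exp m * (exp (- m) * V_norm D (\<lambda>x. u x - u' x)) \<le> exp m * ((exp m * e) * (exp m * (poincare * L2_norm D f)))"
    by (rule mult_left_mono) simp
  moreover have "exp m * (exp (- m) * V_norm D (\<lambda>x. u x - u' x)) = V_norm D (\<lambda>x. u x - u' x)" by (simp add: exp_minus)
  moreover have "exp (3 * m) = exp m * (exp m * exp m)" by (simp add: exp_add[symmetric])
  ultimately show ?thesis by (simp add: algebra_simps)
qed

lemma subspace_of_dimD:
  assumes "subspace_of_dim D S k"
  shows "S \<subseteq> H10 D" "v \<in> S \<Longrightarrow> w \<in> S \<Longrightarrow> (\<lambda>x. v x - w x) \<in> S"
proof -
  show "S \<subseteq> H10 D" using assms by (simp add: subspace_of_dim_def)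
  have add: "\<And>v w. v \<in> S \<Longrightarrow> w \<in> S \<Longrightarrow> (\<lambda>x. v x + w x) \<in> S"
    and mult: "\<And>c v. v \<in> S \<Longrightarrow> (\<lambda>x. c * v x) \<in> S"
    using assms unfolding subspace_of_dim_def by auto
  assume "v \<in> S" "w \<in> S"
  then show "(\<lambda>x. v x - w x) \<in> S" using add[OF _ mult[of w "-1"], of v] by simp
qed

end

theorem theorem2p7:
  fixes D :: "'a::euclidean_space set"
    and f :: "'a \<Rightarrow> real"
    and \<psi> :: "nat \<Rightarrow> 'a \<Rightarrow> real"
    and b u :: "(nat \<Rightarrow> real) \<Rightarrow> 'a \<Rightarrow> real"
    and V :: "real \<Rightarrow> ('a \<Rightarrow> real) set"
    and n :: "real \<Rightarrow> nat"
    and u_h :: "real \<Rightarrow> (nat \<Rightarrow> real) \<Rightarrow> 'a \<Rightarrow> real"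
    and \<alpha> C\<^sub>0 t :: real
  assumes "DIM('a) \<in> {1, 2, 3}"
    and "bounded D" and "lipschitz_domain D"
    and "f \<in> L2 D"
    and "centered_gaussian_process gauss D b"
    and "\<And>x. x \<in> D \<Longrightarrow> AE y in gauss. (\<lambda>j. y j * \<psi> j x) sums b y x"
    and "\<And>y. b y \<in> Linf D \<Longrightarrow> galerkin_solution D (H10 D) (\<lambda>x. exp (b y x)) f (u y)"
    and "\<And>h. h > 0 \<Longrightarrow> subspace_of_dim D (V h) (n h)"
    and "filterlim n at_top (at_right 0)"
    and "\<And>h y. h > 0 \<Longrightarrow> b y \<in> Linf D \<Longrightarrow>
           galerkin_solution D (V h) (\<lambda>x. exp (b y x)) f (u_h h y)"
    and "0 < \<alpha>" and "\<alpha> < 1"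
    and "AE y in gauss. b y \<in> holder_space D \<alpha>"
    and "\<And>k::nat. (\<integral>\<^sup>+y. holder_norm D \<alpha> (b y) ^ k \<partial>gauss) < \<infinity>"
    and "C\<^sub>0 > 0" and "t > 0"
    and "\<And>h v. h > 0 \<Longrightarrow> n h > 0 \<Longrightarrow> v \<in> W_space D \<Longrightarrow>
           (INF v\<^sub>h\<in>V h. V_norm D (\<lambda>x. v x - v\<^sub>h x)) \<le> C\<^sub>0 * real (n h) powr (- t) * W_norm D v"
  shows "\<exists>C>0. \<forall>h>0. (\<lambda>y x. u y x - u_h h y x) \<in> bochner_L2 gauss D \<and>
           (n h > 0 \<longrightarrow>
              bochner_L2_norm gauss D (\<lambda>y x. u y x - u_h h y x) \<le> C * real (n h) powr (- (\<alpha> * t)))"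
proof -
  interpret bounded_open D
    using assms(2,3) by unfold_locales (auto simp: lipschitz_domain_def)
  note f = assms(4) and gal = assms(7) and sub = assms(8) and gal_h = assms(10) and \<alpha> = assms(11) and app = assms(17)
  have bm: "(\<lambda>y. b y x) \<in> borel_measurable gauss" if "x \<in> D" for x
    using assms(5) that by (simp add: centered_gaussian_process_def)
  obtain r where r: "r \<in> borel_measurable gauss" "\<And>y. 0 \<le> r y"
    "AE y in gauss. b y \<in> Linf D \<and> (\<forall>x\<in>D. \<bar>b y x\<bar> \<le> r y) \<and> (\<forall>x\<in>D. \<forall>x'\<in>D. \<bar>b y x - b y x'\<bar> \<le> r y * norm (x - x') powr \<alpha>)"
    "\<And>c. (\<integral>\<^sup>+y. ennreal (exp (c * r y)) \<partial>gauss) < \<infinity>"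
    using gaussian_holder_exp_moments[OF bm assms(6) \<alpha> assms(13,14)] by blast
  define good where "good y \<longleftrightarrow> b y \<in> Linf D \<and> (\<forall>x\<in>D. \<bar>b y x\<bar> \<le> r y) \<and>
      (\<forall>x\<in>D. \<forall>x'\<in>D. \<bar>b y x - b y x'\<bar> \<le> r y * norm (x - x') powr \<alpha>)" for y
  have ae: "AE y in gauss. good y" using r(3) by (simp add: good_def)
  have goodD: "b y \<in> Linf D" "b y \<in> borel_measurable (lebesgue_on D)" "\<And>x. x \<in> D \<Longrightarrow> \<bar>b y x\<bar> \<le> r y"
    "\<forall>x\<in>D. \<forall>x'\<in>D. \<bar>b y x - b y x'\<bar> \<le> r y * norm (x - x') powr \<alpha>" if "good y" for y
    using that by (auto simp: good_def Linf_def)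
  obtain K where K: "0 < K" and err: "\<And>g B S \<delta> u us. \<lbrakk>0 \<le> B; \<And>x. x \<in> D \<Longrightarrow> \<bar>g x\<bar> \<le> B;
      \<forall>x\<in>D. \<forall>y\<in>D. \<bar>g x - g y\<bar> \<le> B * norm (x - y) powr \<alpha>;
      S \<subseteq> H10 D; \<And>v w. v \<in> S \<Longrightarrow> w \<in> S \<Longrightarrow> (\<lambda>x. v x - w x) \<in> S;
      galerkin_solution D (H10 D) (\<lambda>x. exp (g x)) f u; galerkin_solution D S (\<lambda>x. exp (g x)) f us;
      0 < \<delta>; \<delta> \<le> 1;
      \<And>v. v \<in> W_space D \<Longrightarrow> (INF s\<in>S. V_norm D (\<lambda>x. v x - s x)) \<le> C\<^sub>0 * \<delta> * W_norm D v\<rbrakk>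
      \<Longrightarrow> V_norm D (\<lambda>x. u x - us x) \<le> K * exp (8 * B) * \<delta> powr \<alpha>"
    using galerkin_holder_error[OF f \<alpha> less_imp_le[OF assms(12)] less_imp_le[OF assms(15)]] by blast
  define P where "P = poincare * L2_norm D f"
  have P: "0 \<le> P" using Poincare(1) by (simp add: P_def)
  define E where "E c = enn2real (\<integral>\<^sup>+y. ennreal (exp (c * r y)) \<partial>gauss)" for c
  have E: "(\<integral>\<^sup>+y. ennreal (exp (c * r y)) \<partial>gauss) = ennreal (E c)" for c
    using r(4)[of c] by (simp add: E_def)
  have sq: "(\<integral>\<^sup>+y. ennreal ((V_norm D (W y))\<^sup>2) \<partial>gauss) \<le> ennreal (k\<^sup>2 * E (2 * c))"
    if k: "0 \<le> k" and le: "\<And>y. good y \<Longrightarrow> V_norm D (W y) \<le> k * exp (c * r y)" for W k c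
  proof -
    have "(\<integral>\<^sup>+y. ennreal ((V_norm D (W y))\<^sup>2) \<partial>gauss) \<le> (\<integral>\<^sup>+y. ennreal (k\<^sup>2) * ennreal (exp (2 * c * r y)) \<partial>gauss)"
    proof (rule nn_integral_mono_AE, use ae in eventually_elim)
      case (elim y)
      have "(V_norm D (W y))\<^sup>2 \<le> (k * exp (c * r y))\<^sup>2" by (intro power_mono le elim) simp
      also have "\<dots> = k\<^sup>2 * exp (2 * c * r y)" by (simp add: power_mult_distrib exp_double[symmetric] mult.assoc)
      finally show ?case by (simp add: ennreal_mult[symmetric] ennreal_leI)
    qed
    also have "\<dots> = ennreal (k\<^sup>2) * ennreal (E (2 * c))" unfolding E[symmetric] using r(1) by (intro nn_integral_cmult) measurable
    also have "\<dots> = ennreal (k\<^sup>2 * E (2 * c))" by (simp add: ennreal_mult E_def)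
    finally show ?thesis .
  qed
  (* The summand 1 makes C positive; 16 is twice the exponent in the pathwise estimate. *)
  define C where "C = K * sqrt (E 16) + 1"
  have "0 < C" using K by (auto simp: C_def E_def intro!: add_nonneg_pos)
  moreover have "(\<lambda>y x. u y x - u_h h y x) \<in> bochner_L2 gauss D \<and>
      (n h > 0 \<longrightarrow> bochner_L2_norm gauss D (\<lambda>y x. u y x - u_h h y x) \<le> C * real (n h) powr (- (\<alpha> * t)))" if h: "h > 0" for h
  proof -
    let ?U = "\<lambda>y x. u y x - u_h h y x"
    note S = subspace_of_dimD[OF sub[OF h]]
    have uH: "u y \<in> H10 D" "u_h h y \<in> H10 D" if "good y" for y
      using gal[OF goodD(1)[OF that]] gal_h[OF h goodD(1)[OF that]] S(1) by (auto simp: galerkin_solution_def)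
    have UH: "?U y \<in> H10 D" if "good y" for y by (rule H10_diff(1)[OF uH[OF that]])
    have "strongly_measurable gauss D ?U"
    proof (rule strongly_measurable_of_field[OF bm r(1) \<alpha> ae, where C = "2 * P"])
      fix y y' m e
      assume g: "good y" "good y'" and e: "0 \<le> e" and m: "\<And>x. x \<in> D \<Longrightarrow> \<bar>b y x\<bar> \<le> m" "\<And>x. x \<in> D \<Longrightarrow> \<bar>b y' x\<bar> \<le> m"
        and d: "\<And>x. x \<in> D \<Longrightarrow> \<bar>b y x - b y' x\<bar> \<le> e"
      have 1: "V_norm D (\<lambda>x. u y x - u y' x) \<le> P * exp (3 * m) * e"
        unfolding P_def
        by (rule exp_galerkin_lipschitz[OF goodD(2)[OF g(1)] m(1) goodD(2)[OF g(2)] m(2) f order_refl H10_diff(1)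
              gal[OF goodD(1)[OF g(1)]] gal[OF goodD(1)[OF g(2)]] e d])
      have 2: "V_norm D (\<lambda>x. u_h h y x - u_h h y' x) \<le> P * exp (3 * m) * e"
        unfolding P_def
        by (rule exp_galerkin_lipschitz[OF goodD(2)[OF g(1)] m(1) goodD(2)[OF g(2)] m(2) f S
              gal_h[OF h goodD(1)[OF g(1)]] gal_h[OF h goodD(1)[OF g(2)]] e d])
      have "(\<lambda>x. ?U y x - ?U y' x) = (\<lambda>x. (u y x - u y' x) - (u_h h y x - u_h h y' x))" by auto
      then have "V_norm D (\<lambda>x. ?U y x - ?U y' x) \<le> V_norm D (\<lambda>x. u y x - u y' x) + V_norm D (\<lambda>x. u_h h y x - u_h h y' x)"
        using V_norm_diff_le[OF H10_diff(1)[OF uH(1)[OF g(1)] uH(1)[OF g(2)]] H10_diff(1)[OF uH(2)[OF g(1)] uH(2)[OF g(2)]]]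
        by simp
      then show "V_norm D (\<lambda>x. ?U y x - ?U y' x) \<le> 2 * P * exp (3 * m) * e" using 1 2 by linarith
    qed (use goodD UH in auto)
    moreover have "(\<integral>\<^sup>+y. ennreal ((V_norm D (?U y))\<^sup>2) \<partial>gauss) < \<infinity>"
    proof -
      have "V_norm D (?U y) \<le> (2 * P) * exp (1 * r y)" if g: "good y" for y
      proof -
        have "V_norm D (u y) \<le> exp (r y) * P" unfolding P_def
          by (rule exp_galerkin_apriori[OF goodD(2,3)[OF g] f order_refl gal[OF goodD(1)[OF g]]])
        moreover have "V_norm D (u_h h y) \<le> exp (r y) * P" unfolding P_def
          by (rule exp_galerkin_apriori[OF goodD(2,3)[OF g] f S(1) gal_h[OF h goodD(1)[OF g]]])
        ultimately have "V_norm D (?U y) \<le> exp (r y) * P + exp (r y) * P"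
          using V_norm_diff_le[OF uH[OF g]] by linarith
        then show ?thesis by (simp add: mult_ac)
      qed
      from sq[OF _ this] P show ?thesis by (simp add: le_less_trans)
    qed
    ultimately have "?U \<in> bochner_L2 gauss D" by (simp add: bochner_L2_def)
    moreover have "bochner_L2_norm gauss D ?U \<le> C * real (n h) powr (- (\<alpha> * t))" if nh: "n h > 0"
    proof -
      (* The scale of mollification is the approximation error of V h. *)
      define \<delta> where "\<delta> = real (n h) powr (- t)"
      have \<delta>: "0 < \<delta>" "\<delta> \<le> 1"
        using nh assms(16) powr_mono[of "- t" 0 "real (n h)"] by (auto simp: \<delta>_def)
      have \<delta>\<alpha>: "\<delta> powr \<alpha> = real (n h) powr (- (\<alpha> * t))" by (simp add: \<delta>_def powr_powr mult.commute)
      have "V_norm D (?U y) \<le> (K * \<delta> powr \<alpha>) * exp (8 * r y)" if g: "good y" for y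
      proof -
        have "V_norm D (?U y) \<le> K * exp (8 * r y) * \<delta> powr \<alpha>"
          by (rule err[OF r(2) goodD(3,4)[OF g] S gal[OF goodD(1)[OF g]] gal_h[OF h goodD(1)[OF g]] \<delta>])
             (use app[OF h nh] in \<open>simp_all add: \<delta>_def\<close>)
        then show ?thesis by (simp add: mult_ac)
      qed
      then have "(\<integral>\<^sup>+y. ennreal ((V_norm D (?U y))\<^sup>2) \<partial>gauss) \<le> ennreal ((K * \<delta> powr \<alpha>)\<^sup>2 * E (2 * 8))"
        using K by (intro sq) auto
      then have "enn2real (\<integral>\<^sup>+y. ennreal ((V_norm D (?U y))\<^sup>2) \<partial>gauss) \<le> (K * \<delta> powr \<alpha>)\<^sup>2 * E 16"
        by (intro enn2real_leI) (auto simp: E_def)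
      then have "bochner_L2_norm gauss D ?U \<le> sqrt ((K * \<delta> powr \<alpha>)\<^sup>2 * E 16)"
        unfolding bochner_L2_norm_def by (rule real_sqrt_le_mono)
      also have "\<dots> = K * sqrt (E 16) * \<delta> powr \<alpha>" using K by (simp add: real_sqrt_mult)
      also have "\<dots> \<le> C * \<delta> powr \<alpha>" unfolding C_def by (intro mult_right_mono) auto
      finally show ?thesis unfolding \<delta>\<alpha> .
    qed
    ultimately show ?thesis by blast
  qed
  ultimately show ?thesis by blast
qed

end
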